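(* Let $A$ and $B$ be cyclic gapped filtered $A_\infty$-algebras, with $\overline{A}$ and $\overline{B}$ finite dimensional over $\boldsymbol{k}$, and let $h:B\to A$ be a cyclic gapped filtered $A_\infty$-homomorphism. Then the potentials $\Phi^A,\Phi^B$ are related by $$\Phi^B=(h^*\Phi^A)_c+\text{constant},$$ where $h^*$ is the change of coordinates determined by $h$, $(\ )_c$ means cyclization, and the constant is an element of the coefficient ring (independent of the formal variables).
   Context: $\boldsymbol{k}$ is a field of characteristic $0$. The universal Novikov ring is $\Lambda_{nov}=\{\sum_{i\ge0}a_iT^{\lambda_i}e^{n_i}\mid a_i\in\boldsymbol{k},\lambda_i\in\mathbb{R},n_i\in\mathbb{Z},\lim_{i\to\infty}\lambda_i=\infty\}$, with formal parameters $T$ of degree $0$ and $e$ of degree $2$; $\Lambda_{0,nov}$ is the subring with all $\lambda_i\ge0$, and the filtration $F^\lambda$ is given by $\lambda_i\ge\lambda$. For a graded space, $|x|'=|x|-1$ is the degree after the shift $[1]$. Gapped filtered $A_\infty$-algebras: let $G\subset\mathbb{R}_{\ge0}\times2\mathbb{Z}$ be a monoid whose projection to $\mathbb{R}_{\ge0}$ is discrete, with $G\cap(\{0\}\times2\mathbb{Z})=\{(0,0)\}$ and $G\cap(\{\lambda\}\times2\mathbb{Z})$ finite for all $\lambda$; write $\beta=(\lambda(\beta),\mu(\beta))\in G$. Let $\overline C$ be a graded $\boldsymbol{k}$-vector space and $C\cong\overline C\otimes_{\boldsymbol{k}}\Lambda_{0,nov}$. A $G$-gapped filtered $A_\infty$-algebra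 structure on $C$ consists of $\boldsymbol{k}$-linear maps $m_{k,\beta}:\overline C[1]^{\otimes k}\to\overline C[1]$, $k\ge0,\beta\in G$, such that the maps $m_k=\sum_{\beta\in G}T^{\lambda(\beta)}e^{\mu(\beta)/2}m_{k,\beta}$ (extended $\Lambda_{0,nov}$-linearly) have degree one, $m_0(1)\in F^{\lambda}C$ for some $\lambda>0$, and $$\sum_{k_1+k_2=k+1}\sum_i(-1)^{|x_1|'+\cdots+|x_{i-1}|'}m_{k_1}(x_1,\dots,x_{i-1},m_{k_2}(x_i,\dots,x_{i+k_2-1}),\dots,x_k)=0$$ for all $k\ge0$ (including terms with $m_0$). It is cyclic if it is equipped with a skew symmetric ($\langle a,b\rangle=-(-1)^{|a|'|b|'}\langle b,a\rangle$), non-degenerate bilinear map $\langle,\rangle:\overline C[1]\otimes\overline C[1]\to\boldsymbol{k}$ (of some fixed degree), extended linearly to $C$, such that for all $k\ge0$, $\beta\in G$, $$\langle m_{k,\beta}(x_1,\dots,x_k),x_{k+1}\rangle=(-1)^{|x_1|'(|x_2|'+\cdots+|x_{k+1}|')}\langle m_{k,\beta}(x_2,\dots,x_{k+1}),x_1\rangle.$$ A gapped filtered $A_\infty$-homomorphism $h:B\to A$ is a family $h_k=\sum_{\beta\in G}T^{\lambda(\beta)}e^{\mu(\beta)/2}h_{k,\beta}$, $k\ge0$, of degree zero maps $B[1]^{\otimes k}\to A[1]$ with $h_0(1)\in F^\lambda A$ for some $\lambda>0$, satisfying the $A_\infty$-homomorphism equations $\sum m^A(h(\dots),\dots,h(\dots))=\sum\pm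 h(\dots,m^B(\dots),\dots)$ with Koszul signs (the sums including $h_0$ and $m_0$ insertions). It is cyclic if (1) $\langle a,b\rangle=\langle h_{1,0}(a),h_{1,0}(b)\rangle$, where $h_{1,0}$ is the component with $\beta=0$; and (2) for every $k$ and $\beta\in G$ with $(k,\beta)\ne(2,0)$, $$\sum_{i+j=k,\ \beta_1+\beta_2=\beta}\langle h_{i,\beta_1}(x_1,\dots,x_i),h_{j,\beta_2}(x_{i+1},\dots,x_k)\rangle=0.$$ Potential: let $\{e_i\}$ be a homogeneous basis of $\overline A$ and $x_i$ formal non-commuting variables with $\deg x_i=-|e_i|'$. With $m^A_k(e_{i_1},\dots,e_{i_k})=\sum_j{}^Am^j_{i_1,\dots,i_k}e_j$ and $g_{i,j}=\langle e_i,e_j\rangle$, $$\Phi^A(\boldsymbol{x})=\sum_{k\ge0}\frac1{k+1}\langle m^A_k(\boldsymbol{x},\dots,\boldsymbol{x}),\boldsymbol{x}\rangle=\sum_{k\ge0}\frac{1}{k+1}\sum{}^Am^j_{i_1,\dots,i_k}\,g_{j,i_{k+1}}\,x_{i_1}x_{i_2}\cdots x_{i_{k+1}},\qquad \boldsymbol{x}=\sum_ie_ix_i,$$ a formal series in non-commuting variables with coefficients in $\Lambda_{0,nov}$. $\Phi^B$ is defined in the same way using a basis $\{f_j\}$ of $\overline B$ and variables $y_j$. Change of coordinates: with $h_k(f_{j_1},\dots,f_{j_k})=\sum_ih^i_{j_1,\dots,j_k}e_i$ and $h_0(1)=\sum_ih^ie_i$, $h^*\Phi^A$ is obtained from $\Phi^A$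 by substituting $$x_i\mapsto h^i+\sum_{j}h^i_{j}y_{j}+\sum_{j_1,j_2} h^i_{j_1,j_2}y_{j_1}y_{j_2}+\cdots .$$ Cyclization $(\ )_c$ is the linear operation replacing each monomial $y_{j_1}\cdots y_{j_n}$ by the average of its $n$ cyclic rotations, each taken with its Koszul sign (for the degrees of the $y_j$). *)

theory Defs
  imports "HOL-Analysis.Analysis"
begin

section \<open>The universal Novikov ring\<close>

text \<open>
  \<open>'v novikov\<close> is the set of series \<open>\<Sum> a\<^sub>i T^\<lambda>\<^sub>i e^n\<^sub>i\<close> with \<open>a\<^sub>i\<close> in \<open>'v\<close>,
  \<open>\<lambda>\<^sub>i \<ge> 0\<close> and \<open>\<lambda>\<^sub>i \<rightarrow> \<infinity>\<close>, encoded by the coefficient function of \<open>(\<lambda>, n)\<close>.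
  For a field \<open>'k\<close>, \<open>'k novikov\<close> is the ring \<open>\<Lambda>\<^sub>0\<^sub>,\<^sub>n\<^sub>o\<^sub>v\<close>.  For a vector space \<open>'v\<close> over \<open>'k\<close>,
  \<open>'v novikov\<close> is the (completed) tensor product of \<open>'v\<close> with \<open>\<Lambda>\<^sub>0\<^sub>,\<^sub>n\<^sub>o\<^sub>v\<close>; if \<open>'v\<close> is
  finite dimensional, this is the ordinary tensor product.
\<close>

typedef (overloaded) 'v novikov =
  "{c :: real \<times> int \<Rightarrow> 'v::zero.
     (\<forall>\<gamma>. c \<gamma> \<noteq> 0 \<longrightarrow> 0 \<le> fst \<gamma>) \<and> (\<forall>E. finite {\<gamma>. c \<gamma> \<noteq> 0 \<and> fst \<gamma> \<le> E})}"
  morphisms nov_coeff Abs_novikov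
  by (rule exI[of _ "\<lambda>_. 0"]) simp

setup_lifting type_definition_novikov

lemma novikov_eqI: "(\<And>\<gamma>. nov_coeff X \<gamma> = nov_coeff Y \<gamma>) \<Longrightarrow> X = Y"
  by (metis ext nov_coeff_inject)

lemma nov_coeff_nonneg: "nov_coeff X \<gamma> \<noteq> 0 \<Longrightarrow> 0 \<le> fst \<gamma>"
  using nov_coeff[of X] by blast

lemma finite_nov_coeff: "finite {\<gamma>. nov_coeff X \<gamma> \<noteq> 0 \<and> fst \<gamma> \<le> E}"
  using nov_coeff[of X] by auto

instantiation novikov :: (zero) zero
begin
lift_definition zero_novikov :: "'a novikov" is "\<lambda>_. 0" by simp
instance ..
end

instantiation novikov :: (ab_group_add) ab_group_add
begin

lift_definition plus_novikov :: "'a novikov \<Rightarrow> 'a novikov \<Rightarrow> 'a novikov"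
  is "\<lambda>f g \<gamma>. f \<gamma> + g \<gamma>"
proof (intro conjI allI)
  fix f g :: "real \<times> int \<Rightarrow> 'a" and E :: real
  assume a: "(\<forall>\<gamma>. f \<gamma> \<noteq> 0 \<longrightarrow> 0 \<le> fst \<gamma>) \<and> (\<forall>E. finite {\<gamma>. f \<gamma> \<noteq> 0 \<and> fst \<gamma> \<le> E})"
    and b: "(\<forall>\<gamma>. g \<gamma> \<noteq> 0 \<longrightarrow> 0 \<le> fst \<gamma>) \<and> (\<forall>E. finite {\<gamma>. g \<gamma> \<noteq> 0 \<and> fst \<gamma> \<le> E})"
  show "f \<gamma> + g \<gamma> \<noteq> 0 \<longrightarrow> 0 \<le> fst \<gamma>" for \<gamma> using a b by (metis add.right_neutral)
  show "finite {\<gamma>. f \<gamma> + g \<gamma> \<noteq> 0 \<and> fst \<gamma> \<le> E}"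
    by (rule finite_subset[of _ "{\<gamma>. f \<gamma> \<noteq> 0 \<and> fst \<gamma> \<le> E} \<union> {\<gamma>. g \<gamma> \<noteq> 0 \<and> fst \<gamma> \<le> E}"])
       (use a b in auto)
qed

lift_definition uminus_novikov :: "'a novikov \<Rightarrow> 'a novikov" is "\<lambda>f \<gamma>. - f \<gamma>" by simp

definition minus_novikov :: "'a novikov \<Rightarrow> 'a novikov \<Rightarrow> 'a novikov"
  where "minus_novikov X Y = X + (- Y)"

instance
  by standard (unfold minus_novikov_def, (transfer, force simp: algebra_simps)+)
end

lift_definition nov_monom :: "real \<times> int \<Rightarrow> 'v::zero \<Rightarrow> 'v novikov"
  is "\<lambda>\<gamma> v \<delta>. if \<delta> = \<gamma> \<and> 0 \<le> fst \<gamma> then v else 0"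
proof (intro conjI allI)
  fix \<gamma> :: "real \<times> int" and v :: 'v and E :: real
  show "finite {\<delta>. (if \<delta> = \<gamma> \<and> 0 \<le> fst \<gamma> then v else 0) \<noteq> 0 \<and> fst \<delta> \<le> E}"
    by (rule finite_subset[of _ "{\<gamma>}"]) auto
qed auto

abbreviation nov_const :: "'v::zero \<Rightarrow> 'v novikov"
  where "nov_const \<equiv> nov_monom 0"

instantiation novikov :: (comm_ring_1) comm_ring_1
begin

definition one_novikov :: "'a novikov" where "1 = nov_const 1"

lift_definition times_novikov :: "'a novikov \<Rightarrow> 'a novikov \<Rightarrow> 'a novikov"
  is "\<lambda>f g \<gamma>. \<Sum>\<alpha> | f \<alpha> \<noteq> 0 \<and> fst \<alpha> \<le> fst \<gamma>. f \<alpha> * g (\<gamma> - \<alpha>)"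
proof (intro conjI allI)
  fix f g :: "real \<times> int \<Rightarrow> 'a" and E :: real
  let ?p = "\<lambda>\<gamma>. \<Sum>\<alpha> | f \<alpha> \<noteq> 0 \<and> fst \<alpha> \<le> fst \<gamma>. f \<alpha> * g (\<gamma> - \<alpha>)"
  assume a: "(\<forall>\<gamma>. f \<gamma> \<noteq> 0 \<longrightarrow> 0 \<le> fst \<gamma>) \<and> (\<forall>E. finite {\<gamma>. f \<gamma> \<noteq> 0 \<and> fst \<gamma> \<le> E})"
    and b: "(\<forall>\<gamma>. g \<gamma> \<noteq> 0 \<longrightarrow> 0 \<le> fst \<gamma>) \<and> (\<forall>E. finite {\<gamma>. g \<gamma> \<noteq> 0 \<and> fst \<gamma> \<le> E})"
  have ex: "\<exists>\<alpha> \<beta>. f \<alpha> \<noteq> 0 \<and> g \<beta> \<noteq> 0 \<and> \<gamma> = \<alpha> + \<beta>" if nz: "?p \<gamma> \<noteq> 0" for \<gamma>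
  proof -
    obtain \<alpha> where "f \<alpha> \<noteq> 0" "f \<alpha> * g (\<gamma> - \<alpha>) \<noteq> 0"
      using sum.not_neutral_contains_not_neutral[OF nz] by blast
    thus ?thesis by (intro exI[of _ \<alpha>] exI[of _ "\<gamma> - \<alpha>"]) auto
  qed
  show "?p \<gamma> \<noteq> 0 \<longrightarrow> 0 \<le> fst \<gamma>" for \<gamma>
  proof
    assume "?p \<gamma> \<noteq> 0"
    from ex[OF this] obtain \<alpha> \<beta> where *: "f \<alpha> \<noteq> 0" "g \<beta> \<noteq> 0" "\<gamma> = \<alpha> + \<beta>" by blast
    have "0 \<le> fst \<alpha>" "0 \<le> fst \<beta>" using * a b by blast+
    thus "0 \<le> fst \<gamma>" using *(3) by simp
  qed
  let ?S = "\<lambda>f. {\<gamma>. f \<gamma> \<noteq> (0::'a) \<and> fst \<gamma> \<le> E}"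
  show "finite {\<gamma>. ?p \<gamma> \<noteq> 0 \<and> fst \<gamma> \<le> E}"
  proof (rule finite_subset[of _ "(\<lambda>(\<alpha>, \<beta>). \<alpha> + \<beta>) ` (?S f \<times> ?S g)"])
    show "{\<gamma>. ?p \<gamma> \<noteq> 0 \<and> fst \<gamma> \<le> E} \<subseteq> (\<lambda>(\<alpha>, \<beta>). \<alpha> + \<beta>) ` (?S f \<times> ?S g)"
    proof safe
      fix l n assume "?p (l, n) \<noteq> 0" and E: "fst (l, n) \<le> E"
      from ex[OF this(1)] obtain \<alpha> \<beta> where
        *: "f \<alpha> \<noteq> 0" "g \<beta> \<noteq> 0" "(l, n) = \<alpha> + \<beta>" by blast
      have "0 \<le> fst \<alpha>" "0 \<le> fst \<beta>" using * a b by blast+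
      moreover have "fst \<alpha> + fst \<beta> \<le> E" using E *(3) by (metis fst_add)
      ultimately have "fst \<alpha> \<le> E" "fst \<beta> \<le> E" by linarith+
      thus "(l, n) \<in> (\<lambda>(\<alpha>, \<beta>). \<alpha> + \<beta>) ` (?S f \<times> ?S g)"
        using * by (intro image_eqI[of _ _ "(\<alpha>, \<beta>)"]) auto
    qed
    show "finite ((\<lambda>(\<alpha>, \<beta>). \<alpha> + \<beta>) ` (?S f \<times> ?S g))"
      using a b by (intro finite_imageI finite_cartesian_product) auto
  qed
qed

lemma nov_coeff_times:
  fixes X Y :: "'a novikov"
  assumes "finite S" "{\<alpha>. nov_coeff X \<alpha> \<noteq> 0 \<and> fst \<alpha> \<le> fst \<gamma>} \<subseteq> S"
  shows "nov_coeff (X * Y) \<gamma> = (\<Sum>\<alpha>\<in>S. nov_coeff X \<alpha> * nov_coeff Y (\<gamma> - \<alpha>))"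
  unfolding times_novikov.rep_eq
proof (rule sum.mono_neutral_left)
  show "\<forall>\<alpha>\<in>S - {\<alpha>. nov_coeff X \<alpha> \<noteq> 0 \<and> fst \<alpha> \<le> fst \<gamma>}.
          nov_coeff X \<alpha> * nov_coeff Y (\<gamma> - \<alpha>) = 0"
  proof
    fix \<alpha> assume "\<alpha> \<in> S - {\<alpha>. nov_coeff X \<alpha> \<noteq> 0 \<and> fst \<alpha> \<le> fst \<gamma>}"
    hence "nov_coeff X \<alpha> = 0 \<or> \<not> 0 \<le> fst (\<gamma> - \<alpha>)" by auto
    thus "nov_coeff X \<alpha> * nov_coeff Y (\<gamma> - \<alpha>) = 0"
      using nov_coeff_nonneg[of Y "\<gamma> - \<alpha>"] by force
  qed
qed (fact assms)+

instance
proof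
  fix X Y Z :: "'a novikov"
  let ?c = nov_coeff
  let ?S = "\<lambda>X E. {\<alpha>. ?c X \<alpha> \<noteq> 0 \<and> fst \<alpha> \<le> (E::real)}"
  have fin: "finite (?S X E)" for X :: "'a novikov" and E by (rule finite_nov_coeff)
  show comm: "X * Y = Y * X" for X Y :: "'a novikov"
  proof (rule novikov_eqI)
    fix \<gamma> :: "real \<times> int"
    let ?A = "?S X (fst \<gamma>) \<union> (\<lambda>\<beta>. \<gamma> - \<beta>) ` ?S Y (fst \<gamma>)"
    let ?B = "?S Y (fst \<gamma>) \<union> (\<lambda>\<beta>. \<gamma> - \<beta>) ` ?S X (fst \<gamma>)"
    have "?c (X * Y) \<gamma> = (\<Sum>\<alpha>\<in>?A. ?c X \<alpha> * ?c Y (\<gamma> - \<alpha>))"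
      using fin by (intro nov_coeff_times) auto
    also have "\<dots> = (\<Sum>\<beta>\<in>?B. ?c X (\<gamma> - \<beta>) * ?c Y \<beta>)"
      by (rule sum.reindex_bij_witness[of _ "\<lambda>\<beta>. \<gamma> - \<beta>" "\<lambda>\<beta>. \<gamma> - \<beta>"]) auto
    also have "\<dots> = ?c (Y * X) \<gamma>"
      using fin by (subst nov_coeff_times[of ?B]) (auto intro!: sum.cong simp: mult.commute)
    finally show "?c (X * Y) \<gamma> = ?c (Y * X) \<gamma>" .
  qed
  show "X * Y * Z = X * (Y * Z)"
  proof (rule novikov_eqI)
    fix \<gamma> :: "real \<times> int"
    let ?E = "fst \<gamma>"
    let ?P = "(\<lambda>(\<alpha>, \<beta>). \<alpha> + \<beta>) ` (?S X ?E \<times> ?S Y ?E)"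
    have finP: "finite ?P" using fin by auto
    have sub: "?S (X * Y) ?E \<subseteq> ?P"
    proof safe
      fix l n assume nz: "?c (X * Y) (l, n) \<noteq> 0" and le: "fst (l, n) \<le> ?E"
      obtain \<alpha> where \<alpha>: "?c X \<alpha> \<noteq> 0" "?c X \<alpha> * ?c Y ((l, n) - \<alpha>) \<noteq> 0"
        using sum.not_neutral_contains_not_neutral[OF nz[unfolded times_novikov.rep_eq]] by blast
      have y: "?c Y ((l, n) - \<alpha>) \<noteq> 0" using \<alpha> by auto
      have "0 \<le> fst \<alpha>" "0 \<le> fst ((l, n) - \<alpha>)"
        by (rule nov_coeff_nonneg[OF \<alpha>(1)], rule nov_coeff_nonneg[OF y])
      thus "(l, n) \<in> ?P" using \<alpha>(1) y le
        by (intro image_eqI[of _ _ "(\<alpha>, (l, n) - \<alpha>)"]) auto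
    qed
    have "?c (X * Y * Z) \<gamma> = (\<Sum>\<delta>\<in>?P. ?c (X * Y) \<delta> * ?c Z (\<gamma> - \<delta>))"
      using finP sub by (rule nov_coeff_times)
    also have "\<dots> = (\<Sum>\<delta>\<in>?P. \<Sum>\<alpha>\<in>?S X ?E. ?c X \<alpha> * ?c Y (\<delta> - \<alpha>) * ?c Z (\<gamma> - \<delta>))"
    proof (rule sum.cong[OF refl])
      fix \<delta> assume "\<delta> \<in> ?P"
      show "?c (X * Y) \<delta> * ?c Z (\<gamma> - \<delta>) =
            (\<Sum>\<alpha>\<in>?S X ?E. ?c X \<alpha> * ?c Y (\<delta> - \<alpha>) * ?c Z (\<gamma> - \<delta>))"
      proof (cases "fst \<delta> \<le> ?E")
        case True
        have "?c (X * Y) \<delta> = (\<Sum>\<alpha>\<in>?S X ?E. ?c X \<alpha> * ?c Y (\<delta> - \<alpha>))"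
          using True by (intro nov_coeff_times fin) auto
        thus ?thesis by (simp add: sum_distrib_right)
      next
        case False
        hence "\<not> 0 \<le> fst (\<gamma> - \<delta>)" by simp
        hence "?c Z (\<gamma> - \<delta>) = 0" using nov_coeff_nonneg by blast
        thus ?thesis by simp
      qed
    qed
    also have "\<dots> = (\<Sum>\<alpha>\<in>?S X ?E. \<Sum>\<delta>\<in>?P. ?c X \<alpha> * ?c Y (\<delta> - \<alpha>) * ?c Z (\<gamma> - \<delta>))"
      by (rule sum.swap)
    also have "\<dots> = (\<Sum>\<alpha>\<in>?S X ?E. ?c X \<alpha> * ?c (Y * Z) (\<gamma> - \<alpha>))"
    proof (rule sum.cong[OF refl])
      fix \<alpha> assume \<alpha>: "\<alpha> \<in> ?S X ?E"
      have nn: "0 \<le> fst \<alpha>" using \<alpha> nov_coeff_nonneg[of X \<alpha>] by blast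
      have "?c (Y * Z) (\<gamma> - \<alpha>) = (\<Sum>\<beta>\<in>?S Y ?E. ?c Y \<beta> * ?c Z (\<gamma> - \<alpha> - \<beta>))"
        using nn by (intro nov_coeff_times fin) auto
      also have "\<dots> = (\<Sum>\<delta>\<in>(+) \<alpha> ` ?S Y ?E. ?c Y (\<delta> - \<alpha>) * ?c Z (\<gamma> - \<delta>))"
        by (subst sum.reindex) (auto simp: inj_on_def algebra_simps)
      also have "\<dots> = (\<Sum>\<delta>\<in>?P. ?c Y (\<delta> - \<alpha>) * ?c Z (\<gamma> - \<delta>))"
      proof (rule sum.mono_neutral_left[OF finP])
        show "(+) \<alpha> ` ?S Y ?E \<subseteq> ?P"
        proof
          fix \<delta> assume "\<delta> \<in> (+) \<alpha> ` ?S Y ?E"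
          then obtain \<beta> where "\<beta> \<in> ?S Y ?E" "\<delta> = \<alpha> + \<beta>" by blast
          thus "\<delta> \<in> ?P" using \<alpha> by (intro image_eqI[of _ _ "(\<alpha>, \<beta>)"]) simp_all
        qed
        show "\<forall>\<delta>\<in>?P - (+) \<alpha> ` ?S Y ?E. ?c Y (\<delta> - \<alpha>) * ?c Z (\<gamma> - \<delta>) = 0"
        proof
          fix \<delta> assume d: "\<delta> \<in> ?P - (+) \<alpha> ` ?S Y ?E"
          have "\<delta> - \<alpha> \<notin> ?S Y ?E"
          proof
            assume "\<delta> - \<alpha> \<in> ?S Y ?E"
            hence "\<delta> \<in> (+) \<alpha> ` ?S Y ?E" by (intro image_eqI[of _ _ "\<delta> - \<alpha>"]) auto
            thus False using d by blast
          qed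
          moreover have "?c Z (\<gamma> - \<delta>) = 0" if "fst (\<delta> - \<alpha>) > ?E"
          proof -
            have "\<not> 0 \<le> fst (\<gamma> - \<delta>)" using that nn by simp
            thus ?thesis using nov_coeff_nonneg by blast
          qed
          ultimately have "?c Y (\<delta> - \<alpha>) = 0 \<or> ?c Z (\<gamma> - \<delta>) = 0"
            using linorder_not_le by blast
          thus "?c Y (\<delta> - \<alpha>) * ?c Z (\<gamma> - \<delta>) = 0" by (metis mult_zero_left mult_zero_right)
        qed
      qed
      finally show "(\<Sum>\<delta>\<in>?P. ?c X \<alpha> * ?c Y (\<delta> - \<alpha>) * ?c Z (\<gamma> - \<delta>)) =
                    ?c X \<alpha> * ?c (Y * Z) (\<gamma> - \<alpha>)"
        by (simp add: sum_distrib_left mult.assoc)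
    qed
    also have "\<dots> = ?c (X * (Y * Z)) \<gamma>"
      by (rule nov_coeff_times[symmetric]) (auto intro: fin)
    finally show "?c (X * Y * Z) \<gamma> = ?c (X * (Y * Z)) \<gamma>" .
  qed
  show "1 * X = X"
  proof (rule novikov_eqI)
    fix \<gamma> :: "real \<times> int"
    have "?c (1 * X) \<gamma> = (\<Sum>\<alpha>\<in>{0}. ?c 1 \<alpha> * ?c X (\<gamma> - \<alpha>))"
      by (rule nov_coeff_times) (auto simp: one_novikov_def nov_monom.rep_eq)
    thus "?c (1 * X) \<gamma> = ?c X \<gamma>"
      by (simp add: one_novikov_def nov_monom.rep_eq)
  qed
  show "(X + Y) * Z = X * Z + Y * Z"
  proof (rule novikov_eqI)
    fix \<gamma> :: "real \<times> int"
    let ?U = "?S X (fst \<gamma>) \<union> ?S Y (fst \<gamma>)"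
    have "?c ((X + Y) * Z) \<gamma> = (\<Sum>\<alpha>\<in>?U. ?c (X + Y) \<alpha> * ?c Z (\<gamma> - \<alpha>))"
      using fin by (intro nov_coeff_times) (auto simp: plus_novikov.rep_eq)
    also have "\<dots> = (\<Sum>\<alpha>\<in>?U. ?c X \<alpha> * ?c Z (\<gamma> - \<alpha>)) + (\<Sum>\<alpha>\<in>?U. ?c Y \<alpha> * ?c Z (\<gamma> - \<alpha>))"
      by (simp add: plus_novikov.rep_eq algebra_simps sum.distrib)
    also have "(\<Sum>\<alpha>\<in>?U. ?c X \<alpha> * ?c Z (\<gamma> - \<alpha>)) = ?c (X * Z) \<gamma>"
      using fin by (intro nov_coeff_times[symmetric]) auto
    also have "(\<Sum>\<alpha>\<in>?U. ?c Y \<alpha> * ?c Z (\<gamma> - \<alpha>)) = ?c (Y * Z) \<gamma>"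
      using fin by (intro nov_coeff_times[symmetric]) auto
    finally show "?c ((X + Y) * Z) \<gamma> = ?c (X * Z + Y * Z) \<gamma>"
      by (simp add: plus_novikov.rep_eq)
  qed
  show "(0 :: 'a novikov) \<noteq> 1"
  proof
    assume "(0 :: 'a novikov) = 1"
    hence "?c (0 :: 'a novikov) 0 = ?c 1 0" by simp
    thus False by (simp add: zero_novikov.rep_eq one_novikov_def nov_monom.rep_eq)
  qed
qed
end

definition nov_filtration :: "real \<Rightarrow> 'v::zero novikov set" where
  "nov_filtration l = {X. \<forall>\<gamma>. nov_coeff X \<gamma> \<noteq> 0 \<longrightarrow> l \<le> fst \<gamma>}"

text \<open>
  Infinite sums are taken in the topology defined by the filtration: a family is summable if
  it tends to \<open>0\<close>.  As for other infinite sums in HOL, a divergent family has sum \<open>0\<close>.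
\<close>

definition nov_summable :: "('i \<Rightarrow> 'v::zero novikov) \<Rightarrow> 'i set \<Rightarrow> bool" where
  "nov_summable F I \<longleftrightarrow> (\<forall>E. finite {i\<in>I. F i \<notin> nov_filtration E})"

lift_definition nov_sum :: "('i \<Rightarrow> 'v::ab_group_add novikov) \<Rightarrow> 'i set \<Rightarrow> 'v novikov"
  is "\<lambda>F I \<gamma>. if nov_summable F I
              then \<Sum>i | i \<in> I \<and> nov_coeff (F i) \<gamma> \<noteq> 0. nov_coeff (F i) \<gamma> else 0"
proof -
  fix F :: "'i \<Rightarrow> 'v novikov" and I :: "'i set"
  let ?s = "\<lambda>\<gamma>. if nov_summable F I
              then \<Sum>i | i \<in> I \<and> nov_coeff (F i) \<gamma> \<noteq> 0. nov_coeff (F i) \<gamma> else 0"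
  have ex: "nov_summable F I \<and> (\<exists>i\<in>I. nov_coeff (F i) \<gamma> \<noteq> 0)" if nz: "?s \<gamma> \<noteq> 0" for \<gamma>
  proof -
    have s: "nov_summable F I" using nz by presburger
    hence "(\<Sum>i | i \<in> I \<and> nov_coeff (F i) \<gamma> \<noteq> 0. nov_coeff (F i) \<gamma>) \<noteq> 0" using nz by simp
    from sum.not_neutral_contains_not_neutral[OF this] show ?thesis using s by auto
  qed
  have "finite {\<gamma>. ?s \<gamma> \<noteq> 0 \<and> fst \<gamma> \<le> E}" for E
  proof (cases "nov_summable F I")
    case True
    let ?J = "{i\<in>I. F i \<notin> nov_filtration (E + 1)}"
    have "{\<gamma>. ?s \<gamma> \<noteq> 0 \<and> fst \<gamma> \<le> E} \<subseteq> (\<Union>i\<in>?J. {\<gamma>. nov_coeff (F i) \<gamma> \<noteq> 0 \<and> fst \<gamma> \<le> E})"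
    proof
      fix \<gamma> assume g: "\<gamma> \<in> {\<gamma>. ?s \<gamma> \<noteq> 0 \<and> fst \<gamma> \<le> E}"
      then obtain i where i: "i \<in> I" "nov_coeff (F i) \<gamma> \<noteq> 0" using ex[of \<gamma>] by blast
      have le: "fst \<gamma> \<le> E" using g by blast
      have "F i \<notin> nov_filtration (E + 1)"
      proof
        assume "F i \<in> nov_filtration (E + 1)"
        hence "E + 1 \<le> fst \<gamma>" using i unfolding nov_filtration_def by blast
        thus False using le by linarith
      qed
      thus "\<gamma> \<in> (\<Union>i\<in>?J. {\<gamma>. nov_coeff (F i) \<gamma> \<noteq> 0 \<and> fst \<gamma> \<le> E})" using i le by blast
    qed
    moreover have "finite (\<Union>i\<in>?J. {\<gamma>. nov_coeff (F i) \<gamma> \<noteq> 0 \<and> fst \<gamma> \<le> E})"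
      using True finite_nov_coeff unfolding nov_summable_def by blast
    ultimately show ?thesis by (rule finite_subset)
  qed simp
  moreover have "0 \<le> fst \<gamma>" if "?s \<gamma> \<noteq> 0" for \<gamma>
    using ex[OF that] nov_coeff_nonneg by blast
  ultimately show "(\<forall>\<gamma>. ?s \<gamma> \<noteq> 0 \<longrightarrow> 0 \<le> fst \<gamma>) \<and>
                   (\<forall>E. finite {\<gamma>. ?s \<gamma> \<noteq> 0 \<and> fst \<gamma> \<le> E})" by blast
qed

text \<open>Coefficientwise application of a map that preserves \<open>0\<close>.\<close>

lift_definition nov_map :: "('v::zero \<Rightarrow> 'w::zero) \<Rightarrow> 'v novikov \<Rightarrow> 'w novikov"
  is "\<lambda>\<phi> c \<gamma>. if c \<gamma> = 0 then 0 else \<phi> (c \<gamma>)"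
proof (intro conjI allI)
  fix \<phi> :: "'v \<Rightarrow> 'w" and c :: "real \<times> int \<Rightarrow> 'v" and E :: real
  assume "(\<forall>\<gamma>. c \<gamma> \<noteq> 0 \<longrightarrow> 0 \<le> fst \<gamma>) \<and> (\<forall>E. finite {\<gamma>. c \<gamma> \<noteq> 0 \<and> fst \<gamma> \<le> E})"
  thus "finite {\<gamma>. (if c \<gamma> = 0 then 0 else \<phi> (c \<gamma>)) \<noteq> 0 \<and> fst \<gamma> \<le> E}"
    by (auto elim!: rev_finite_subset)
qed auto


section \<open>Gapped filtered A-infinity algebras\<close>

text \<open>\<open>koszul n x\<close> is \<open>(-1)^n x\<close>.\<close>

definition koszul :: "int \<Rightarrow> 'a::ab_group_add \<Rightarrow> 'a" where
  "koszul n x = (if even n then x else - x)"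

text \<open>
  Gradings are always the unshifted ones, so an element of degree \<open>d\<close> has degree \<open>d - 1\<close>
  after the shift \<open>[1]\<close>; this is the sum of these shifted degrees.
\<close>

definition shifted_degree :: "int list \<Rightarrow> int" where
  "shifted_degree ds = (\<Sum>d\<leftarrow>ds. d - 1)"

locale graded_vector_space = vector_space scale
  for scale :: "'k::field \<Rightarrow> 'a::ab_group_add \<Rightarrow> 'a" +
  fixes gr :: "int \<Rightarrow> 'a set"
  assumes subspace_gr: "subspace (gr d)"
    and direct_sum: "\<exists>!c. (\<forall>d. c d \<in> gr d) \<and> finite {d. c d \<noteq> 0} \<and> v = (\<Sum>d | c d \<noteq> 0. c d)"

text \<open>The degree on the Novikov extension, where \<open>T\<close> has degree \<open>0\<close> and \<open>e\<close> has degree \<open>2\<close>.\<close>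

definition nov_homogeneous :: "(int \<Rightarrow> 'a::zero set) \<Rightarrow> int \<Rightarrow> 'a novikov \<Rightarrow> bool" where
  "nov_homogeneous gr d X \<longleftrightarrow> (\<forall>l n. nov_coeff X (l, n) \<in> gr (d - 2 * n))"

text \<open>
  A map defined on the \<open>k\<close>-fold tensor power is encoded by a multilinear function on lists
  of length \<open>k\<close>.
\<close>

definition multilinear ::
  "nat \<Rightarrow> ('k::field \<Rightarrow> 'a::ab_group_add \<Rightarrow> 'a) \<Rightarrow> ('k \<Rightarrow> 'b::ab_group_add \<Rightarrow> 'b)
    \<Rightarrow> ('a list \<Rightarrow> 'b) \<Rightarrow> bool" where
  "multilinear k s1 s2 f \<longleftrightarrow>
    (\<forall>xs i. length xs = k \<and> i < k \<longrightarrow> Vector_Spaces.linear s1 s2 (\<lambda>x. f (xs[i := x])))"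

text \<open>
  Discreteness of the set of energies means that it has no accumulation point in the real
  line; this is what makes the sums over \<open>G\<close> below converge.
\<close>

locale gapping_monoid =
  fixes G :: "(real \<times> int) set"
  assumes nonneg_even: "\<beta> \<in> G \<Longrightarrow> 0 \<le> fst \<beta> \<and> even (snd \<beta>)"
    and zero_mem: "0 \<in> G"
    and add_mem: "\<beta> \<in> G \<Longrightarrow> \<beta>' \<in> G \<Longrightarrow> \<beta> + \<beta>' \<in> G"
    and discrete: "\<not> l islimpt (fst ` G)"
    and zero_energy: "G \<inter> ({0} \<times> UNIV) = {0}"
    and finite_energy: "finite (G \<inter> ({l} \<times> UNIV))"

text \<open>
  The \<open>\<Lambda>\<^sub>0\<^sub>,\<^sub>n\<^sub>o\<^sub>v\<close>-multilinear extension of the maps \<open>f\<^sub>k = \<Sum>\<^sub>\<beta> T^\<lambda>(\<beta>) e^(\<mu>(\<beta>)/2) f\<^sub>k\<^sub>,\<^sub>\<beta>\<close>,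
  evaluated on a list of length \<open>k\<close>: every argument is expanded as
  \<open>X = \<Sum>\<^sub>\<gamma> T^(fst \<gamma>) e^(snd \<gamma>) X\<^sub>\<gamma>\<close>.
\<close>

definition nov_extend ::
  "(real \<times> int) set \<Rightarrow> (nat \<Rightarrow> real \<times> int \<Rightarrow> 'a::zero list \<Rightarrow> 'b::ab_group_add)
    \<Rightarrow> 'a novikov list \<Rightarrow> 'b novikov" where
  "nov_extend G f Xs =
    nov_sum (\<lambda>(\<beta>, \<gamma>s). nov_monom ((fst \<beta>, snd \<beta> div 2) + sum_list \<gamma>s)
                         (f (length Xs) \<beta> (map2 nov_coeff Xs \<gamma>s)))
      (G \<times> {\<gamma>s. length \<gamma>s = length Xs})"

text \<open>
  In \<open>ainf_relation\<close>, the inner operation takes \<open>j\<close> arguments after the first \<open>i\<close> ones.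
\<close>

locale gapped_ainf_algebra = gapping_monoid G + graded_vector_space scale gr
  for G :: "(real \<times> int) set"
    and scale :: "'k::field_char_0 \<Rightarrow> 'a::ab_group_add \<Rightarrow> 'a"
    and gr :: "int \<Rightarrow> 'a set" +
  fixes m :: "nat \<Rightarrow> real \<times> int \<Rightarrow> 'a list \<Rightarrow> 'a"
  assumes m_multilinear: "\<beta> \<in> G \<Longrightarrow> multilinear k scale scale (m k \<beta>)"
    and m_degree: "list_all2 (nov_homogeneous gr) ds Xs \<Longrightarrow>
      nov_homogeneous gr (shifted_degree ds + 1 + 1) (nov_extend G m Xs)"
    and m_curvature: "\<exists>l>0. nov_extend G m [] \<in> nov_filtration l"
    and ainf_relation: "list_all2 (nov_homogeneous gr) ds Xs \<Longrightarrow>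
      (\<Sum>(i, j) | i + j \<le> length Xs.
         koszul (shifted_degree (take i ds))
           (nov_extend G m
              (take i Xs @ [nov_extend G m (take j (drop i Xs))] @ drop (i + j) Xs))) = 0"

locale cyclic_gapped_ainf_algebra = gapped_ainf_algebra G scale gr m
  for G :: "(real \<times> int) set"
    and scale :: "'k::field_char_0 \<Rightarrow> 'a::ab_group_add \<Rightarrow> 'a"
    and gr :: "int \<Rightarrow> 'a set"
    and m :: "nat \<Rightarrow> real \<times> int \<Rightarrow> 'a list \<Rightarrow> 'a" +
  fixes pair :: "'a \<Rightarrow> 'a \<Rightarrow> 'k"
  assumes pair_linear_left: "Vector_Spaces.linear scale (*) (\<lambda>a. pair a b)"
    and pair_linear_right: "Vector_Spaces.linear scale (*) (\<lambda>b. pair a b)"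
    and pair_degree: "\<exists>D. \<forall>p q. \<forall>a\<in>gr p. \<forall>b\<in>gr q.
      pair a b \<noteq> 0 \<longrightarrow> (p - 1) + (q - 1) + D = 0"
    and pair_skew: "a \<in> gr p \<Longrightarrow> b \<in> gr q \<Longrightarrow>
      pair a b = - koszul ((p - 1) * (q - 1)) (pair b a)"
    and pair_nondegenerate: "(\<forall>b. pair a b = 0) \<Longrightarrow> a = 0"
    and m_cyclic: "\<beta> \<in> G \<Longrightarrow> x \<in> gr d \<Longrightarrow> list_all2 (\<lambda>d x. x \<in> gr d) ds xs \<Longrightarrow> length xs = k \<Longrightarrow>
      pair (m k \<beta> (butlast (x # xs))) (last (x # xs)) =
        koszul ((d - 1) * shifted_degree ds) (pair (m k \<beta> xs) x)"


section \<open>Cyclic homomorphisms\<close>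

text \<open>
  A decomposition of the list of arguments into \<open>r\<close> consecutive, possibly empty, blocks is a
  list \<open>bs\<close> of length \<open>r\<close> with \<open>concat bs = Xs\<close>; each empty block gives an insertion of \<open>h\<^sub>0(1)\<close>.
\<close>

locale gapped_ainf_hom =
    dom: gapped_ainf_algebra G sB grB mB + cod: gapped_ainf_algebra G sA grA mA
  for G :: "(real \<times> int) set"
    and sB :: "'k::field_char_0 \<Rightarrow> 'b::ab_group_add \<Rightarrow> 'b" and grB mB
    and sA :: "'k \<Rightarrow> 'a::ab_group_add \<Rightarrow> 'a" and grA mA +
  fixes h :: "nat \<Rightarrow> real \<times> int \<Rightarrow> 'b list \<Rightarrow> 'a"
  assumes h_multilinear: "\<beta> \<in> G \<Longrightarrow> multilinear k sB sA (h k \<beta>)"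
    and h_degree: "list_all2 (nov_homogeneous grB) ds Xs \<Longrightarrow>
      nov_homogeneous grA (shifted_degree ds + 1) (nov_extend G h Xs)"
    and h_curvature: "\<exists>l>0. nov_extend G h [] \<in> nov_filtration l"
    and hom_relation: "list_all2 (nov_homogeneous grB) ds Xs \<Longrightarrow>
      nov_sum (\<lambda>bs. nov_extend G mA (map (nov_extend G h) bs)) {bs. concat bs = Xs} =
      (\<Sum>(i, j) | i + j \<le> length Xs.
         koszul (shifted_degree (take i ds))
           (nov_extend G h
              (take i Xs @ [nov_extend G mB (take j (drop i Xs))] @ drop (i + j) Xs)))"

locale cyclic_gapped_ainf_hom =
    dom: cyclic_gapped_ainf_algebra G sB grB mB pairB +
    cod: cyclic_gapped_ainf_algebra G sA grA mA pairA +
    gapped_ainf_hom G sB grB mB sA grA mA h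
  for G :: "(real \<times> int) set"
    and sB :: "'k::field_char_0 \<Rightarrow> 'b::ab_group_add \<Rightarrow> 'b" and grB mB pairB
    and sA :: "'k \<Rightarrow> 'a::ab_group_add \<Rightarrow> 'a" and grA mA pairA
    and h :: "nat \<Rightarrow> real \<times> int \<Rightarrow> 'b list \<Rightarrow> 'a" +
  assumes h_isometry: "pairB a b = pairA (h 1 0 [a]) (h 1 0 [b])"
    and h_cyclic: "length xs = k \<Longrightarrow> \<beta> \<in> G \<Longrightarrow> (k, \<beta>) \<noteq> (2, 0) \<Longrightarrow>
      (\<Sum>i\<le>k. \<Sum>(\<beta>1, \<beta>2) | \<beta>1 \<in> G \<and> \<beta>2 \<in> G \<and> \<beta>1 + \<beta>2 = \<beta>.
         pairA (h i \<beta>1 (take i xs)) (h (k - i) \<beta>2 (drop i xs))) = 0"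


section \<open>Potentials and non-commutative formal power series\<close>

definition homogeneous_basis ::
  "('k::field \<Rightarrow> 'a::ab_group_add \<Rightarrow> 'a) \<Rightarrow> (int \<Rightarrow> 'a set) \<Rightarrow> 'i set \<Rightarrow> ('i \<Rightarrow> 'a)
    \<Rightarrow> ('i \<Rightarrow> int) \<Rightarrow> bool" where
  "homogeneous_basis s gr I e d \<longleftrightarrow>
    inj_on e I \<and> \<not> module.dependent s (e ` I) \<and> module.span s (e ` I) = UNIV \<and>
    (\<forall>i\<in>I. e i \<in> gr (d i))"

text \<open>
  \<open>struct_const G f I e u [i\<^sub>1,\<dots>,i\<^sub>k] j\<close> is the coefficient at \<open>e j\<close> of
  \<open>f\<^sub>k (u i\<^sub>1, \<dots>, u i\<^sub>k)\<close>; here \<open>e\<close> is a basis of the target and \<open>u\<close> one of the source.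
\<close>

definition struct_const ::
  "(real \<times> int) set \<Rightarrow> ('k::field \<Rightarrow> 'a::ab_group_add \<Rightarrow> 'a)
    \<Rightarrow> (nat \<Rightarrow> real \<times> int \<Rightarrow> 'b::zero list \<Rightarrow> 'a) \<Rightarrow> 'i set \<Rightarrow> ('i \<Rightarrow> 'a) \<Rightarrow> ('j \<Rightarrow> 'b)
    \<Rightarrow> 'j list \<Rightarrow> 'i \<Rightarrow> 'k novikov" where
  "struct_const G s f I e u js i =
    nov_map (\<lambda>v. module.representation s (e ` I) v (e i))
      (nov_extend G f (map (\<lambda>j. nov_const (u j)) js))"

text \<open>
  A formal power series in non-commuting variables indexed by \<open>'i\<close> is given by its
  coefficients at the words in \<open>'i\<close>.
\<close>

type_synonym ('i, 'r) nc_series = "'i list \<Rightarrow> 'r"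

definition nc_const :: "'r::zero \<Rightarrow> ('i, 'r) nc_series" where
  "nc_const c w = (if w = [] then c else 0)"

definition nc_mult :: "('i, 'r::comm_ring_1) nc_series \<Rightarrow> ('i, 'r) nc_series \<Rightarrow> ('i, 'r) nc_series"
  where "nc_mult S S' w = (\<Sum>i\<le>length w. S (take i w) * S' (drop i w))"

definition potential ::
  "(real \<times> int) set \<Rightarrow> ('k::field_char_0 \<Rightarrow> 'a::ab_group_add \<Rightarrow> 'a)
    \<Rightarrow> (nat \<Rightarrow> real \<times> int \<Rightarrow> 'a list \<Rightarrow> 'a) \<Rightarrow> ('a \<Rightarrow> 'a \<Rightarrow> 'k)
    \<Rightarrow> 'i set \<Rightarrow> ('i \<Rightarrow> 'a) \<Rightarrow> ('i, 'k novikov) nc_series" where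
  "potential G s m pair I e w =
    (if w = [] then 0
     else nov_const (1 / of_nat (length w)) *
       (\<Sum>j\<in>I. struct_const G s m I e e (butlast w) j * nov_const (pair (e j) (e (last w)))))"

text \<open>Substitution of the series \<open>\<sigma> i\<close> for the variable with index \<open>i\<close>.\<close>

definition nc_subst ::
  "'i set \<Rightarrow> ('i \<Rightarrow> ('j, 'k::comm_ring_1 novikov) nc_series) \<Rightarrow> ('i, 'k novikov) nc_series
    \<Rightarrow> ('j, 'k novikov) nc_series" where
  "nc_subst I \<sigma> S w =
    nov_sum (\<lambda>u. S u * foldr nc_mult (map \<sigma> u) (nc_const 1) w) (lists I)"

definition pullback ::
  "(real \<times> int) set \<Rightarrow> ('k::field_char_0 \<Rightarrow> 'a::ab_group_add \<Rightarrow> 'a)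
    \<Rightarrow> (nat \<Rightarrow> real \<times> int \<Rightarrow> 'b::zero list \<Rightarrow> 'a) \<Rightarrow> 'i set \<Rightarrow> ('i \<Rightarrow> 'a) \<Rightarrow> ('j \<Rightarrow> 'b)
    \<Rightarrow> ('i, 'k novikov) nc_series \<Rightarrow> ('j, 'k novikov) nc_series" where
  "pullback G s h I e f = nc_subst I (\<lambda>i js. struct_const G s h I e f js i)"

text \<open>
  \<open>cyc_monomial d u\<close> is the cyclization of the monomial \<open>u\<close> in variables of degree \<open>d\<close>.
  Rotating by \<open>r\<close> moves the first \<open>r\<close> variables past the others.
\<close>

definition cyc_monomial ::
  "('j \<Rightarrow> int) \<Rightarrow> 'j list \<Rightarrow> ('j, 'k::field_char_0 novikov) nc_series" where
  "cyc_monomial d u w =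
    (if u = [] then nc_const 1 w
     else nov_const (1 / of_nat (length u)) *
       (\<Sum>r<length u. if rotate r u = w
          then koszul ((\<Sum>j\<leftarrow>take r u. d j) * (\<Sum>j\<leftarrow>drop r u. d j)) 1 else 0))"

text \<open>
  The linear extension of \<open>cyc_monomial d\<close>: only rotations of \<open>w\<close> contribute to the
  coefficient at \<open>w\<close>.
\<close>

definition cyclization ::
  "('j \<Rightarrow> int) \<Rightarrow> ('j, 'k::field_char_0 novikov) nc_series \<Rightarrow> ('j, 'k novikov) nc_series" where
  "cyclization d S w = (\<Sum>u\<in>{rotate r w |r. True}. S u * cyc_monomial d u w)"

end

theory Submission
  imports Defs
begin

text \<open>
  Compare the coefficients of both sides at a word \<open>Y w\<close> with last letter \<open>w\<close>.  Up to the common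
  factor one over the length, the coefficient of \<open>\<Phi>\<^sup>B\<close> is \<open>\<langle>m\<^sup>B(Y), w\<rangle>\<close>, while the one of the cyclized
  pullback is the signed sum, over all rotations of the word and all ways to cut the rotated word
  into blocks \<open>b\<^sub>1, \<dots>, b\<^sub>l\<close>, of \<open>(1 / l) \<langle>m\<^sup>A(h(b\<^sub>1), \<dots>, h(b\<^sub>l\<^sub>-\<^sub>1)), h(b\<^sub>l)\<rangle>\<close>.  That these agree is a
  non-commutative version of the following computation: the derivative of a cyclic potential in
  the direction \<open>w\<close> is \<open>\<langle>m(x), w\<rangle>\<close>, so the derivative of the pullback is
  \<open>\<langle>m\<^sup>A(h(y)), dh(w)\<rangle> = \<langle>dh(m\<^sup>B(y)), dh(w)\<rangle> = \<langle>m\<^sup>B(y), w\<rangle>\<close>, because \<open>h\<close> is a homomorphism and preserves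
  the pairing.

  First, \<open>m\<^sup>A\<close> is cyclic, so the \<open>l\<close> rotations of a sequence of blocks contribute equally; the
  weight \<open>1 / l\<close> disappears if one keeps only the sequences whose last block contains the marked
  letter \<open>w\<close> (\<open>polygon_sum_over_rotations\<close>).  Secondly, the remaining blocks are now summed over all
  decompositions of a segment of \<open>Y\<close>, so the relation for \<open>h\<close> applies and replaces
  \<open>m\<^sup>A(h(\<dots>), \<dots>, h(\<dots>))\<close> by terms \<open>h(\<dots>, m\<^sup>B(\<dots>), \<dots>)\<close>.  Thirdly, with \<open>z = m\<^sup>B(\<dots>)\<close> fixed, what is left is
  the sum of \<open>\<langle>h(\<dots>, z, \<dots>), h(\<dots>, w, \<dots>)\<rangle>\<close> over all ways of cutting a cyclic word \<open>U z V w\<close> into two arcs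
  that separate \<open>z\<close> from \<open>w\<close>.  The cyclicity of \<open>h\<close> controls the sum over all cuts of each rotation of
  this word, and the cuts that do not separate \<open>z\<close> from \<open>w\<close> cancel by skew symmetry
  (\<open>separating_cuts\<close>).  So only the case of empty \<open>U\<close> and \<open>V\<close> survives, where \<open>z = m\<^sup>B(Y)\<close> and the
  isometry condition gives \<open>\<langle>m\<^sup>B(Y), w\<rangle>\<close> (\<open>marked_polygon_sum\<close>).

  These are identities between finite sums over the ground field for each exponent of \<open>T\<close> and \<open>e\<close>:
  exponents have a positive minimal energy apart from \<open>0\<close>, and \<open>h\<^sub>0\<close> has no component of exponent
  \<open>0\<close>, so that below a given energy only finitely many empty blocks can be inserted.  The
  translation between Novikov series and these finite sums is made in \<open>nov_coeff_nov_extend\<close>,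
  \<open>nov_coeff_composition\<close> and \<open>nov_coeff_nc_subst\<close>.
\<close>


section \<open>Signs and rearrangements of sums\<close>

lemma koszul_0 [simp]: "koszul 0 x = x"
  by (simp add: koszul_def)

lemma koszul_koszul: "koszul a (koszul b x) = koszul (a + b) x"
  by (auto simp: koszul_def)

lemma koszul_cong: "even (a - b) \<Longrightarrow> koszul a x = koszul b x"
  by (auto simp: koszul_def)

lemma koszul_sum: "koszul n (sum f A) = (\<Sum>i\<in>A. koszul n (f i))"
  by (simp add: koszul_def sum_negf)

lemma koszul_minus: "koszul n (- x) = - koszul n x"
  by (simp add: koszul_def)

lemma koszul_zero_right [simp]: "koszul n 0 = 0"
  by (simp add: koszul_def)

lemma koszul_mult_right: "koszul n (c * x) = c * koszul n (x :: 'r::comm_ring_1)"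
  by (simp add: koszul_def)

lemma additive_koszul:
  assumes "\<And>x y. \<phi> (x + y) = \<phi> x + \<phi> y"
  shows "\<phi> (koszul n x) = koszul n (\<phi> x :: 'b::ab_group_add)"
proof -
  have "\<phi> 0 = 0" using assms[of 0 0] by simp
  hence "\<phi> (- x) = - \<phi> x" using assms[of "- x" x] by (simp add: eq_neg_iff_add_eq_0)
  thus ?thesis by (simp add: koszul_def)
qed

text \<open>
  A cut of the word \<open>x z y\<close> falls on one side of \<open>z\<close>.  Applied twice, this isolates the cuts
  that separate two given letters.
\<close>
lemma sum_cuts_around_letter:
  "(\<Sum>i\<le>length (x @ z # y). g (take i (x @ z # y)) (drop i (x @ z # y))) =
   (\<Sum>i\<le>length x. g (take i x) (drop i x @ z # y)) +
   (\<Sum>i\<le>length y. g (x @ z # take i y) (drop i y) :: 'c::comm_monoid_add)"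
proof -
  let ?w = "x @ z # y" and ?n = "length x"
  have "{..length ?w} = {..?n} \<union> {Suc ?n..Suc ?n + length y}" by auto
  hence "(\<Sum>i\<le>length ?w. g (take i ?w) (drop i ?w)) =
      (\<Sum>i\<le>?n. g (take i ?w) (drop i ?w)) + (\<Sum>i=Suc ?n..Suc ?n + length y. g (take i ?w) (drop i ?w))"
    by (simp only:) (rule sum.union_disjoint, auto)
  also have "(\<Sum>i=Suc ?n..Suc ?n + length y. g (take i ?w) (drop i ?w)) =
      (\<Sum>i\<le>length y. g (take (i + Suc ?n) ?w) (drop (i + Suc ?n) ?w))"
    by (rule sum.reindex_bij_witness[of _ "\<lambda>i. i + Suc ?n" "\<lambda>i. i - Suc ?n"]) auto
  finally show ?thesis by (simp add: Suc_diff_le)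
qed

lemma sum_swap_nested:
  "(\<Sum>x\<in>A. \<Sum>y\<in>B x. \<Sum>z\<in>C. f x y z) = (\<Sum>z\<in>C. \<Sum>x\<in>A. \<Sum>y\<in>B x. f x y z :: 'c::comm_monoid_add)"
proof -
  have "(\<Sum>x\<in>A. \<Sum>y\<in>B x. \<Sum>z\<in>C. f x y z) = (\<Sum>x\<in>A. \<Sum>z\<in>C. \<Sum>y\<in>B x. f x y z)"
    by (intro sum.cong refl sum.swap)
  thus ?thesis by (simp only: sum.swap[of _ _ A])
qed

lemma sum_Sigma3:
  assumes "finite A" "\<And>x. x \<in> A \<Longrightarrow> finite (B x)" "\<And>x y. x \<in> A \<Longrightarrow> y \<in> B x \<Longrightarrow> finite (C x y)"
  shows "(\<Sum>x\<in>A. \<Sum>y\<in>B x. \<Sum>z\<in>C x y. f x y z) =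
    (\<Sum>(x, y, z)\<in>(SIGMA x:A. SIGMA y:B x. C x y). f x y z :: 'c::comm_monoid_add)"
proof -
  have "(\<Sum>x\<in>A. \<Sum>y\<in>B x. \<Sum>z\<in>C x y. f x y z) =
      (\<Sum>x\<in>A. \<Sum>(y, z)\<in>(SIGMA y:B x. C x y). f x y z)"
    by (intro sum.cong refl sum.Sigma) (auto intro: assms)
  also have "\<dots> = (\<Sum>(x, y, z)\<in>(SIGMA x:A. SIGMA y:B x. C x y). f x y z)"
    by (rule sum.Sigma) (auto intro!: finite_SigmaI intro: assms)
  finally show ?thesis .
qed

section \<open>Exponents and decorated block decompositions\<close>

context gapping_monoid
begin

text \<open>
  The exponents \<open>(\<lambda>, n)\<close> of the monomials \<open>T^\<lambda> e^n\<close> that occur in the structure maps: the monoid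
  \<open>G\<close> records \<open>\<mu> = 2 n\<close> instead of \<open>n\<close>.
\<close>
definition exponents :: "(real \<times> int) set" ("\<Gamma>")
  where "\<Gamma> = {\<gamma>. (fst \<gamma>, 2 * snd \<gamma>) \<in> G}"

definition splits :: "real \<times> int \<Rightarrow> ((real \<times> int) \<times> (real \<times> int)) set"
  where "splits \<gamma> = {(\<alpha>, \<beta>). \<alpha> \<in> \<Gamma> \<and> \<beta> \<in> \<Gamma> \<and> \<alpha> + \<beta> = \<gamma>}"

text \<open>
  Every block carries the exponent of the component of a homomorphism that will be applied to
  it.  Empty blocks stand for insertions of \<open>h\<^sub>0(1)\<close>; as \<open>h\<^sub>0\<close> has no component of exponent \<open>0\<close>,
  those of exponent \<open>0\<close> are left out, and this makes the set finite.
\<close>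
definition blocks :: "real \<times> int \<Rightarrow> 'l list \<Rightarrow> ((real \<times> int) \<times> 'l list) list set"
  where "blocks \<gamma> w = {ds. set ds \<subseteq> \<Gamma> \<times> UNIV - {(0, [])} \<and>
    concat (map snd ds) = w \<and> sum_list (map fst ds) = \<gamma>}"

lemma zero_in_exponents: "0 \<in> \<Gamma>"
  using zero_mem by (simp add: exponents_def zero_prod_def)

lemma add_in_exponents: "\<alpha> \<in> \<Gamma> \<Longrightarrow> \<beta> \<in> \<Gamma> \<Longrightarrow> \<alpha> + \<beta> \<in> \<Gamma>"
  using add_mem[of "(fst \<alpha>, 2 * snd \<alpha>)" "(fst \<beta>, 2 * snd \<beta>)"]
  by (simp add: exponents_def algebra_simps)

lemma sum_list_in_exponents: "set gs \<subseteq> \<Gamma> \<Longrightarrow> sum_list gs \<in> \<Gamma>"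
  by (induction gs) (auto intro: zero_in_exponents add_in_exponents)

lemma exponents_nonneg: "\<gamma> \<in> \<Gamma> \<Longrightarrow> 0 \<le> fst \<gamma>"
  using nonneg_even by (force simp: exponents_def)

lemma finite_exponents_le: "finite {\<gamma>\<in>\<Gamma>. fst \<gamma> \<le> E}"
proof -
  have fin: "finite (fst ` G \<inter> {0..E})"
  proof (rule ccontr)
    assume "infinite (fst ` G \<inter> {0..E})"
    then obtain l where "l islimpt (fst ` G \<inter> {0..E})"
      using compact_eq_Bolzano_Weierstrass[of "{0..E}"] compact_Icc by (metis inf_le2)
    thus False using discrete islimpt_subset by blast
  qed
  have "{\<beta>\<in>G. fst \<beta> \<le> E} \<subseteq> (\<Union>l\<in>fst ` G \<inter> {0..E}. G \<inter> ({l} \<times> UNIV))"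
    using nonneg_even by force
  hence "finite {\<beta>\<in>G. fst \<beta> \<le> E}"
    by (rule finite_subset) (use fin finite_energy in blast)
  hence "finite ((\<lambda>\<gamma>. (fst \<gamma>, 2 * snd \<gamma>)) -` {\<beta>\<in>G. fst \<beta> \<le> E})"
    by (rule finite_vimageI) (auto simp: inj_on_def prod_eq_iff)
  thus ?thesis by (rule finite_subset[rotated]) (auto simp: exponents_def)
qed

lemma finite_splits: "finite (splits \<gamma>)"
proof (rule finite_subset)
  let ?S = "{\<alpha>\<in>\<Gamma>. fst \<alpha> \<le> fst \<gamma>}"
  show "splits \<gamma> \<subseteq> ?S \<times> ?S"
    unfolding splits_def using exponents_nonneg by fastforce
  show "finite (?S \<times> ?S)" using finite_exponents_le by blast
qed

text \<open>
  The energies do not accumulate at \<open>0\<close>, and \<open>0\<close> is the only exponent of energy \<open>0\<close>.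
\<close>
lemma energy_gap: "\<exists>\<epsilon>>0. \<forall>\<gamma>\<in>\<Gamma>. \<gamma> \<noteq> 0 \<longrightarrow> \<epsilon> \<le> fst \<gamma>"
proof -
  obtain \<epsilon> where \<epsilon>: "\<epsilon> > 0" "\<And>x. x \<in> fst ` G \<Longrightarrow> x \<noteq> 0 \<Longrightarrow> \<not> dist x 0 < \<epsilon>"
    using discrete[of 0] unfolding islimpt_approachable by blast
  have "\<epsilon> \<le> fst \<gamma>" if "\<gamma> \<in> \<Gamma>" "\<gamma> \<noteq> 0" for \<gamma>
  proof -
    have mem: "(fst \<gamma>, 2 * snd \<gamma>) \<in> G" using that(1) by (simp add: exponents_def)
    have "fst \<gamma> \<noteq> 0"
    proof
      assume "fst \<gamma> = 0"
      hence "(fst \<gamma>, 2 * snd \<gamma>) \<in> G \<inter> ({0} \<times> UNIV)" using mem by simp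
      hence "(fst \<gamma>, 2 * snd \<gamma>) = 0" using zero_energy by blast
      thus False using that(2) by (simp add: prod_eq_iff)
    qed
    moreover have "fst \<gamma> \<in> fst ` G" using imageI[OF mem, of fst] by simp
    ultimately show ?thesis
      using \<epsilon>(2)[of "fst \<gamma>"] exponents_nonneg[OF that(1)] by (simp add: dist_real_def)
  qed
  thus ?thesis using \<epsilon>(1) by blast
qed

text \<open>
  A block either consumes a letter or costs a definite amount of energy, so the number of
  blocks is bounded in terms of the word and of the total energy.
\<close>
lemma blocks_length_bound:
  assumes "\<forall>\<gamma>\<in>\<Gamma>. \<gamma> \<noteq> 0 \<longrightarrow> \<epsilon> \<le> fst \<gamma>" "0 < \<epsilon>" "set ds \<subseteq> \<Gamma> \<times> UNIV - {(0, [])}"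
  shows "\<epsilon> * length ds \<le> \<epsilon> * length (concat (map snd ds)) + fst (sum_list (map fst ds))"
  using assms(3)
proof (induction ds)
  case (Cons d ds)
  obtain \<gamma> b where d: "d = (\<gamma>, b)" by (cases d)
  have \<gamma>: "\<gamma> \<in> \<Gamma>" "\<gamma> \<noteq> 0 \<or> b \<noteq> []" using Cons.prems d by auto
  have "\<epsilon> \<le> \<epsilon> * length b + fst \<gamma>"
  proof (cases "b = []")
    case True
    thus ?thesis using assms(1) \<gamma> by simp
  next
    case False
    hence "\<epsilon> * 1 \<le> \<epsilon> * length b"
      using assms(2) by (intro mult_left_mono) (auto simp: Suc_le_eq)
    thus ?thesis using exponents_nonneg[OF \<gamma>(1)] by linarith
  qed
  thus ?case using Cons d by (simp add: algebra_simps)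
qed simp

lemma finite_blocks: "finite (blocks \<gamma> w)"
proof -
  obtain \<epsilon> where \<epsilon>: "\<epsilon> > 0" "\<forall>\<gamma>\<in>\<Gamma>. \<gamma> \<noteq> 0 \<longrightarrow> \<epsilon> \<le> fst \<gamma>" using energy_gap by blast
  let ?S = "{\<alpha>\<in>\<Gamma>. fst \<alpha> \<le> fst \<gamma>} \<times> {b. set b \<subseteq> set w \<and> length b \<le> length w}"
  let ?K = "nat \<lceil>(\<epsilon> * length w + fst \<gamma>) / \<epsilon>\<rceil>"
  show ?thesis
  proof (rule finite_subset)
    show "blocks \<gamma> w \<subseteq> {ds. set ds \<subseteq> ?S \<and> length ds \<le> ?K}"
    proof safe
      fix ds assume ds: "ds \<in> blocks \<gamma> w"
      hence "\<epsilon> * length ds \<le> \<epsilon> * length w + fst \<gamma>"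
        using blocks_length_bound[OF \<epsilon>(2,1), of ds] by (auto simp: blocks_def)
      hence "length ds \<le> (\<epsilon> * length w + fst \<gamma>) / \<epsilon>"
        using \<epsilon>(1) by (simp add: field_simps)
      thus "length ds \<le> ?K" by linarith
      fix \<alpha>1 \<alpha>2 and b :: "'a list"
      assume d: "((\<alpha>1, \<alpha>2), b) \<in> set ds"
      then obtain xs ys where s: "ds = xs @ ((\<alpha>1, \<alpha>2), b) # ys" by (meson split_list)
      show "(\<alpha>1, \<alpha>2) \<in> \<Gamma>" using ds d by (auto simp: blocks_def)
      have "sum_list (map fst xs) \<in> \<Gamma>" "sum_list (map fst ys) \<in> \<Gamma>"
        using ds s by (intro sum_list_in_exponents; auto simp: blocks_def)+
      moreover have "\<gamma> = sum_list (map fst xs) + ((\<alpha>1, \<alpha>2) + sum_list (map fst ys))"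
        using ds s by (simp add: blocks_def)
      ultimately show "fst (\<alpha>1, \<alpha>2) \<le> fst \<gamma>"
        using exponents_nonneg[of "sum_list (map fst xs)"] exponents_nonneg[of "sum_list (map fst ys)"]
        by simp
      show "x \<in> set w" if "x \<in> set b" for x using ds s that by (auto simp: blocks_def)
      show "length b \<le> length w" using ds s by (auto simp: blocks_def)
    qed
    show "finite {ds. set ds \<subseteq> ?S \<and> length ds \<le> ?K}"
    proof (rule finite_lists_length_le, rule finite_cartesian_product)
      show "finite {b. set b \<subseteq> set w \<and> length b \<le> length w}" by (simp add: finite_lists_length_le)
    qed (rule finite_exponents_le)
  qed
qed

lemma sum_splits_swap:
  "(\<Sum>(\<alpha>, \<beta>)\<in>splits \<gamma>. F \<alpha> \<beta>) = (\<Sum>(\<alpha>, \<beta>)\<in>splits \<gamma>. F \<beta> \<alpha> :: 'c::comm_monoid_add)"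
  by (rule sum.reindex_bij_witness[of _ "\<lambda>(a, b). (b, a)" "\<lambda>(a, b). (b, a)"])
     (auto simp: splits_def add.commute)

lemma sum_splits_assoc:
  "(\<Sum>(\<alpha>, \<beta>)\<in>splits \<gamma>. \<Sum>(\<beta>1, \<beta>2)\<in>splits \<beta>. F \<alpha> \<beta>1 \<beta>2) =
   (\<Sum>(\<delta>, \<beta>2)\<in>splits \<gamma>. \<Sum>(\<alpha>, \<beta>1)\<in>splits \<delta>. F \<alpha> \<beta>1 \<beta>2 :: 'c::comm_monoid_add)"
proof -
  have "(\<Sum>(\<alpha>, \<beta>)\<in>splits \<gamma>. \<Sum>(\<beta>1, \<beta>2)\<in>splits \<beta>. F \<alpha> \<beta>1 \<beta>2) =
      (\<Sum>(p, q)\<in>(SIGMA p:splits \<gamma>. splits (snd p)). F (fst p) (fst q) (snd q))"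
    by (subst sum.Sigma[symmetric]) (auto simp: finite_splits split_def)
  also have "\<dots> = (\<Sum>(p, q)\<in>(SIGMA p:splits \<gamma>. splits (fst p)). F (fst q) (snd q) (snd p))"
    by (rule sum.reindex_bij_witness[of _
          "\<lambda>(p, q). ((fst q, snd q + snd p), (snd q, snd p))"
          "\<lambda>(p, q). ((fst p + fst q, snd q), (fst p, fst q))"])
       (auto simp: splits_def algebra_simps
          add_in_exponents[of "(a, b)" "(c, d)" for a b c d, simplified])
  also have "\<dots> = (\<Sum>(\<delta>, \<beta>2)\<in>splits \<gamma>. \<Sum>(\<alpha>, \<beta>1)\<in>splits \<delta>. F \<alpha> \<beta>1 \<beta>2)"
    by (subst sum.Sigma[symmetric]) (auto simp: finite_splits split_def)
  finally show ?thesis .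
qed

end


section \<open>Block decompositions and a marked letter\<close>

abbreviation total :: "('l \<Rightarrow> int) \<Rightarrow> 'l list \<Rightarrow> int"
  where "total deg w \<equiv> sum_list (map deg w)"

text \<open>
  A marked letter singles out one block of a decomposition, and its position determines
  the two pieces into which it cuts that block.
\<close>
lemma block_containing_letter:
  assumes "concat (map snd ds) = v @ w # x"
  shows "\<exists>xs g b1 b2 ys. ds = xs @ (g, b1 @ w # b2) # ys \<and>
    v = concat (map snd xs) @ b1 \<and> x = b2 @ concat (map snd ys)"
  using assms
proof (induction ds arbitrary: v)
  case (Cons d ds)
  obtain g b where d: "d = (g, b)" by (cases d)
  have "b @ concat (map snd ds) = v @ w # x" using Cons.prems d by simp
  hence "(\<exists>us. b = v @ w # us \<and> us @ concat (map snd ds) = x) \<or>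
      (\<exists>us. v = b @ us \<and> concat (map snd ds) = us @ w # x)"
    by (fastforce simp: append_eq_append_conv2 append_eq_Cons_conv)
  then consider us where "b = v @ w # us" "us @ concat (map snd ds) = x"
    | us where "v = b @ us" "concat (map snd ds) = us @ w # x" by blast
  thus ?case
  proof cases
    case 1
    hence "d # ds = [] @ (g, v @ w # us) # ds \<and> v = concat (map snd []) @ v \<and>
      x = us @ concat (map snd ds)" using d by simp
    thus ?thesis by blast
  next
    case 2
    from Cons.IH[OF 2(2)] obtain xs g' b1 b2 ys where
      "ds = xs @ (g', b1 @ w # b2) # ys" "us = concat (map snd xs) @ b1"
      "x = b2 @ concat (map snd ys)" by blast
    hence "d # ds = (d # xs) @ (g', b1 @ w # b2) # ys \<and> v = concat (map snd (d # xs)) @ b1 \<and>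
      x = b2 @ concat (map snd ys)" using d 2 by simp
    thus ?thesis by blast
  qed
qed simp

lemma block_containing_letter_unique:
  assumes "xs @ (g, b1 @ w # b2) # ys = xs' @ (g', b1' @ w # b2') # ys'"
    and "length (concat (map snd xs) @ b1) = length (concat (map snd xs') @ b1')"
  shows "xs = xs' \<and> g = g' \<and> b1 = b1' \<and> b2 = b2' \<and> ys = ys'"
  using assms
proof (induction xs arbitrary: xs')
  case Nil
  show ?case using Nil by (cases xs') auto
next
  case (Cons d xs)
  show ?case
  proof (cases xs')
    case Nil
    thus ?thesis using Cons.prems by auto
  next
    case (Cons d' xs'')
    thus ?thesis using Cons.prems Cons.IH[of xs''] by simp
  qed
qed

section \<open>The identity for cyclic words\<close>

text \<open>
  What the argument needs to know about a cyclic homomorphism, coefficient by coefficient.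
  The set \<open>L\<close> contains the homogeneous letters, \<open>deg\<close> is the shifted degree, and the operations
  \<open>h\<close> and \<open>mB\<close> take an exponent, which selects a component, and a word.  The
  assumption \<open>h_cuts\<close> combines the two conditions in the definition of a cyclic homomorphism:
  the case \<open>(k, \<beta>) = (2, 0)\<close>, which is excluded in the second one, is the isometry condition.
\<close>
locale cyclic_transfer = gapping_monoid G for G +
  fixes L :: "'l set" and deg :: "'l \<Rightarrow> int"
    and h :: "real \<times> int \<Rightarrow> 'l list \<Rightarrow> 'a::ab_group_add"
    and mA :: "real \<times> int \<Rightarrow> 'a list \<Rightarrow> 'a" and mB :: "real \<times> int \<Rightarrow> 'l list \<Rightarrow> 'l"
    and pA :: "'a \<Rightarrow> 'a \<Rightarrow> 'k::field_char_0" and pB :: "'l \<Rightarrow> 'l \<Rightarrow> 'k"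
  assumes mB_letter: "\<gamma> \<in> \<Gamma> \<Longrightarrow> w \<in> lists L \<Longrightarrow> mB \<gamma> w \<in> L"
    and deg_mB: "\<gamma> \<in> \<Gamma> \<Longrightarrow> w \<in> lists L \<Longrightarrow> even (deg (mB \<gamma> w) - total deg w - 1)"
    and pA_add: "pA (x + y) z = pA x z + pA y z"
    and h_skew: "\<alpha> \<in> \<Gamma> \<Longrightarrow> \<beta> \<in> \<Gamma> \<Longrightarrow> u \<in> lists L \<Longrightarrow> v \<in> lists L \<Longrightarrow>
      pA (h \<alpha> u) (h \<beta> v) = - koszul (total deg u * total deg v) (pA (h \<beta> v) (h \<alpha> u))"
    and h_cuts: "\<gamma> \<in> \<Gamma> \<Longrightarrow> w \<in> lists L \<Longrightarrow>
      (\<Sum>i\<le>length w. \<Sum>(\<alpha>, \<beta>)\<in>splits \<gamma>. pA (h \<alpha> (take i w)) (h \<beta> (drop i w))) =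
      (if length w = 2 \<and> \<gamma> = 0 then pB (w ! 0) (w ! 1) else 0)"
    and h_relation: "\<gamma> \<in> \<Gamma> \<Longrightarrow> w \<in> lists L \<Longrightarrow>
      (\<Sum>(\<alpha>, \<beta>)\<in>splits \<gamma>. \<Sum>ds\<in>blocks \<beta> w. mA \<alpha> (map (case_prod h) ds)) =
      (\<Sum>(i, j) | i + j \<le> length w. \<Sum>(\<alpha>, \<beta>)\<in>splits \<gamma>.
         koszul (total deg (take i w))
           (h \<alpha> (take i w @ mB \<beta> (take j (drop i w)) # drop (i + j) w)))"
    and mA_rotate: "\<alpha> \<in> \<Gamma> \<Longrightarrow> set (d # ds) \<subseteq> \<Gamma> \<times> lists L \<Longrightarrow>
      pA (mA \<alpha> (map (case_prod h) (butlast (d # ds)))) (case_prod h (last (d # ds))) =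
      koszul (total deg (snd d) * total deg (concat (map snd ds)))
        (pA (mA \<alpha> (map (case_prod h) ds)) (case_prod h d))"
begin

lemma pA_zero: "pA 0 z = 0"
  using pA_add[of 0 0 z] by simp

lemma pA_sum: "pA (sum f S) z = (\<Sum>i\<in>S. pA (f i) z)"
  by (induction S rule: infinite_finite_induct) (simp_all add: pA_zero pA_add)

lemma pA_koszul: "pA (koszul n x) z = koszul n (pA x z)"
  by (rule additive_koszul[of "\<lambda>x. pA x z"]) (rule pA_add)

definition cut :: "real \<times> int \<Rightarrow> 'l list \<Rightarrow> 'l list \<Rightarrow> 'k"
  where "cut \<gamma> u v = (\<Sum>(\<alpha>, \<beta>)\<in>splits \<gamma>. pA (h \<alpha> u) (h \<beta> v))"

text \<open>
  The contribution of a cyclic arrangement of blocks to the pulled back potential.  The last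
  block is the second argument of the pairing; by \<open>mA_rotate\<close> another choice of the last block
  changes the value by a sign only.
\<close>
definition polygon :: "real \<times> int \<Rightarrow> ((real \<times> int) \<times> 'l list) list \<Rightarrow> 'k"
  where "polygon \<alpha> ds = pA (mA \<alpha> (map (case_prod h) (butlast ds))) (case_prod h (last ds))"

lemma cut_skew:
  assumes "u \<in> lists L" "v \<in> lists L"
  shows "cut \<gamma> u v = - koszul (total deg u * total deg v) (cut \<gamma> v u)"
proof -
  have "cut \<gamma> u v = (\<Sum>(\<alpha>, \<beta>)\<in>splits \<gamma>. pA (h \<beta> u) (h \<alpha> v))"
    unfolding cut_def by (rule sum_splits_swap)
  also have "\<dots> = (\<Sum>(\<alpha>, \<beta>)\<in>splits \<gamma>. - koszul (total deg u * total deg v) (pA (h \<alpha> v) (h \<beta> u)))"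
    by (intro sum.cong refl) (auto simp: splits_def intro!: h_skew assms)
  finally show ?thesis by (simp add: cut_def koszul_sum sum_negf split_def)
qed

text \<open>
  For every rotation of the cyclic word \<open>U z V w\<close> that starts in \<open>U\<close>, the sum over all cuts into
  two arcs is known from \<open>h_cuts\<close>.  A cut inside \<open>U\<close>, together with the starting point, divides
  the cyclic word at two places of \<open>U\<close>; exchanging these two places exchanges the arguments of
  the pairing, so by skew symmetry such terms cancel, and there remain the cuts that separate
  \<open>z\<close> from \<open>w\<close>.

  Moving a prefix of degree \<open>a\<close> of a word of degree \<open>D\<close> to the end costs the sign \<open>(-1)^(a (D - a))\<close>,
  which equals \<open>(-1)^((D - 1) a)\<close>; in this form the sign is multiplicative in the prefix.
\<close>
lemma separating_cuts:
  assumes U: "U \<in> lists L" and V: "V \<in> lists L" and z: "z \<in> L" and w: "w \<in> L" and \<gamma>: "\<gamma> \<in> \<Gamma>"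
    and D: "D = total deg U + deg z + total deg V + deg w"
  shows "(\<Sum>s\<le>length U. koszul ((D - 1) * total deg (take s U))
      (\<Sum>t\<le>length V. cut \<gamma> (drop s U @ z # take t V) (drop t V @ w # take s U))) =
    (if U = [] \<and> V = [] \<and> \<gamma> = 0 then pB z w else 0)"
proof -
  let ?p = "length U" and ?rhs = "if U = [] \<and> V = [] \<and> \<gamma> = 0 then pB z w else 0"
  let ?k = "\<lambda>s. koszul ((D - 1) * total deg (take s U)) :: 'k \<Rightarrow> 'k"
  let ?good = "\<lambda>s. \<Sum>t\<le>length V. cut \<gamma> (drop s U @ z # take t V) (drop t V @ w # take s U)"
  let ?X = "\<lambda>s r. cut \<gamma> (drop s (take r U)) (drop r U @ z # V @ w # take s U)"
  let ?Y = "\<lambda>s r. cut \<gamma> (drop s U @ z # V @ w # take r U) (drop r (take s U))"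
  let ?word = "\<lambda>s. drop s U @ z # V @ w # take s U"
  have cuts: "(\<Sum>i\<le>length (?word s). cut \<gamma> (take i (?word s)) (drop i (?word s))) =
      (\<Sum>r=s..?p. ?X s r) + ?good s + (\<Sum>r\<le>s. ?Y s r)" if "s \<le> ?p" for s
  proof -
    have "(\<Sum>i\<le>length (?word s). cut \<gamma> (take i (?word s)) (drop i (?word s))) =
        (\<Sum>i\<le>length (drop s U). cut \<gamma> (take i (drop s U)) (drop i (drop s U) @ z # V @ w # take s U)) +
        (\<Sum>i\<le>length (V @ w # take s U).
           cut \<gamma> (drop s U @ z # take i (V @ w # take s U)) (drop i (V @ w # take s U)))"
      by (rule sum_cuts_around_letter)
    also have "(\<Sum>i\<le>length (V @ w # take s U).
           cut \<gamma> (drop s U @ z # take i (V @ w # take s U)) (drop i (V @ w # take s U))) =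
        (\<Sum>i\<le>length V. cut \<gamma> (drop s U @ z # take i V) (drop i V @ w # take s U)) +
        (\<Sum>i\<le>length (take s U). cut \<gamma> (drop s U @ z # V @ w # take i (take s U)) (drop i (take s U)))"
      by (rule sum_cuts_around_letter[of "\<lambda>a b. cut \<gamma> (drop s U @ z # a) b"])
    also have "(\<Sum>i\<le>length (take s U). cut \<gamma> (drop s U @ z # V @ w # take i (take s U)) (drop i (take s U)))
        = (\<Sum>r\<le>s. ?Y s r)"
      using that by (intro sum.cong) (auto simp: min_def)
    also have "(\<Sum>i\<le>length (drop s U). cut \<gamma> (take i (drop s U)) (drop i (drop s U) @ z # V @ w # take s U))
        = (\<Sum>r=s..?p. ?X s r)"
      using that by (intro sum.reindex_bij_witness[of _ "\<lambda>r. r - s" "\<lambda>i. s + i"])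
        (auto simp: take_drop add.commute)
    finally show ?thesis by (simp add: algebra_simps)
  qed
  have L: "drop s (take r U) \<in> lists L" "drop s U \<in> lists L" "take s U \<in> lists L" for s r
    using U set_take_subset set_drop_subset by (fastforce simp: in_lists_conv_set)+
  have total_split: "total deg (take r U) = total deg (take s U) + total deg (drop s (take r U))"
    if "s \<le> r" for s r
  proof -
    have "take r U = take s U @ drop s (take r U)"
      using that by (metis append_take_drop_id min.absorb1 take_take)
    hence "map deg (take r U) = map deg (take s U) @ map deg (drop s (take r U))"
      by (metis map_append)
    thus ?thesis by simp
  qed
  have total_drop: "total deg (drop r U) = total deg U - total deg (take r U)" for r
    by (metis add_diff_cancel_left' append_take_drop_id map_append sum_list_append)
  \<comment> \<open>The divisions at \<open>(s, r)\<close> and at \<open>(r, s)\<close> are the same up to the order of the two arcs.\<close>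
  have cancel: "?k s (?Y s r) = - ?k r (?X r s)" if "r \<le> s" for r s
  proof -
    have "?Y s r = - koszul (total deg (drop s U @ z # V @ w # take r U) * total deg (drop r (take s U)))
        (?X r s)"
      by (rule cut_skew) (use L U V z w in auto)
    thus ?thesis
      using total_split[OF that] total_drop[of s]
      by (simp add: koszul_minus koszul_koszul D)
         (rule koszul_cong, simp add: algebra_simps)
  qed
  have "(\<Sum>s\<le>?p. ?k s (\<Sum>r\<le>s. ?Y s r)) = - (\<Sum>s\<le>?p. \<Sum>r\<le>s. ?k r (?X r s))"
    by (simp add: koszul_sum cancel sum_negf)
  also have "(\<Sum>s\<le>?p. \<Sum>r\<le>s. ?k r (?X r s)) = (\<Sum>r\<le>?p. \<Sum>s=r..?p. ?k r (?X r s))"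
    by (subst (1 2) sum.Sigma)
       (auto intro!: sum.reindex_bij_witness[of _ "\<lambda>(a, b). (b, a)" "\<lambda>(a, b). (b, a)"])
  finally have "(\<Sum>s\<le>?p. ?k s (\<Sum>r\<le>s. ?Y s r)) = - (\<Sum>r\<le>?p. ?k r (\<Sum>s=r..?p. ?X r s))"
    by (simp add: koszul_sum)
  moreover have kadd: "?k s (a + b) = ?k s a + ?k s b" for s and a b :: 'k
    by (simp add: koszul_def)
  ultimately have "(\<Sum>s\<le>?p. ?k s (?good s)) =
      (\<Sum>s\<le>?p. ?k s ((\<Sum>r=s..?p. ?X s r) + ?good s + (\<Sum>r\<le>s. ?Y s r)))"
    by (simp add: sum.distrib)
  also have "\<dots> =
      (\<Sum>s\<le>?p. ?k s (\<Sum>i\<le>length (?word s). cut \<gamma> (take i (?word s)) (drop i (?word s))))"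
    by (intro sum.cong refl arg_cong[of _ _ "koszul _"]) (rule cuts[symmetric], simp)
  also have "\<dots> = (\<Sum>s\<le>?p. ?k s ?rhs)"
  proof (intro sum.cong refl arg_cong[of _ _ "koszul _"])
    fix s assume s: "s \<in> {..?p}"
    have "?word s \<in> lists L" using L V z w by auto
    from h_cuts[OF \<gamma> this] show "(\<Sum>i\<le>length (?word s). cut \<gamma> (take i (?word s)) (drop i (?word s))) = ?rhs"
      using s by (auto simp: cut_def)
  qed
  also have "\<dots> = ?rhs" by simp
  finally show ?thesis .
qed

lemma polygon_rotate:
  assumes "\<alpha> \<in> \<Gamma>" "set us \<subseteq> \<Gamma> \<times> lists L" "set vs \<subseteq> \<Gamma> \<times> lists L"
  shows "polygon \<alpha> (us @ vs) =
    koszul (total deg (concat (map snd us)) * total deg (concat (map snd vs))) (polygon \<alpha> (vs @ us))"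
  using assms
proof (induction us arbitrary: vs)
  case (Cons d us)
  have "polygon \<alpha> (d # us @ vs) =
      koszul (total deg (snd d) * total deg (concat (map snd (us @ vs)))) (polygon \<alpha> (us @ vs @ [d]))"
    using mA_rotate[of \<alpha> d "us @ vs"] Cons.prems unfolding polygon_def by (auto simp: butlast_append)
  moreover have "polygon \<alpha> (us @ vs @ [d]) = koszul (total deg (concat (map snd us)) *
      total deg (concat (map snd (vs @ [d])))) (polygon \<alpha> ((vs @ [d]) @ us))"
    using Cons.prems by (intro Cons.IH) auto
  ultimately show ?case
    by (simp add: koszul_koszul) (rule koszul_cong, simp add: algebra_simps)
qed simp

lemma blocks_letters:
  assumes "ds \<in> blocks \<beta> W" "W \<in> lists L"
  shows "set ds \<subseteq> \<Gamma> \<times> lists L"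
proof
  fix d assume d: "d \<in> set ds"
  have "set (concat (map snd ds)) \<subseteq> L" using assms by (auto simp: blocks_def)
  hence "set (snd d) \<subseteq> L" using d by auto
  moreover have "fst d \<in> \<Gamma>" using assms(1) d by (auto simp: blocks_def)
  ultimately show "d \<in> \<Gamma> \<times> lists L" by (cases d) auto
qed

text \<open>
  Mark the letter \<open>w\<close> of the cyclic word \<open>Y w\<close>.  When a rotation of the word is cut into \<open>l\<close>
  blocks, rotating the blocks yields \<open>l\<close> configurations whose signed contributions agree, and
  in exactly one of them \<open>w\<close> lies in the last block.  The weight \<open>1 / l\<close> is therefore absorbed
  by keeping only those configurations: their last block consists of the letters of \<open>Y\<close> from
  position \<open>s + t\<close> on, of \<open>w\<close>, and of the first \<open>s\<close> letters of \<open>Y\<close>.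
\<close>
lemma polygon_sum_over_rotations:
  assumes Y: "Y \<in> lists L" and w: "w \<in> L" and \<alpha>: "\<alpha> \<in> \<Gamma>" and D: "D = total deg Y + deg w"
  shows "(\<Sum>s\<le>length Y. \<Sum>ds\<in>blocks \<beta> (drop s Y @ w # take s Y).
      koszul ((D - 1) * total deg (take s Y)) (polygon \<alpha> ds) / of_nat (length ds)) =
    (\<Sum>s\<le>length Y. \<Sum>(\<beta>', g)\<in>splits \<beta>. \<Sum>t\<le>length Y - s.
      \<Sum>ds\<in>blocks \<beta>' (take t (drop s Y)). koszul ((D - 1) * total deg (take s Y))
        (polygon \<alpha> (ds @ [(g, drop t (drop s Y) @ w # take s Y)])))"
proof -
  let ?n = "length Y" and ?E = "\<lambda>s. (D - 1) * total deg (take s Y)"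
  let ?len = "\<lambda>c zs. length (concat (map snd (take c zs)))"
  let ?b = "\<lambda>s t. drop t (drop s Y) @ w # take s Y"
  define Q where "Q = (\<lambda>(s, ds). koszul (?E s) (polygon \<alpha> ds) / of_nat (length ds))"
  define R where "R = (SIGMA s:{..?n}. SIGMA p:splits \<beta>. SIGMA t:{..?n - s}.
      blocks (fst p) (take t (drop s Y)))"
  define T where "T = (SIGMA s:{..?n}. blocks \<beta> (drop s Y @ w # take s Y))"
  define RC where "RC = (SIGMA r:R. {..length (snd (snd (snd r)))})"
  \<comment> \<open>The map \<open>\<phi>\<close> moves the first \<open>c\<close> of the blocks \<open>zs\<close> behind the block that contains \<open>w\<close>.\<close>
  define \<phi> where "\<phi> = (\<lambda>((s, p :: (real \<times> int) \<times> (real \<times> int), t, zs), c). (s + ?len c zs, drop c zs @ (snd p, ?b s t) # take c zs))"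
  have concat_split: "concat (map snd zs) = concat (map snd (take c zs)) @ concat (map snd (drop c zs))"
    for c and zs :: "((real \<times> int) \<times> 'l list) list"
    by (metis append_take_drop_id concat_append map_append)
  have R: "s + t \<le> ?n \<and> (\<beta>', g) \<in> splits \<beta> \<and> set zs \<subseteq> \<Gamma> \<times> UNIV - {(0, [])} \<and>
      concat (map snd zs) = take t (drop s Y) \<and> sum_list (map fst zs) = \<beta>'"
    if "(s, (\<beta>', g), t, zs) \<in> R" for s t \<beta>' g zs
    using that by (auto simp: R_def blocks_def)
  have YR: "Y = take s Y @ concat (map snd (take c zs)) @ concat (map snd (drop c zs)) @ drop t (drop s Y)"
    if "(s, (\<beta>', g), t, zs) \<in> R" for s t \<beta>' g zs c
    using R[OF that] concat_split[of zs c] by (metis append_assoc append_take_drop_id)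
  have lenR: "?n = s + ?len c zs + length (concat (map snd (drop c zs)) @ drop t (drop s Y))"
    if "(s, (\<beta>', g), t, zs) \<in> R" for s t \<beta>' g zs c
  proof -
    have "?n = length (take s Y) + (?len c zs + length (concat (map snd (drop c zs)) @ drop t (drop s Y)))"
      using arg_cong[OF YR[OF that, of c], of length] by (simp only: length_append append_assoc)
    thus ?thesis using R[OF that] by simp
  qed
  have cutY: "take (s + ?len c zs) Y = take s Y @ concat (map snd (take c zs)) \<and>
      drop (s + ?len c zs) Y = concat (map snd (drop c zs)) @ drop t (drop s Y)"
    if "(s, (\<beta>', g), t, zs) \<in> R" for s t \<beta>' g zs c
  proof -
    have "length (take s Y @ concat (map snd (take c zs))) = s + ?len c zs"
      using R[OF that] by simp
    moreover have "Y = (take s Y @ concat (map snd (take c zs))) @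
        concat (map snd (drop c zs)) @ drop t (drop s Y)"
      using YR[OF that, of c] by simp
    ultimately show ?thesis by (metis append_eq_conv_conj)
  qed
  have mem: "\<phi> (r, c) \<in> T" if "(r, c) \<in> RC" for r c
  proof -
    obtain s \<beta>' g t zs where r: "r = (s, (\<beta>', g), t, zs)" by (metis prod.exhaust)
    have rR: "(s, (\<beta>', g), t, zs) \<in> R" using that r by (simp add: RC_def)
    note f = R[OF rR]
    note tk = cutY[OF rR, of c, THEN conjunct1] and dr = cutY[OF rR, of c, THEN conjunct2]
    have st: "set (take c zs) \<subseteq> \<Gamma> \<times> UNIV - {(0, [])}" "set (drop c zs) \<subseteq> \<Gamma> \<times> UNIV - {(0, [])}"
      using f set_take_subset[of c zs] set_drop_subset[of c zs] by blast+
    have "sum_list (map fst (take c zs)) + sum_list (map fst (drop c zs)) = \<beta>'"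
      using f by (metis append_take_drop_id map_append sum_list_append)
    hence "sum_list (map fst (drop c zs @ (g, ?b s t) # take c zs)) = \<beta>"
      using f by (auto simp: splits_def algebra_simps)
    moreover have "g \<in> \<Gamma>" using f by (simp add: splits_def)
    moreover have "s + ?len c zs \<le> ?n" using lenR[OF rR, of c] by linarith
    ultimately show ?thesis using st unfolding r T_def \<phi>_def
      by (simp add: blocks_def tk dr)
  qed
  have inj: "inj_on \<phi> RC"
  proof (rule inj_onI)
    fix x y assume xy: "x \<in> RC" "y \<in> RC" "\<phi> x = \<phi> y"
    obtain s \<beta>' g t zs c where x: "x = ((s, (\<beta>', g), t, zs), c)" by (metis prod.exhaust)
    obtain s' \<beta>'' g' t' zs' c' where y: "y = ((s', (\<beta>'', g'), t', zs'), c')" by (metis prod.exhaust)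
    have xR: "(s, (\<beta>', g), t, zs) \<in> R" and yR: "(s', (\<beta>'', g'), t', zs') \<in> R"
      using xy x y by (auto simp: RC_def)
    have eq: "s + ?len c zs = s' + ?len c' zs'"
        "drop c zs @ (g, ?b s t) # take c zs = drop c' zs' @ (g', ?b s' t') # take c' zs'"
      using xy(3) by (auto simp: \<phi>_def x y)
    have "length (concat (map snd (drop c zs)) @ drop t (drop s Y)) =
        length (concat (map snd (drop c' zs')) @ drop t' (drop s' Y))"
      using lenR[OF xR, of c] lenR[OF yR, of c'] eq(1) by linarith
    from block_containing_letter_unique[OF eq(2) this]
    have u: "drop c zs = drop c' zs'" "g = g'" "drop t (drop s Y) = drop t' (drop s' Y)"
      "take s Y = take s' Y" "take c zs = take c' zs'" by auto
    have "s = s'" using arg_cong[OF u(4), of length] R[OF xR] R[OF yR] by simp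
    moreover have zs: "zs = zs'" using u by (metis append_take_drop_id)
    moreover have "c = c'" using arg_cong[OF u(5), of length] xy(1,2) zs
      by (simp add: RC_def x y)
    moreover have "length (concat (map snd zs)) = t" "length (concat (map snd zs')) = t'"
      using R[OF xR] R[OF yR] by auto
    hence "t = t'" using zs by simp
    moreover have "\<beta>' = \<beta>''" using R[OF xR] R[OF yR] zs by blast
    ultimately show "x = y" using x y u(2) by blast
  qed
  have surj: "T \<subseteq> \<phi> ` RC"
  proof
    fix x assume x: "x \<in> T"
    obtain s ds where sd: "x = (s, ds)" by (cases x)
    have s: "s \<le> ?n" and ds: "set ds \<subseteq> \<Gamma> \<times> UNIV - {(0, [])}"
      "concat (map snd ds) = drop s Y @ w # take s Y" "sum_list (map fst ds) = \<beta>"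
      using x sd by (auto simp: T_def blocks_def)
    obtain xs g b1 b2 ys where d: "ds = xs @ (g, b1 @ w # b2) # ys"
      "drop s Y = concat (map snd xs) @ b1" "take s Y = b2 @ concat (map snd ys)"
      using block_containing_letter[OF ds(2)] by blast
    have Yeq: "Y = b2 @ concat (map snd (ys @ xs)) @ b1"
      using append_take_drop_id[of s Y] d by simp
    let ?s = "length b2" and ?t = "length (concat (map snd (ys @ xs)))"
    have "set xs \<subseteq> \<Gamma> \<times> UNIV - {(0, [])}" "set ys \<subseteq> \<Gamma> \<times> UNIV - {(0, [])}" "g \<in> \<Gamma>"
      using ds(1) d(1) by auto
    hence zs: "ys @ xs \<in> blocks (sum_list (map fst (ys @ xs))) (concat (map snd (ys @ xs)))"
      "sum_list (map fst (ys @ xs)) \<in> \<Gamma>" "g \<in> \<Gamma>"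
      by (force simp: blocks_def intro!: sum_list_in_exponents)+
    have gb: "sum_list (map fst (ys @ xs)) + g = \<beta>"
      using ds(3) d(1) by (simp add: algebra_simps)
    have sb: "take ?s Y = b2" "take ?t (drop ?s Y) = concat (map snd (ys @ xs))"
      "drop ?t (drop ?s Y) = b1" "?t \<le> ?n - ?s" "?s \<le> ?n"
      by (subst Yeq; simp)+
    have "((?s, (sum_list (map fst (ys @ xs)), g), ?t, ys @ xs), length ys) \<in> RC"
      using zs gb unfolding RC_def R_def
      by (auto simp: sb splits_def simp del: map_append concat_append sum_list_append)
    moreover have "?s + length (concat (map snd ys)) = s"
      using arg_cong[OF d(3), of length] s by simp
    hence "\<phi> ((?s, (sum_list (map fst (ys @ xs)), g), ?t, ys @ xs), length ys) = x"
      unfolding \<phi>_def sd using sb(1,3) d(1) by simp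
    ultimately show "x \<in> \<phi> ` RC" by (metis image_eqI)
  qed
  \<comment> \<open>The sign of the rotation of the word compensates the one of the rotation of the blocks.\<close>
  have QR: "Q (\<phi> ((s, (\<beta>', g), t, zs), c)) =
      koszul (?E s) (polygon \<alpha> (zs @ [(g, ?b s t)])) / of_nat (Suc (length zs))"
    if xr: "((s, (\<beta>', g), t, zs), c) \<in> RC" for s \<beta>' g t zs c
  proof -
    have rR: "(s, (\<beta>', g), t, zs) \<in> R" and c: "c \<le> length zs" using xr by (auto simp: RC_def)
    have letters: "set (drop c zs @ (g, ?b s t) # take c zs) \<subseteq> \<Gamma> \<times> lists L"
    proof -
      let ?s' = "s + ?len c zs"
      have "drop c zs @ (g, ?b s t) # take c zs \<in> blocks \<beta> (drop ?s' Y @ w # take ?s' Y)"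
        using mem[OF xr] by (simp add: T_def \<phi>_def)
      moreover have "drop ?s' Y @ w # take ?s' Y \<in> lists L"
        using Y w set_take_subset set_drop_subset by (fastforce simp: in_lists_conv_set)
      ultimately show ?thesis by (rule blocks_letters)
    qed
    let ?v = "total deg (concat (map snd (take c zs)))"
    have tY: "total deg Y = total deg (take s Y) + ?v +
        total deg (concat (map snd (drop c zs))) + total deg (drop t (drop s Y))"
      by (subst YR[OF rR, of c]) simp
    note tk = cutY[OF rR, of c, THEN conjunct1]
    have "polygon \<alpha> ((drop c zs @ [(g, ?b s t)]) @ take c zs) =
        koszul ((D - ?v) * ?v) (polygon \<alpha> (take c zs @ drop c zs @ [(g, ?b s t)]))"
      using letters by (subst polygon_rotate[OF \<alpha>]) (auto simp: D tY algebra_simps)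
    also have "take c zs @ drop c zs @ [(g, ?b s t)] = zs @ [(g, ?b s t)]"
      by (metis append_assoc append_take_drop_id)
    finally have "polygon \<alpha> (drop c zs @ (g, ?b s t) # take c zs) =
        koszul ((D - ?v) * ?v) (polygon \<alpha> (zs @ [(g, ?b s t)]))" by simp
    moreover have "koszul (?E (s + ?len c zs)) (koszul ((D - ?v) * ?v) x) = koszul (?E s) x" for x :: 'k
      unfolding koszul_koszul by (rule koszul_cong) (simp add: tk algebra_simps)
    ultimately show ?thesis using c by (simp add: Q_def \<phi>_def)
  qed
  have finR: "finite R" unfolding R_def by (intro finite_SigmaI finite_splits finite_blocks) auto
  have "(\<Sum>s\<le>?n. \<Sum>ds\<in>blocks \<beta> (drop s Y @ w # take s Y).
      koszul (?E s) (polygon \<alpha> ds) / of_nat (length ds)) = sum Q T"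
    unfolding T_def Q_def by (subst sum.Sigma) (auto simp: finite_blocks)
  also have "\<dots> = (\<Sum>x\<in>RC. Q (\<phi> x))"
    by (rule sum.reindex_bij_betw[symmetric]) (use inj mem surj in \<open>auto simp: bij_betw_def\<close>)
  also have "\<dots> = (\<Sum>r\<in>R. \<Sum>c\<le>length (snd (snd (snd r))). Q (\<phi> (r, c)))"
    unfolding RC_def by (subst sum.Sigma) (auto simp: finR split_def)
  also have "\<dots> = (\<Sum>(s, (\<beta>', g), t, zs)\<in>R. koszul (?E s) (polygon \<alpha> (zs @ [(g, ?b s t)])))"
  proof (rule sum.cong[OF refl])
    fix r assume r: "r \<in> R"
    obtain s \<beta>' g t zs where rr: "r = (s, (\<beta>', g), t, zs)" by (metis prod.exhaust)
    have "(\<Sum>c\<le>length zs. Q (\<phi> (r, c))) =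
        (\<Sum>c\<le>length zs. koszul (?E s) (polygon \<alpha> (zs @ [(g, ?b s t)])) / of_nat (Suc (length zs)))"
    proof (intro sum.cong refl)
      fix c assume "c \<in> {..length zs}"
      hence "((s, (\<beta>', g), t, zs), c) \<in> RC" using r by (simp add: rr RC_def)
      from QR[OF this] show "Q (\<phi> (r, c)) =
          koszul (?E s) (polygon \<alpha> (zs @ [(g, ?b s t)])) / of_nat (Suc (length zs))"
        by (simp only: rr)
    qed
    also have "\<dots> = koszul (?E s) (polygon \<alpha> (zs @ [(g, ?b s t)]))"
      by (simp del: of_nat_Suc add: field_simps)
    finally show "(\<Sum>c\<le>length (snd (snd (snd r))). Q (\<phi> (r, c))) =
        (\<lambda>(s, (\<beta>', g), t, zs). koszul (?E s) (polygon \<alpha> (zs @ [(g, ?b s t)]))) r"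
      by (simp add: rr)
  qed
  also have "\<dots> = (\<Sum>s\<le>?n. \<Sum>(\<beta>', g)\<in>splits \<beta>. \<Sum>t\<le>?n - s. \<Sum>zs\<in>blocks \<beta>' (take t (drop s Y)).
      koszul (?E s) (polygon \<alpha> (zs @ [(g, ?b s t)])))"
    unfolding R_def
    by (subst sum.Sigma[symmetric], simp, intro ballI finite_SigmaI finite_splits finite_blocks, simp,
        intro sum.cong refl, subst sum.Sigma[symmetric], rule finite_splits,
        intro ballI finite_SigmaI finite_blocks, simp, intro sum.cong refl,
        simp add: split_def, subst sum.Sigma, simp, simp add: finite_blocks,
        simp add: split_def)
  finally show ?thesis .
qed

text \<open>
  The relation for \<open>h\<close> turns \<open>m\<^sup>A(h(\<dots>), \<dots>, h(\<dots>))\<close> into a sum of terms \<open>h(\<dots>, z, \<dots>)\<close> with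
  \<open>z = m\<^sup>B(\<dots>)\<close>.  For a fixed choice of the arguments of \<open>m\<^sup>B\<close>, the remaining sums over \<open>s\<close> and \<open>t\<close>
  run over the cuts that separate \<open>z\<close> from \<open>w\<close>.  By \<open>separating_cuts\<close> they vanish unless \<open>z\<close> and
  \<open>w\<close> are the only letters, that is, unless \<open>m\<^sup>B\<close> takes all of \<open>Y\<close>.
\<close>
lemma marked_polygon_sum:
  assumes Y: "Y \<in> lists L" and w: "w \<in> L" and \<gamma>: "\<gamma> \<in> \<Gamma>" and D: "D = total deg Y + deg w"
  shows "(\<Sum>s\<le>length Y. \<Sum>t\<le>length Y - s. \<Sum>(\<delta>, g)\<in>splits \<gamma>.
      \<Sum>(\<alpha>, \<beta>)\<in>splits \<delta>. \<Sum>ds\<in>blocks \<beta> (take t (drop s Y)).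
        koszul ((D - 1) * total deg (take s Y))
          (polygon \<alpha> (ds @ [(g, drop t (drop s Y) @ w # take s Y)]))) = pB (mB \<gamma> Y) w"
    (is "(\<Sum>s\<le>_. \<Sum>t\<le>_. ?lhs s t) = _")
proof -
  let ?n = "length Y" and ?E = "\<lambda>s. (D - 1) * total deg (take s Y)"
  let ?b = "\<lambda>s t. drop t (drop s Y) @ w # take s Y"
  have sub: "take k Y \<in> lists L" "drop k Y \<in> lists L" for k
    using Y set_take_subset set_drop_subset by (fastforce simp: in_lists_conv_set)+
  have sub2: "take t (drop s Y) \<in> lists L" for s t
    using sub(2)[of s] set_take_subset by (fastforce simp: in_lists_conv_set)
  \<comment> \<open>\<open>C s t p j\<close>: the operation \<open>m\<^sup>B\<close> takes the \<open>j\<close> letters after the first \<open>p\<close> ones, and the two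
    cuts are at position \<open>s\<close> of the letters before these and at position \<open>t\<close> of those after.\<close>
  define C where "C = (\<lambda>s t p j. koszul (?E s + total deg (drop s (take p Y)))
    (\<Sum>(\<beta>, \<delta>)\<in>splits \<gamma>. cut \<delta> (drop s (take p Y) @ mB \<beta> (take j (drop p Y)) # take t (drop (p + j) Y))
      (drop t (drop (p + j) Y) @ w # take s Y)))"
  have inner: "?lhs s t = (\<Sum>(i, j) | i + j \<le> t. C s (t - i - j) (s + i) j)"
    if st: "s + t \<le> ?n" for s t
  proof -
    let ?S = "take t (drop s Y)"
    let ?hm = "\<lambda>\<alpha> \<beta> i j. h \<alpha> (take i ?S @ mB \<beta> (take j (drop i ?S)) # drop (i + j) ?S)"
    have "?lhs s t = (\<Sum>(\<delta>, g)\<in>splits \<gamma>. koszul (?E s)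
        (pA (\<Sum>(\<alpha>, \<beta>)\<in>splits \<delta>. \<Sum>ds\<in>blocks \<beta> ?S. mA \<alpha> (map (case_prod h) ds)) (h g (?b s t))))"
      by (simp add: polygon_def pA_sum koszul_sum split_def)
    also have "\<dots> = (\<Sum>(\<delta>, g)\<in>splits \<gamma>. koszul (?E s)
        (pA (\<Sum>(i, j) | i + j \<le> length ?S. \<Sum>(\<alpha>, \<beta>)\<in>splits \<delta>.
           koszul (total deg (take i ?S)) (?hm \<alpha> \<beta> i j)) (h g (?b s t))))"
      by (intro sum.cong refl) (auto simp: splits_def[of \<gamma>] h_relation sub2)
    also have "\<dots> = (\<Sum>(\<delta>, g)\<in>splits \<gamma>. \<Sum>(i, j) | i + j \<le> t. \<Sum>(\<alpha>, \<beta>)\<in>splits \<delta>.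
        koszul (?E s + total deg (take i ?S)) (pA (?hm \<alpha> \<beta> i j) (h g (?b s t))))"
      using st by (simp add: pA_sum pA_koszul koszul_sum koszul_koszul split_def)
    also have "\<dots> = (\<Sum>(i, j) | i + j \<le> t. \<Sum>(\<delta>, g)\<in>splits \<gamma>. \<Sum>(\<alpha>, \<beta>)\<in>splits \<delta>.
        koszul (?E s + total deg (take i ?S)) (pA (?hm \<alpha> \<beta> i j) (h g (?b s t))))"
      unfolding split_def by (rule sum.swap)
    also have "\<dots> = (\<Sum>(i, j) | i + j \<le> t. C s (t - i - j) (s + i) j)"
    proof (intro sum.cong refl, clarify)
      fix i j assume ij: "i + j \<le> t"
      have words: "take i ?S = drop s (take (s + i) Y)" "take j (drop i ?S) = take j (drop (s + i) Y)"
        "drop (i + j) ?S = take (t - i - j) (drop (s + i + j) Y)"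
        "drop t (drop s Y) = drop (t - i - j) (drop (s + i + j) Y)"
        subgoal using ij by (simp add: take_drop add.commute)
        subgoal using ij by (simp add: drop_take add.commute)
        subgoal by (simp add: drop_take add_ac)
        subgoal using ij by (simp add: add_ac)
        done
      have "(\<Sum>(\<delta>, g)\<in>splits \<gamma>. \<Sum>(\<alpha>, \<beta>)\<in>splits \<delta>.
          koszul (?E s + total deg (take i ?S)) (pA (?hm \<alpha> \<beta> i j) (h g (?b s t)))) =
        (\<Sum>(\<delta>, g)\<in>splits \<gamma>. \<Sum>(\<beta>, \<alpha>)\<in>splits \<delta>.
          koszul (?E s + total deg (take i ?S)) (pA (?hm \<alpha> \<beta> i j) (h g (?b s t))))"
        by (intro sum.cong refl, clarify) (rule sum_splits_swap)
      also have "\<dots> = (\<Sum>(\<beta>, \<delta>)\<in>splits \<gamma>. \<Sum>(\<alpha>, g)\<in>splits \<delta>.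
          koszul (?E s + total deg (take i ?S)) (pA (?hm \<alpha> \<beta> i j) (h g (?b s t))))"
        by (rule sum_splits_assoc[symmetric])
      also have "\<dots> = C s (t - i - j) (s + i) j"
        unfolding C_def cut_def words by (simp add: koszul_sum split_def)
      finally show "(\<Sum>(\<delta>, g)\<in>splits \<gamma>. \<Sum>(\<alpha>, \<beta>)\<in>splits \<delta>.
          koszul (?E s + total deg (take i ?S)) (pA (?hm \<alpha> \<beta> i j) (h g (?b s t)))) =
          C s (t - i - j) (s + i) j" .
    qed
    finally show ?thesis .
  qed
  have fin2: "finite {(i, j). i + j \<le> (k::nat)}" for k
    by (rule finite_subset[of _ "{..k} \<times> {..k}"]) auto
  have "(\<Sum>s\<le>?n. \<Sum>t\<le>?n - s. ?lhs s t) =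
      (\<Sum>s\<le>?n. \<Sum>t\<le>?n - s. \<Sum>(i, j) | i + j \<le> t. C s (t - i - j) (s + i) j)"
    by (intro sum.cong refl inner) auto
  also have "\<dots> = (\<Sum>(s, t, i, j)\<in>(SIGMA s:{..?n}. SIGMA t:{..?n - s}. {(i, j). i + j \<le> t}).
      C s (t - i - j) (s + i) j)"
    by (rule sum_Sigma3) (auto simp: fin2)
  also have "\<dots> = (\<Sum>(q, s, t)\<in>(SIGMA q:{(p, j). p + j \<le> ?n}. SIGMA s:{..fst q}. {..?n - fst q - snd q}).
      C s t (fst q) (snd q))"
    by (rule sum.reindex_bij_witness[of _ "\<lambda>((p, j), s, t). (s, t + (p - s) + j, p - s, j)"
          "\<lambda>(s, t, i, j). ((s + i, j), s, t - i - j)"]) auto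
  also have "\<dots> = (\<Sum>(p, j) | p + j \<le> ?n. \<Sum>s\<le>p. \<Sum>t\<le>?n - p - j. C s t p j)"
    unfolding split_def by (rule sum_Sigma3[symmetric, unfolded split_def]) (use fin2[of ?n] in \<open>auto simp: split_def\<close>)
  also have "\<dots> = (\<Sum>(p, j) | p + j \<le> ?n. if p = 0 \<and> j = ?n then pB (mB \<gamma> Y) w else 0)"
  proof (intro sum.cong refl, clarify)
    fix p j assume pj: "p + j \<le> ?n"
    let ?U = "take p Y" and ?M = "take j (drop p Y)" and ?V = "drop (p + j) Y"
    have L: "?U \<in> lists L" "?M \<in> lists L" "?V \<in> lists L" using sub sub2 by auto
    have len: "length ?U = p" "length ?V = ?n - p - j" using pj by auto
    have tY: "total deg Y = total deg ?U + total deg ?M + total deg ?V"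
    proof -
      have "Y = ?U @ ?M @ ?V" by (metis add.commute append_take_drop_id drop_drop)
      hence "map deg Y = map deg ?U @ map deg ?M @ map deg ?V" by (metis map_append)
      thus ?thesis by simp
    qed
    let ?cut = "\<lambda>\<beta> \<delta> s t. cut \<delta> (drop s ?U @ mB \<beta> ?M # take t ?V) (drop t ?V @ w # take s ?U)"
    \<comment> \<open>Since \<open>m\<^sup>B\<close> has odd degree, the cyclic word with \<open>z\<close> in place of its arguments has the
      opposite parity.  With the sign of the relation for \<open>h\<close>, this turns the sign of a rotation
      of the word \<open>Y w\<close> into that of a rotation of the new word, up to a sign that depends on \<open>p\<close> only.\<close>
    have Ceq: "C s t p j = (\<Sum>(\<beta>, \<delta>)\<in>splits \<gamma>. koszul (total deg ?U)
        (koszul ((total deg ?U + deg (mB \<beta> ?M) + total deg ?V + deg w - 1) * total deg (take s ?U))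
          (?cut \<beta> \<delta> s t)))" if s: "s \<le> p" for s t
    proof -
      have tU: "total deg ?U = total deg (take s Y) + total deg (drop s ?U)"
      proof -
        have "?U = take s Y @ drop s ?U" using s by (metis append_take_drop_id min.absorb1 take_take)
        hence "map deg ?U = map deg (take s Y) @ map deg (drop s ?U)" by (metis map_append)
        thus ?thesis by simp
      qed
      have tk: "take s ?U = take s Y" using s by (simp add: min_def)
      show ?thesis unfolding C_def koszul_sum tk
      proof (intro sum.cong refl, clarify)
        fix \<beta> \<delta> assume "(\<beta>, \<delta>) \<in> splits \<gamma>"
        hence "\<beta> \<in> \<Gamma>" by (simp add: splits_def)
        from deg_mB[OF this L(2)] have "even (deg (mB \<beta> ?M) - total deg ?M - 1)" .
        then obtain q where "deg (mB \<beta> ?M) - total deg ?M - 1 = 2 * q" by (rule evenE)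
        hence q: "deg (mB \<beta> ?M) = total deg ?M + 1 + 2 * q" by simp
        show "koszul (?E s + total deg (drop s ?U))
            (cut \<delta> (drop s ?U @ mB \<beta> ?M # take t ?V) (drop t ?V @ w # take s Y)) =
          koszul (total deg ?U) (koszul ((total deg ?U + deg (mB \<beta> ?M) + total deg ?V + deg w - 1) *
            total deg (take s Y)) (cut \<delta> (drop s ?U @ mB \<beta> ?M # take t ?V) (drop t ?V @ w # take s Y)))"
          unfolding koszul_koszul by (rule koszul_cong) (simp add: D tY q tU algebra_simps)
      qed
    qed
    have "(\<Sum>s\<le>p. \<Sum>t\<le>?n - p - j. C s t p j) =
        (\<Sum>s\<le>p. \<Sum>t\<le>?n - p - j. \<Sum>(\<beta>, \<delta>)\<in>splits \<gamma>. koszul (total deg ?U)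
        (koszul ((total deg ?U + deg (mB \<beta> ?M) + total deg ?V + deg w - 1) * total deg (take s ?U))
          (?cut \<beta> \<delta> s t)))"
      by (intro sum.cong refl Ceq) auto
    also have "\<dots> = (\<Sum>(\<beta>, \<delta>)\<in>splits \<gamma>. \<Sum>s\<le>p. \<Sum>t\<le>?n - p - j. koszul (total deg ?U)
        (koszul ((total deg ?U + deg (mB \<beta> ?M) + total deg ?V + deg w - 1) * total deg (take s ?U))
          (?cut \<beta> \<delta> s t)))"
      unfolding split_def by (rule sum_swap_nested)
    also have "\<dots> = (\<Sum>(\<beta>, \<delta>)\<in>splits \<gamma>. koszul (total deg ?U)
        (\<Sum>s\<le>length ?U. koszul ((total deg ?U + deg (mB \<beta> ?M) + total deg ?V + deg w - 1) * total deg (take s ?U))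
          (\<Sum>t\<le>length ?V. ?cut \<beta> \<delta> s t)))"
      unfolding len by (simp add: koszul_sum)
    also have "\<dots> = (\<Sum>(\<beta>, \<delta>)\<in>splits \<gamma>. koszul (total deg ?U)
        (if ?U = [] \<and> ?V = [] \<and> \<delta> = 0 then pB (mB \<beta> ?M) w else 0))"
    proof (intro sum.cong refl, clarify)
      fix \<beta> \<delta> assume "(\<beta>, \<delta>) \<in> splits \<gamma>"
      hence "\<beta> \<in> \<Gamma>" "\<delta> \<in> \<Gamma>" by (auto simp: splits_def)
      from separating_cuts[OF L(1,3) mB_letter[OF this(1) L(2)] w this(2) refl]
      show "koszul (total deg ?U) (\<Sum>s\<le>length ?U.
            koszul ((total deg ?U + deg (mB \<beta> ?M) + total deg ?V + deg w - 1) * total deg (take s ?U))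
          (\<Sum>t\<le>length ?V. ?cut \<beta> \<delta> s t)) =
        koszul (total deg ?U) (if ?U = [] \<and> ?V = [] \<and> \<delta> = 0 then pB (mB \<beta> ?M) w else 0)"
        by simp
    qed
    also have "\<dots> = (if p = 0 \<and> j = ?n then pB (mB \<gamma> Y) w else 0)"
    proof (cases "p = 0 \<and> j = ?n")
      case True
      have "(\<Sum>(\<beta>, \<delta>)\<in>splits \<gamma>. if \<delta> = 0 then pB (mB \<beta> Y) w else 0) =
          (\<Sum>(\<beta>, \<delta>)\<in>{(\<gamma>, 0 :: real \<times> int)}. if \<delta> = 0 then pB (mB \<beta> Y) w else 0)"
        by (rule sum.mono_neutral_right[OF finite_splits])
           (use \<gamma> zero_in_exponents in \<open>auto simp: splits_def zero_prod_def split: if_splits\<close>)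
      moreover have "?U = []" "?V = []" "?M = Y" using True by auto
      ultimately show ?thesis using True by (simp only:) simp
    next
      case False
      hence "\<not> (?U = [] \<and> ?V = [])" using pj len by auto
      hence "(\<Sum>(\<beta>, \<delta>)\<in>splits \<gamma>. koszul (total deg ?U)
          (if ?U = [] \<and> ?V = [] \<and> \<delta> = 0 then pB (mB \<beta> ?M) w else 0)) = 0"
        by (intro sum.neutral) auto
      thus ?thesis using False by (simp only: if_False)
    qed
    finally show "(\<Sum>s\<le>p. \<Sum>t\<le>?n - p - j. C s t p j) =
        (if p = 0 \<and> j = ?n then pB (mB \<gamma> Y) w else 0)" .
  qed
  also have "\<dots> = (\<Sum>(p, j)\<in>{(0 :: nat, ?n)}. if p = 0 \<and> j = ?n then pB (mB \<gamma> Y) w else 0)"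
    by (rule sum.mono_neutral_right[OF fin2]) (auto split: if_splits)
  finally show ?thesis by simp
qed

theorem cyclized_polygon_sum:
  assumes Y: "Y \<in> lists L" and w: "w \<in> L" and \<gamma>: "\<gamma> \<in> \<Gamma>" and D: "D = total deg Y + deg w"
  shows "(\<Sum>s\<le>length Y. koszul ((D - 1) * total deg (take s Y))
      (\<Sum>(\<alpha>, \<beta>)\<in>splits \<gamma>. \<Sum>ds\<in>blocks \<beta> (drop s Y @ w # take s Y).
        polygon \<alpha> ds / of_nat (length ds))) = pB (mB \<gamma> Y) w"
proof -
  let ?n = "length Y" and ?E = "\<lambda>s. (D - 1) * total deg (take s Y)"
  let ?q = "\<lambda>s t \<alpha> \<beta> g. \<Sum>ds\<in>blocks \<beta> (take t (drop s Y)). koszul (?E s)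
        (polygon \<alpha> (ds @ [(g, drop t (drop s Y) @ w # take s Y)]))"
  have kdiv: "koszul n (x / y) = koszul n x / y" for n and x y :: 'k by (simp add: koszul_def)
  have "(\<Sum>s\<le>?n. koszul (?E s) (\<Sum>(\<alpha>, \<beta>)\<in>splits \<gamma>. \<Sum>ds\<in>blocks \<beta> (drop s Y @ w # take s Y).
        polygon \<alpha> ds / of_nat (length ds))) =
      (\<Sum>(\<alpha>, \<beta>)\<in>splits \<gamma>. \<Sum>s\<le>?n. \<Sum>ds\<in>blocks \<beta> (drop s Y @ w # take s Y).
        koszul (?E s) (polygon \<alpha> ds) / of_nat (length ds))"
    unfolding split_def koszul_sum kdiv by (rule sum.swap)
  also have "\<dots> = (\<Sum>(\<alpha>, \<beta>)\<in>splits \<gamma>. \<Sum>s\<le>?n. \<Sum>(\<beta>', g)\<in>splits \<beta>. \<Sum>t\<le>?n - s. ?q s t \<alpha> \<beta>' g)"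
    by (intro sum.cong refl, clarify)
       (rule polygon_sum_over_rotations[OF Y w _ D], simp add: splits_def)
  also have "\<dots> = (\<Sum>s\<le>?n. \<Sum>(\<alpha>, \<beta>)\<in>splits \<gamma>. \<Sum>(\<beta>', g)\<in>splits \<beta>. \<Sum>t\<le>?n - s. ?q s t \<alpha> \<beta>' g)"
    unfolding split_def by (rule sum.swap)
  also have "\<dots> = (\<Sum>s\<le>?n. \<Sum>(\<delta>, g)\<in>splits \<gamma>. \<Sum>(\<alpha>, \<beta>')\<in>splits \<delta>. \<Sum>t\<le>?n - s. ?q s t \<alpha> \<beta>' g)"
    by (subst sum_splits_assoc) (rule refl)
  also have "\<dots> = (\<Sum>s\<le>?n. \<Sum>t\<le>?n - s. \<Sum>(\<delta>, g)\<in>splits \<gamma>. \<Sum>(\<alpha>, \<beta>')\<in>splits \<delta>. ?q s t \<alpha> \<beta>' g)"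
    unfolding split_def by (intro sum.cong refl) (rule sum_swap_nested)
  also have "\<dots> = pB (mB \<gamma> Y) w" by (rule marked_polygon_sum[OF Y w \<gamma> D])
  finally show ?thesis .
qed

end


section \<open>Coefficients of Novikov series\<close>

lemma nov_coeff_nov_sum:
  assumes "nov_summable F I" "finite S" "S \<subseteq> I" "\<And>i. i \<in> I - S \<Longrightarrow> nov_coeff (F i) \<gamma> = 0"
  shows "nov_coeff (nov_sum F I) \<gamma> = (\<Sum>i\<in>S. nov_coeff (F i) \<gamma>)"
  unfolding nov_sum.rep_eq using assms by (auto intro!: sum.mono_neutral_left)

lemma nov_coeff_sum: "nov_coeff (sum F A) \<gamma> = (\<Sum>i\<in>A. nov_coeff (F i) \<gamma>)"
  by (induction A rule: infinite_finite_induct) (simp_all add: zero_novikov.rep_eq plus_novikov.rep_eq)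

lemma nov_coeff_koszul: "nov_coeff (koszul n X) \<gamma> = koszul n (nov_coeff X \<gamma>)"
  by (rule additive_koszul[of "\<lambda>X. nov_coeff X \<gamma>"]) (simp add: plus_novikov.rep_eq)

lemma nov_coeff_const: "nov_coeff (nov_const v) \<gamma> = (if \<gamma> = 0 then v else 0)"
  by (simp add: nov_monom.rep_eq)

lemma nov_coeff_const_times: "nov_coeff (nov_const c * X) \<gamma> = c * nov_coeff X \<gamma>"
proof -
  have "nov_coeff (nov_const c * X) \<gamma> = (\<Sum>\<alpha>\<in>{0}. nov_coeff (nov_const c) \<alpha> * nov_coeff X (\<gamma> - \<alpha>))"
    by (rule nov_coeff_times) (auto simp: nov_coeff_const)
  thus ?thesis by (simp add: nov_coeff_const)
qed

lemma multilinear_zero: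
  assumes "multilinear (length xs) s1 s2 f" "0 \<in> set xs"
  shows "f xs = 0"
proof -
  obtain i where i: "i < length xs" "xs ! i = 0" using assms(2) by (metis in_set_conv_nth)
  have "Vector_Spaces.linear s1 s2 (\<lambda>x. f (xs[i := x]))"
    using assms(1) i unfolding multilinear_def by blast
  hence "f (xs[i := 0 + 0]) = f (xs[i := 0]) + f (xs[i := 0])"
    unfolding Vector_Spaces.linear_iff by blast
  moreover have "xs[i := 0] = xs" using i by (metis list_update_id)
  ultimately show ?thesis by simp
qed

lemma concat_eq_map:
  "concat bs = map g xs \<Longrightarrow> \<exists>cs. concat cs = xs \<and> bs = map (map g) cs"
proof (induction bs arbitrary: xs)
  case (Cons b bs)
  let ?n = "length b"
  have "b @ concat bs = map g (take ?n xs @ drop ?n xs)" using Cons.prems by simp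
  moreover have "length b = length (map g (take ?n xs))"
    using arg_cong[OF Cons.prems, of length] by simp
  ultimately have "b = map g (take ?n xs)" "concat bs = map g (drop ?n xs)"
    by (metis append_eq_append_conv map_append)+
  with Cons.IH obtain cs where cs: "concat cs = drop ?n xs" "bs = map (map g) cs" by blast
  have "concat (take ?n xs # cs) = xs" using cs(1) by simp
  moreover have "b # bs = map (map g) (take ?n xs # cs)"
    unfolding list.map using \<open>b = map g (take ?n xs)\<close> cs(2) by (rule arg_cong2[where f = "(#)"])
  ultimately show ?case by (intro exI[of _ "take ?n xs # cs"] conjI)
qed simp

text \<open>
  The map \<open>g\<close> may identify letters: a decomposition of a given word is determined by the
  lengths of its blocks.
\<close>
lemma map_blocks_inj:
  assumes "concat cs = concat cs'" "map (map g) cs = map (map g) cs'"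
  shows "cs = cs'"
proof -
  have len: "length cs = length cs'" using arg_cong[OF assms(2), of length] by simp
  have "\<forall>(x, y)\<in>set (zip cs cs'). length x = length y"
  proof clarify
    fix x y assume "(x, y) \<in> set (zip cs cs')"
    then obtain i where i: "i < length cs" "i < length cs'" "x = cs ! i" "y = cs' ! i"
      by (auto simp: in_set_zip)
    have "map (map g) cs ! i = map (map g) cs' ! i" using assms(2) by simp
    thus "length x = length y" using i by (metis length_map nth_map)
  qed
  thus ?thesis using assms(1) len by (metis concat_injective)
qed

text \<open>
  The component \<open>f\<^sub>k\<^sub>,\<^sub>\<beta>\<close> is indexed by the exponent \<open>(\<lambda>, n)\<close> of \<open>T\<close> and \<open>e\<close> instead of \<open>\<beta> = (\<lambda>, 2 n)\<close>,
  and \<open>k\<close> is read off from the list of arguments.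
\<close>
definition component :: "(nat \<Rightarrow> real \<times> int \<Rightarrow> 'a list \<Rightarrow> 'b) \<Rightarrow> real \<times> int \<Rightarrow> 'a list \<Rightarrow> 'b"
  where "component f \<gamma> xs = f (length xs) (fst \<gamma>, 2 * snd \<gamma>) xs"

context gapping_monoid
begin

lemma in_exponentsD: "\<gamma> \<in> \<Gamma> \<Longrightarrow> (fst \<gamma>, 2 * snd \<gamma>) \<in> G"
  by (simp add: exponents_def)

lemma splits_outside: "\<gamma> \<notin> \<Gamma> \<Longrightarrow> splits \<gamma> = {}"
  using add_in_exponents by (auto simp: splits_def)

text \<open>
  All series that arise from the structure maps and from constants are of this form, and
  coefficients of their products are sums over the finite sets \<open>splits \<gamma>\<close>.
\<close>
definition gapped :: "'v::zero novikov \<Rightarrow> bool"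
  where "gapped X \<longleftrightarrow> (\<forall>\<gamma>. nov_coeff X \<gamma> \<noteq> 0 \<longrightarrow> \<gamma> \<in> \<Gamma>)"

lemma gapped_const: "gapped (nov_const v)"
  by (simp add: gapped_def nov_coeff_const zero_in_exponents)

lemma gapped_sum: "(\<And>i. i \<in> A \<Longrightarrow> gapped (F i)) \<Longrightarrow> gapped (sum F A)"
  unfolding gapped_def nov_coeff_sum by (metis (no_types, lifting) sum.not_neutral_contains_not_neutral)

lemma nov_coeff_times_gapped:
  assumes "gapped X" "gapped Y"
  shows "nov_coeff (X * Y) \<gamma> = (\<Sum>(\<alpha>, \<beta>)\<in>splits \<gamma>. nov_coeff X \<alpha> * nov_coeff Y \<beta>)"
proof -
  let ?S = "fst ` splits \<gamma> \<union> {\<alpha>. nov_coeff X \<alpha> \<noteq> 0 \<and> fst \<alpha> \<le> fst \<gamma>}"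
  have "nov_coeff (X * Y) \<gamma> = (\<Sum>\<alpha>\<in>?S. nov_coeff X \<alpha> * nov_coeff Y (\<gamma> - \<alpha>))"
    by (rule nov_coeff_times) (auto simp: finite_splits finite_nov_coeff)
  also have "\<dots> = (\<Sum>\<alpha>\<in>fst ` splits \<gamma>. nov_coeff X \<alpha> * nov_coeff Y (\<gamma> - \<alpha>))"
  proof (rule sum.mono_neutral_right)
    show "\<forall>\<alpha>\<in>?S - fst ` splits \<gamma>. nov_coeff X \<alpha> * nov_coeff Y (\<gamma> - \<alpha>) = 0"
    proof (clarify, rule ccontr)
      fix a b assume nin: "(a, b) \<notin> fst ` splits \<gamma>"
        and nz: "nov_coeff X (a, b) * nov_coeff Y (\<gamma> - (a, b)) \<noteq> 0"
      have "nov_coeff X (a, b) \<noteq> 0" "nov_coeff Y (\<gamma> - (a, b)) \<noteq> 0" using nz by auto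
      hence "((a, b), \<gamma> - (a, b)) \<in> splits \<gamma>"
        using assms unfolding gapped_def splits_def by (simp del: split_paired_All)
      thus False using nin by force
    qed
  qed (auto simp: finite_splits finite_nov_coeff)
  also have "\<dots> = (\<Sum>(\<alpha>, \<beta>)\<in>splits \<gamma>. nov_coeff X \<alpha> * nov_coeff Y \<beta>)"
    by (subst sum.reindex) (auto simp: inj_on_def splits_def intro!: sum.cong)
  finally show ?thesis .
qed

lemma gapped_times:
  assumes "gapped X" "gapped Y"
  shows "gapped (X * Y)"
  unfolding gapped_def nov_coeff_times_gapped[OF assms] using splits_outside by fastforce

definition tuples :: "nat \<Rightarrow> real \<times> int \<Rightarrow> (real \<times> int) list set"
  where "tuples n \<gamma> = {gs. set gs \<subseteq> \<Gamma> \<and> length gs = n \<and> sum_list gs = \<gamma>}"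

lemma fst_le_sum_list: "set gs \<subseteq> \<Gamma> \<Longrightarrow> g \<in> set gs \<Longrightarrow> fst g \<le> fst (sum_list gs)"
proof (induction gs)
  case (Cons a gs)
  have "0 \<le> fst a" "0 \<le> fst (sum_list gs)"
    using Cons.prems exponents_nonneg sum_list_in_exponents by auto
  thus ?case using Cons by fastforce
qed simp

lemma finite_tuples: "finite (tuples n \<gamma>)"
proof (rule finite_subset)
  show "tuples n \<gamma> \<subseteq> {gs. set gs \<subseteq> {\<alpha>\<in>\<Gamma>. fst \<alpha> \<le> fst \<gamma>} \<and> length gs = n}"
    unfolding tuples_def using fst_le_sum_list by auto
qed (rule finite_lists_length_eq[OF finite_exponents_le])

lemma tuples_0: "tuples 0 \<gamma> = (if \<gamma> = 0 then {[]} else {})"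
  by (auto simp: tuples_def)

lemma sum_tuples_Suc:
  "(\<Sum>gs\<in>tuples (Suc n) \<gamma>. F gs) =
   (\<Sum>(\<alpha>, \<beta>)\<in>splits \<gamma>. \<Sum>gs\<in>tuples n \<beta>. F (\<alpha> # gs) :: 'c::comm_monoid_add)"
proof -
  have "(\<Sum>(\<alpha>, \<beta>)\<in>splits \<gamma>. \<Sum>gs\<in>tuples n \<beta>. F (\<alpha> # gs)) =
      (\<Sum>(p, gs)\<in>(SIGMA p:splits \<gamma>. tuples n (snd p)). F (fst p # gs))"
    unfolding split_def by (subst sum.Sigma) (auto simp: finite_splits finite_tuples split_def)
  also have "\<dots> = (\<Sum>gs\<in>tuples (Suc n) \<gamma>. F gs)"
    by (rule sum.reindex_bij_witness[of _ "\<lambda>gs. ((hd gs, sum_list (tl gs)), tl gs)" "\<lambda>(p, gs). fst p # gs"])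
       (auto simp: tuples_def splits_def length_Suc_conv sum_list_in_exponents)
  finally show ?thesis ..
qed

text \<open>Constant arguments contribute only through their coefficient at \<open>T^0 e^0\<close>.\<close>
lemma sum_tuples_const:
  assumes "\<And>ys. length ys = length us + length Ws \<Longrightarrow> 0 \<in> set ys \<Longrightarrow> \<Phi> ys = 0" and "\<gamma> \<in> \<Gamma>"
  shows "(\<Sum>gs\<in>tuples (length us + length Ws) \<gamma>. \<Phi> (map2 nov_coeff (map nov_const us @ Ws) gs)) =
    (\<Sum>gs\<in>tuples (length Ws) \<gamma>. \<Phi> (us @ map2 nov_coeff Ws gs) :: 'c::comm_monoid_add)"
  using assms(1)
proof (induction us arbitrary: \<Phi>)
  case (Cons u us)
  have "(\<Sum>gs\<in>tuples (length (u # us) + length Ws) \<gamma>.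
        \<Phi> (map2 nov_coeff (map nov_const (u # us) @ Ws) gs)) =
      (\<Sum>(\<alpha>, \<beta>)\<in>splits \<gamma>. \<Sum>gs\<in>tuples (length us + length Ws) \<beta>.
        \<Phi> (nov_coeff (nov_const u) \<alpha> # map2 nov_coeff (map nov_const us @ Ws) gs))"
    by (simp add: sum_tuples_Suc)
  also have "\<dots> = (\<Sum>(\<alpha>, \<beta>)\<in>{(0, \<gamma>)}. \<Sum>gs\<in>tuples (length us + length Ws) \<beta>.
        \<Phi> (nov_coeff (nov_const u) \<alpha> # map2 nov_coeff (map nov_const us @ Ws) gs))"
  proof (rule sum.mono_neutral_right[OF finite_splits])
    show "{(0, \<gamma>)} \<subseteq> splits \<gamma>" using assms(2) zero_in_exponents by (simp add: splits_def)
    show "\<forall>p\<in>splits \<gamma> - {(0, \<gamma>)}. (case p of (\<alpha>, \<beta>) \<Rightarrow> \<Sum>gs\<in>tuples (length us + length Ws) \<beta>.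
        \<Phi> (nov_coeff (nov_const u) \<alpha> # map2 nov_coeff (map nov_const us @ Ws) gs)) = 0"
    proof
      fix p assume p: "p \<in> splits \<gamma> - {(0, \<gamma>)}"
      obtain \<alpha> \<beta> where ab: "p = (\<alpha>, \<beta>)" by (cases p)
      have "\<alpha> \<noteq> 0" using p ab by (auto simp: splits_def)
      hence "(\<Sum>gs\<in>tuples (length us + length Ws) \<beta>.
        \<Phi> (nov_coeff (nov_const u) \<alpha> # map2 nov_coeff (map nov_const us @ Ws) gs)) = 0"
        by (intro sum.neutral ballI Cons.prems) (auto simp: nov_coeff_const tuples_def)
      thus "(case p of (\<alpha>, \<beta>) \<Rightarrow> \<Sum>gs\<in>tuples (length us + length Ws) \<beta>.
        \<Phi> (nov_coeff (nov_const u) \<alpha> # map2 nov_coeff (map nov_const us @ Ws) gs)) = 0"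
        by (simp add: ab)
    qed
  qed
  also have "\<dots> = (\<Sum>gs\<in>tuples (length us + length Ws) \<gamma>.
        (\<lambda>ys. \<Phi> (u # ys)) (map2 nov_coeff (map nov_const us @ Ws) gs))"
    by (simp add: nov_coeff_const)
  also have "\<dots> = (\<Sum>gs\<in>tuples (length Ws) \<gamma>. \<Phi> (u # us @ map2 nov_coeff Ws gs))"
    by (rule Cons.IH) (auto intro!: Cons.prems)
  finally show ?case by simp
qed simp

lemma sum_tuples_all_const:
  assumes "\<And>ys. length ys = length us \<Longrightarrow> 0 \<in> set ys \<Longrightarrow> \<Phi> ys = 0" and "\<gamma> \<in> \<Gamma>"
  shows "(\<Sum>gs\<in>tuples (length us) \<gamma>. \<Phi> (map2 nov_coeff (map nov_const us) gs)) =
    (if \<gamma> = 0 then \<Phi> us else 0 :: 'c::comm_monoid_add)"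
  using sum_tuples_const[of us "[]" \<Phi> \<gamma>] assms by (simp add: tuples_0)

text \<open>
  A nonzero term has nonzero arguments, so all its exponents lie in \<open>\<Gamma>\<close> and have energy at most
  the total one.  As there are finitely many exponents below any energy, the defining sum
  converges and each of its coefficients is a finite sum.
\<close>
lemma nov_coeff_nov_extend:
  assumes f: "\<And>k \<beta>. \<beta> \<in> G \<Longrightarrow> multilinear k s1 s2 (f k \<beta>)"
    and Xs: "\<And>X. X \<in> set Xs \<Longrightarrow> gapped X"
  shows "nov_coeff (nov_extend G f Xs) \<gamma> =
    (\<Sum>(\<alpha>, \<beta>)\<in>splits \<gamma>. \<Sum>gs\<in>tuples (length Xs) \<beta>. component f \<alpha> (map2 nov_coeff Xs gs))"
proof -
  let ?half = "\<lambda>\<beta> :: real \<times> int. (fst \<beta>, snd \<beta> div 2)"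
  let ?dbl = "\<lambda>\<alpha> :: real \<times> int. (fst \<alpha>, 2 * snd \<alpha>)"
  let ?v = "\<lambda>\<beta> gs. f (length Xs) \<beta> (map2 nov_coeff Xs gs)"
  define F where "F = (\<lambda>(\<beta>, gs). nov_monom (?half \<beta> + sum_list gs) (?v \<beta> gs))"
  define I where "I = G \<times> {gs :: (real \<times> int) list. length gs = length Xs}"
  have half: "?half \<beta> \<in> \<Gamma>" "?dbl (?half \<beta>) = \<beta>" if "\<beta> \<in> G" for \<beta>
    using nonneg_even[OF that] that by (auto simp: exponents_def)
  have nz: "set gs \<subseteq> \<Gamma> \<and> ?half \<beta> + sum_list gs = \<gamma>"
    if "(\<beta>, gs) \<in> I" "nov_coeff (F (\<beta>, gs)) \<gamma> \<noteq> 0" for \<beta> gs \<gamma>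
  proof -
    have len: "length gs = length Xs" and \<beta>: "\<beta> \<in> G" using that by (auto simp: I_def)
    have v: "?v \<beta> gs \<noteq> 0" "?half \<beta> + sum_list gs = \<gamma>"
      using that by (auto simp: F_def nov_monom.rep_eq split: if_splits)
    have "g \<in> \<Gamma>" if "g \<in> set gs" for g
    proof -
      obtain i where i: "i < length gs" "g = gs ! i"
        using \<open>g \<in> set gs\<close> unfolding in_set_conv_nth by blast
      have "map2 nov_coeff Xs gs ! i \<noteq> 0"
      proof
        assume "map2 nov_coeff Xs gs ! i = 0"
        moreover have "i < length (map2 nov_coeff Xs gs)" using i len by simp
        ultimately have "0 \<in> set (map2 nov_coeff Xs gs)" by (metis nth_mem)
        moreover have "length (map2 nov_coeff Xs gs) = length Xs" using len by simp
        ultimately have "?v \<beta> gs = 0" using multilinear_zero f[OF \<beta>] by metis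
        thus False using v(1) by simp
      qed
      hence "nov_coeff (Xs ! i) g \<noteq> 0" using i len by simp
      moreover have "gapped (Xs ! i)" using i len by (intro Xs) simp
      ultimately show ?thesis unfolding gapped_def by blast
    qed
    thus ?thesis using v(2) by blast
  qed
  have summable: "nov_summable F I"
    unfolding nov_summable_def
  proof
    fix E
    let ?A = "{\<alpha>\<in>\<Gamma>. fst \<alpha> \<le> E}"
    have "{i \<in> I. F i \<notin> nov_filtration E} \<subseteq> ?dbl ` ?A \<times> {gs. set gs \<subseteq> ?A \<and> length gs = length Xs}"
    proof
      fix i assume i: "i \<in> {i \<in> I. F i \<notin> nov_filtration E}"
      obtain \<beta> gs where ib: "i = (\<beta>, gs)" by (cases i)
      obtain \<delta> where \<delta>: "nov_coeff (F (\<beta>, gs)) \<delta> \<noteq> 0" "fst \<delta> < E"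
        using i ib by (auto simp: nov_filtration_def not_le)
      have bI: "(\<beta>, gs) \<in> I" "\<beta> \<in> G" using i ib by (auto simp: I_def)
      note n = nz[OF bI(1) \<delta>(1)]
      have s: "fst \<delta> = fst \<beta> + fst (sum_list gs)" using n by auto
      have "0 \<le> fst \<beta>" "0 \<le> fst (sum_list gs)"
        using nonneg_even[OF bI(2)] exponents_nonneg[OF sum_list_in_exponents] n by auto
      hence le: "fst \<beta> \<le> E" "fst (sum_list gs) \<le> E" using s \<delta>(2) by linarith+
      have "\<beta> \<in> ?dbl ` ?A"
        by (rule image_eqI[of _ _ "?half \<beta>"]) (use half[OF bI(2)] le in auto)
      moreover have "set gs \<subseteq> ?A" using n fst_le_sum_list[of gs] le by force
      ultimately show "i \<in> ?dbl ` ?A \<times> {gs. set gs \<subseteq> ?A \<and> length gs = length Xs}"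
        using ib bI(1) by (auto simp: I_def)
    qed
    thus "finite {i \<in> I. F i \<notin> nov_filtration E}"
      by (rule finite_subset)
         (intro finite_cartesian_product finite_imageI finite_lists_length_eq finite_exponents_le)
  qed
  define P where "P = (SIGMA p:splits \<gamma>. tuples (length Xs) (snd p))"
  define \<phi> where "\<phi> = (\<lambda>(p :: (real \<times> int) \<times> (real \<times> int), gs :: (real \<times> int) list). (?dbl (fst p), gs))"
  have finP: "finite P" unfolding P_def by (intro finite_SigmaI finite_splits finite_tuples)
  have "nov_coeff (nov_sum F I) \<gamma> = (\<Sum>i\<in>\<phi> ` P. nov_coeff (F i) \<gamma>)"
  proof (rule nov_coeff_nov_sum[OF summable])
    show "finite (\<phi> ` P)" using finP by simp
    show "\<phi> ` P \<subseteq> I" by (auto simp: P_def \<phi>_def I_def splits_def tuples_def exponents_def)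
    show "nov_coeff (F i) \<gamma> = 0" if "i \<in> I - \<phi> ` P" for i
    proof (rule ccontr)
      assume nz': "nov_coeff (F i) \<gamma> \<noteq> 0"
      obtain \<beta> gs where ib: "i = (\<beta>, gs)" by (cases i)
      have bI: "(\<beta>, gs) \<in> I" "\<beta> \<in> G" using that ib by (auto simp: I_def)
      note n = nz[OF bI(1), of \<gamma>]
      have n': "set gs \<subseteq> \<Gamma>" "?half \<beta> + sum_list gs = \<gamma>" using n nz' ib by auto
      have "((?half \<beta>, sum_list gs), gs) \<in> P"
        using n' half[OF bI(2)] bI(1)
        by (auto simp: P_def splits_def tuples_def I_def sum_list_in_exponents)
      moreover have "\<phi> ((?half \<beta>, sum_list gs), gs) = i" using half(2)[OF bI(2)] by (simp add: \<phi>_def ib)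
      ultimately have "i \<in> \<phi> ` P" by (metis image_eqI)
      thus False using that by blast
    qed
  qed
  also have "\<dots> = (\<Sum>x\<in>P. nov_coeff (F (\<phi> x)) \<gamma>)"
    by (subst sum.reindex) (auto simp: inj_on_def \<phi>_def P_def splits_def tuples_def prod_eq_iff)
  also have "\<dots> = (\<Sum>(p, gs)\<in>P. component f (fst p) (map2 nov_coeff Xs gs))"
  proof (intro sum.cong refl, clarify)
    fix a b c d gs assume "(((a, b), (c, d)), gs) \<in> P"
    hence p: "(a, b) \<in> \<Gamma>" "(c, d) \<in> \<Gamma>" "(a, b) + (c, d) = \<gamma>" "length gs = length Xs" "sum_list gs = (c, d)"
      by (auto simp: P_def splits_def tuples_def)
    have "0 \<le> fst \<gamma>" using p add_in_exponents exponents_nonneg by blast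
    thus "nov_coeff (F (\<phi> (((a, b), c, d), gs))) \<gamma> = component f (fst ((a, b), c, d)) (map2 nov_coeff Xs gs)"
      using p by (simp add: F_def \<phi>_def nov_monom.rep_eq component_def)
  qed
  also have "\<dots> = (\<Sum>(\<alpha>, \<beta>)\<in>splits \<gamma>. \<Sum>gs\<in>tuples (length Xs) \<beta>. component f \<alpha> (map2 nov_coeff Xs gs))"
    unfolding P_def split_def by (subst sum.Sigma) (auto simp: finite_splits finite_tuples split_def)
  finally show ?thesis by (simp add: nov_extend_def F_def I_def split_def)
qed

lemma component_zero:
  assumes "\<And>k \<beta>. \<beta> \<in> G \<Longrightarrow> multilinear k s1 s2 (f k \<beta>)" "\<alpha> \<in> \<Gamma>" "0 \<in> set xs"
  shows "component f \<alpha> xs = 0"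
  unfolding component_def by (rule multilinear_zero[OF assms(1)]) (use assms in \<open>auto dest: in_exponentsD\<close>)

lemma gapped_nov_extend:
  assumes "\<And>k \<beta>. \<beta> \<in> G \<Longrightarrow> multilinear k s1 s2 (f k \<beta>)" "\<And>X. X \<in> set Xs \<Longrightarrow> gapped X"
  shows "gapped (nov_extend G f Xs)"
  unfolding gapped_def
proof (intro allI impI, rule ccontr)
  fix \<gamma> assume nz: "nov_coeff (nov_extend G f Xs) \<gamma> \<noteq> 0" and "\<gamma> \<notin> \<Gamma>"
  have "nov_coeff (nov_extend G f Xs) \<gamma> =
    (\<Sum>(\<alpha>, \<beta>)\<in>splits \<gamma>. \<Sum>gs\<in>tuples (length Xs) \<beta>. component f \<alpha> (map2 nov_coeff Xs gs))"
    by (rule nov_coeff_nov_extend) (use assms in auto)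
  thus False using nz splits_outside[OF \<open>\<gamma> \<notin> \<Gamma>\<close>] by simp
qed

lemma nov_coeff_nov_extend_const:
  assumes f: "\<And>k \<beta>. \<beta> \<in> G \<Longrightarrow> multilinear k s1 s2 (f k \<beta>)"
  shows "nov_coeff (nov_extend G f (map nov_const xs)) \<gamma> = (if \<gamma> \<in> \<Gamma> then component f \<gamma> xs else 0)"
proof -
  have "nov_coeff (nov_extend G f (map nov_const xs)) \<gamma> =
      (\<Sum>(\<alpha>, \<beta>)\<in>splits \<gamma>. \<Sum>gs\<in>tuples (length (map nov_const xs)) \<beta>.
        component f \<alpha> (map2 nov_coeff (map nov_const xs) gs))"
    by (rule nov_coeff_nov_extend[of s1 s2 f, OF f]) (auto simp: gapped_const)
  also have "\<dots> = (\<Sum>(\<alpha>, \<beta>)\<in>splits \<gamma>. if \<beta> = 0 then component f \<alpha> xs else 0)"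
  proof (intro sum.cong refl, clarify)
    fix a b c d assume s: "((a, b), c, d) \<in> splits \<gamma>"
    have "(\<Sum>gs\<in>tuples (length xs) (c, d).
        component f (a, b) (map2 nov_coeff (map nov_const xs) gs)) =
      (if (c, d) = 0 then component f (a, b) xs else 0)"
      by (rule sum_tuples_all_const) (use s component_zero[of s1 s2 f, OF f] in \<open>auto simp: splits_def\<close>)
    thus "(\<Sum>gs\<in>tuples (length (map nov_const xs)) (c, d).
        component f (a, b) (map2 nov_coeff (map nov_const xs) gs)) =
      (if (c, d) = 0 then component f (a, b) xs else 0)"
      by simp
  qed
  also have "\<dots> = (if \<gamma> \<in> \<Gamma> then component f \<gamma> xs else 0)"
  proof (cases "\<gamma> \<in> \<Gamma>")
    case True
    have "(\<Sum>(\<alpha>, \<beta>)\<in>splits \<gamma>. if \<beta> = 0 then component f \<alpha> xs else 0) =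
      (\<Sum>(\<alpha>, \<beta>)\<in>{(\<gamma>, 0 :: real \<times> int)}. if \<beta> = 0 then component f \<alpha> xs else 0)"
      by (rule sum.mono_neutral_right[OF finite_splits])
         (use True zero_in_exponents in \<open>auto simp: splits_def zero_prod_def split: if_splits\<close>)
    thus ?thesis using True by simp
  qed (simp add: splits_outside)
  finally show ?thesis .
qed

lemma nov_coeff_nov_extend_insert:
  assumes f: "\<And>k \<beta>. \<beta> \<in> G \<Longrightarrow> multilinear k s1 s2 (f k \<beta>)" and Z: "gapped Z"
  shows "nov_coeff (nov_extend G f (map nov_const us @ [Z] @ map nov_const vs)) \<gamma> =
    (\<Sum>(\<alpha>, \<beta>)\<in>splits \<gamma>. component f \<alpha> (us @ nov_coeff Z \<beta> # vs))"
proof -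
  let ?Ws = "Z # map nov_const vs"
  have "nov_coeff (nov_extend G f (map nov_const us @ ?Ws)) \<gamma> =
      (\<Sum>(\<alpha>, \<beta>)\<in>splits \<gamma>. \<Sum>gs\<in>tuples (length (map nov_const us @ ?Ws)) \<beta>.
        component f \<alpha> (map2 nov_coeff (map nov_const us @ ?Ws) gs))"
    by (rule nov_coeff_nov_extend[of s1 s2 f, OF f]) (auto simp: gapped_const Z)
  also have "\<dots> = (\<Sum>(\<alpha>, \<beta>)\<in>splits \<gamma>. component f \<alpha> (us @ nov_coeff Z \<beta> # vs))"
  proof (intro sum.cong refl, clarify)
    fix a b c d assume s: "((a, b), c, d) \<in> splits \<gamma>"
    hence ab: "(a, b) \<in> \<Gamma>" and cd: "(c, d) \<in> \<Gamma>" by (auto simp: splits_def)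
    have "(\<Sum>gs\<in>tuples (length us + length ?Ws) (c, d).
        component f (a, b) (map2 nov_coeff (map nov_const us @ ?Ws) gs)) =
      (\<Sum>gs\<in>tuples (length ?Ws) (c, d). component f (a, b) (us @ map2 nov_coeff ?Ws gs))"
      by (rule sum_tuples_const[OF _ cd]) (rule component_zero[of s1 s2 f, OF f ab])
    also have "\<dots> = (\<Sum>(\<alpha>, \<beta>)\<in>splits (c, d). \<Sum>gs\<in>tuples (length vs) \<beta>.
        component f (a, b) (us @ nov_coeff Z \<alpha> # map2 nov_coeff (map nov_const vs) gs))"
      by (simp add: sum_tuples_Suc)
    also have "\<dots> = (\<Sum>(\<alpha>, \<beta>)\<in>splits (c, d). if \<beta> = 0 then component f (a, b) (us @ nov_coeff Z \<alpha> # vs) else 0)"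
    proof (intro sum.cong refl, clarify)
      fix p q r s assume "((p, q), r, s) \<in> splits (c, d)"
      hence rs: "(r, s) \<in> \<Gamma>" by (auto simp: splits_def)
      show "(\<Sum>gs\<in>tuples (length vs) (r, s).
          component f (a, b) (us @ nov_coeff Z (p, q) # map2 nov_coeff (map nov_const vs) gs)) =
        (if (r, s) = 0 then component f (a, b) (us @ nov_coeff Z (p, q) # vs) else 0)"
        by (rule sum_tuples_all_const[OF _ rs]) (auto intro!: component_zero[of s1 s2 f, OF f ab])
    qed
    also have "\<dots> = (\<Sum>(\<alpha>, \<beta>)\<in>{((c, d), 0 :: real \<times> int)}.
        if \<beta> = 0 then component f (a, b) (us @ nov_coeff Z \<alpha> # vs) else 0)"
      by (rule sum.mono_neutral_right[OF finite_splits])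
         (use cd zero_in_exponents in \<open>auto simp: splits_def zero_prod_def split: if_splits\<close>)
    finally show "(\<Sum>gs\<in>tuples (length (map nov_const us @ ?Ws)) (c, d).
        component f (a, b) (map2 nov_coeff (map nov_const us @ ?Ws) gs)) =
      component f (a, b) (us @ nov_coeff Z (c, d) # vs)" by simp
  qed
  finally show ?thesis by simp
qed

lemma sum_blocks_map:
  fixes g :: "'a \<Rightarrow> 'b"
  shows "(\<Sum>ds\<in>blocks \<beta> (map g ws). F ds) =
   (\<Sum>ds\<in>blocks \<beta> ws. F (map (apsnd (map g)) ds) :: 'c::comm_monoid_add)"
proof (rule sum.reindex_bij_betw[symmetric])
  let ?\<phi> = "map (apsnd (map g)) :: ((real \<times> int) \<times> 'a list) list \<Rightarrow> ((real \<times> int) \<times> 'b list) list"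
  have fst: "map fst (?\<phi> ds) = map fst ds" and snd: "map snd (?\<phi> ds) = map (map g) (map snd ds)" for ds
    by simp_all
  have mem: "?\<phi> ds \<in> blocks \<beta> (map g ws) \<longleftrightarrow> ds \<in> blocks \<beta> ws" if "concat (map snd ds) = ws" for ds
  proof -
    have "concat (map snd (?\<phi> ds)) = map g ws" unfolding snd that[symmetric] by (rule map_concat[symmetric])
    moreover have "set (?\<phi> ds) \<subseteq> \<Gamma> \<times> UNIV - {(0, [])} \<longleftrightarrow> set ds \<subseteq> \<Gamma> \<times> UNIV - {(0, [])}"
      by (fastforce simp: image_subset_iff)
    ultimately show ?thesis unfolding blocks_def mem_Collect_eq fst using that by blast
  qed
  show "bij_betw ?\<phi> (blocks \<beta> ws) (blocks \<beta> (map g ws))"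
    unfolding bij_betw_def
  proof (intro conjI equalityI)
    show "inj_on ?\<phi> (blocks \<beta> ws)"
    proof (rule inj_onI)
      fix ds ds' assume d: "ds \<in> blocks \<beta> ws" "ds' \<in> blocks \<beta> ws" and e: "?\<phi> ds = ?\<phi> ds'"
      have "map snd ds = map snd ds'"
        using d by (intro map_blocks_inj[of _ _ g]) (simp_all only: snd[symmetric] e, simp add: blocks_def)
      moreover have "map fst ds = map fst ds'" using e fst by metis
      ultimately show "ds = ds'" by (metis zip_map_fst_snd)
    qed
    show "?\<phi> ` blocks \<beta> ws \<subseteq> blocks \<beta> (map g ws)"
    proof (rule image_subsetI)
      fix ds assume ds: "ds \<in> blocks \<beta> ws"
      hence "concat (map snd ds) = ws" by (simp add: blocks_def)
      from mem[OF this] show "?\<phi> ds \<in> blocks \<beta> (map g ws)" using ds by blast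
    qed
    show "blocks \<beta> (map g ws) \<subseteq> ?\<phi> ` blocks \<beta> ws"
    proof
      fix es assume es: "es \<in> blocks \<beta> (map g ws)"
      then obtain cs where cs: "concat cs = ws" "map snd es = map (map g) cs"
        using concat_eq_map[of "map snd es" g ws] by (auto simp: blocks_def)
      have len: "length es = length cs" using arg_cong[OF cs(2), of length] by simp
      let ?ds = "zip (map fst es) cs"
      have "map fst (?\<phi> ?ds) = map fst es" "map snd (?\<phi> ?ds) = map snd es"
        unfolding fst snd cs(2) using len by simp_all
      hence e: "?\<phi> ?ds = es" by (metis zip_map_fst_snd)
      have "concat (map snd ?ds) = ws" using cs(1) len by simp
      from mem[OF this] show "es \<in> ?\<phi> ` blocks \<beta> ws" using es e by (metis image_eqI)
    qed
  qed
qed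

text \<open>
  In \<open>\<Sum> m(h(\<dots>), \<dots>, h(\<dots>))\<close> an empty block of exponent \<open>0\<close> contributes nothing, so that
  each coefficient of the infinite sum is the finite sum over \<open>blocks\<close>.
\<close>
lemma nov_coeff_composition:
  fixes xs :: "'c::ab_group_add list"
  assumes m: "\<And>k \<beta>. \<beta> \<in> G \<Longrightarrow> multilinear k s s' (m k \<beta>)"
    and h: "\<And>k \<beta>. \<beta> \<in> G \<Longrightarrow> multilinear k t t' (h k \<beta>)"
    and h0: "component h 0 [] = 0"
  shows "nov_coeff (nov_sum (\<lambda>bs. nov_extend G m (map (nov_extend G h) bs)) {bs. concat bs = map nov_const xs}) \<gamma> =
    (\<Sum>(\<alpha>, \<beta>)\<in>splits \<gamma>. \<Sum>ds\<in>blocks \<beta> xs. component m \<alpha> (map (case_prod (component h)) ds))"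
    (is "nov_coeff (nov_sum ?F ?I) \<gamma> = _")
proof -
  let ?c = "map (map nov_const) :: 'c list list \<Rightarrow> 'c novikov list list"
  let ?T = "\<lambda>cs \<beta>. {gs \<in> tuples (length cs) \<beta>. (0, []) \<notin> set (zip gs (cs :: 'c list list))}"
  let ?K = "\<lambda>\<alpha> ds. component m \<alpha> (map (case_prod (component h)) ds)"
  define CS where "CS \<gamma> = (\<Union>p\<in>splits \<gamma>. map snd ` blocks (snd p) xs)" for \<gamma>
  have finCS: "finite (CS \<gamma>)" for \<gamma> unfolding CS_def using finite_splits finite_blocks by blast
  have zipb: "zip gs cs \<in> blocks \<beta> xs" if "gs \<in> ?T cs \<beta>" "concat cs = xs" for gs cs \<beta>
    using that by (auto simp: tuples_def blocks_def dest: set_zip_leftD)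
  have coeff_F: "nov_coeff (?F (?c cs)) \<gamma> = (\<Sum>(\<alpha>, \<beta>)\<in>splits \<gamma>. \<Sum>gs\<in>?T cs \<beta>. ?K \<alpha> (zip gs cs))"
    for cs \<gamma>
  proof -
    let ?Xs = "map (nov_extend G h) (?c cs)"
    have gap: "gapped X" if "X \<in> set ?Xs" for X
      using that by (auto intro!: gapped_nov_extend[of t t' h, OF h] simp: gapped_const)
    have "nov_coeff (?F (?c cs)) \<gamma> =
        (\<Sum>(\<alpha>, \<beta>)\<in>splits \<gamma>. \<Sum>gs\<in>tuples (length ?Xs) \<beta>. component m \<alpha> (map2 nov_coeff ?Xs gs))"
      by (rule nov_coeff_nov_extend[of s s' m, OF m gap])
    also have "\<dots> = (\<Sum>(\<alpha>, \<beta>)\<in>splits \<gamma>. \<Sum>gs\<in>?T cs \<beta>. ?K \<alpha> (zip gs cs))"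
    proof (rule sum.cong[OF refl], clarify)
      fix a b c d assume s: "((a, b), c, d) \<in> splits \<gamma>"
      have entries: "map2 nov_coeff ?Xs gs = map (case_prod (component h)) (zip gs cs)"
        if "gs \<in> tuples (length cs) (c, d)" for gs
      proof (rule nth_equalityI)
        show "length (map2 nov_coeff ?Xs gs) = length (map (case_prod (component h)) (zip gs cs))"
          by simp
        fix i assume "i < length (map2 nov_coeff ?Xs gs)"
        hence i: "i < length cs" "i < length gs" by auto
        have "gs ! i \<in> \<Gamma>" using that i by (auto simp: tuples_def)
        thus "map2 nov_coeff ?Xs gs ! i = map (case_prod (component h)) (zip gs cs) ! i"
          using i nov_coeff_nov_extend_const[of t t' h "cs ! i" "gs ! i", OF h] by simp
      qed
      have "(\<Sum>gs\<in>tuples (length ?Xs) (c, d). component m (a, b) (map2 nov_coeff ?Xs gs)) =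
          (\<Sum>gs\<in>tuples (length cs) (c, d). ?K (a, b) (zip gs cs))"
        by (intro sum.cong) (simp_all only: entries length_map)
      also have "\<dots> = (\<Sum>gs\<in>?T cs (c, d). ?K (a, b) (zip gs cs))"
      proof (rule sum.mono_neutral_right[OF finite_tuples])
        show "\<forall>gs\<in>tuples (length cs) (c, d) - ?T cs (c, d). ?K (a, b) (zip gs cs) = 0"
        proof
          fix gs assume "gs \<in> tuples (length cs) (c, d) - ?T cs (c, d)"
          hence "(0, []) \<in> set (zip gs cs)" by blast
          hence "case_prod (component h) (0, []) \<in> set (map (case_prod (component h)) (zip gs cs))"
            unfolding set_map by (rule imageI)
          thus "?K (a, b) (zip gs cs) = 0"
            using component_zero[of s s' m, OF m] s h0 by (simp add: splits_def)
        qed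
      qed auto
      finally show "(\<Sum>gs\<in>tuples (length ?Xs) (c, d). component m (a, b) (map2 nov_coeff ?Xs gs)) =
          (\<Sum>gs\<in>?T cs (c, d). ?K (a, b) (zip gs cs))" .
    qed
    finally show ?thesis .
  qed
  have inI: "\<exists>cs. concat cs = xs \<and> bs = ?c cs" if "bs \<in> ?I" for bs
    using concat_eq_map[of bs nov_const xs] that by simp
  have supp: "cs \<in> CS \<gamma> \<and> \<gamma> \<in> \<Gamma>" if "concat cs = xs" "nov_coeff (?F (?c cs)) \<gamma> \<noteq> 0" for cs \<gamma>
  proof -
    have "(\<Sum>(\<alpha>, \<beta>)\<in>splits \<gamma>. \<Sum>gs\<in>?T cs \<beta>. ?K \<alpha> (zip gs cs)) \<noteq> 0"
      using that(2) coeff_F by simp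
    from sum.not_neutral_contains_not_neutral[OF this] obtain p where
      p: "p \<in> splits \<gamma>" "(case p of (\<alpha>, \<beta>) \<Rightarrow> \<Sum>gs\<in>?T cs \<beta>. ?K \<alpha> (zip gs cs)) \<noteq> 0"
      by blast
    from p(2) have p2: "(\<Sum>gs\<in>?T cs (snd p). ?K (fst p) (zip gs cs)) \<noteq> 0"
      unfolding split_def .
    from sum.not_neutral_contains_not_neutral[OF p2] obtain gs where gs: "gs \<in> ?T cs (snd p)" by blast
    have "cs = map snd (zip gs cs)" using gs by (simp add: tuples_def)
    hence "cs \<in> map snd ` blocks (snd p) xs" using zipb[OF gs that(1)] by (metis image_eqI)
    thus ?thesis using p(1) splits_outside[of \<gamma>] by (auto simp: CS_def)
  qed
  have summable: "nov_summable ?F ?I"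
    unfolding nov_summable_def
  proof
    fix E
    have "{bs \<in> ?I. ?F bs \<notin> nov_filtration E} \<subseteq> (\<Union>\<gamma>\<in>{\<gamma>\<in>\<Gamma>. fst \<gamma> \<le> E}. ?c ` CS \<gamma>)"
    proof
      fix bs assume bs: "bs \<in> {bs \<in> ?I. ?F bs \<notin> nov_filtration E}"
      then obtain cs where cs: "concat cs = xs" "bs = ?c cs" using inI by blast
      obtain \<gamma> where \<gamma>: "nov_coeff (?F (?c cs)) \<gamma> \<noteq> 0" "fst \<gamma> < E"
        using bs cs by (auto simp: nov_filtration_def not_le)
      have "\<gamma> \<in> {\<gamma>\<in>\<Gamma>. fst \<gamma> \<le> E}" "bs \<in> ?c ` CS \<gamma>"
        using supp[OF cs(1) \<gamma>(1)] \<gamma>(2) cs(2) by simp_all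
      thus "bs \<in> (\<Union>\<gamma>\<in>{\<gamma>\<in>\<Gamma>. fst \<gamma> \<le> E}. ?c ` CS \<gamma>)" by blast
    qed
    thus "finite {bs \<in> ?I. ?F bs \<notin> nov_filtration E}"
      by (rule finite_subset) (use finCS finite_exponents_le in blast)
  qed
  have CSc: "concat cs = xs" if "cs \<in> CS \<gamma>" for cs
    using that by (auto simp: CS_def blocks_def)
  have "nov_coeff (nov_sum ?F ?I) \<gamma> = (\<Sum>bs\<in>?c ` CS \<gamma>. nov_coeff (?F bs) \<gamma>)"
  proof (rule nov_coeff_nov_sum[OF summable])
    show "finite (?c ` CS \<gamma>)" using finCS by blast
    show "?c ` CS \<gamma> \<subseteq> ?I" using CSc by (auto simp: map_concat[symmetric])
    show "nov_coeff (?F bs) \<gamma> = 0" if "bs \<in> ?I - ?c ` CS \<gamma>" for bs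
      using that inI[of bs] supp[of _ \<gamma>] by blast
  qed
  also have "\<dots> = (\<Sum>cs\<in>CS \<gamma>. nov_coeff (?F (?c cs)) \<gamma>)"
  proof (rule sum.reindex[unfolded comp_def])
    show "inj_on ?c (CS \<gamma>)" by (intro inj_onI) (metis CSc map_blocks_inj)
  qed
  also have "\<dots> = (\<Sum>cs\<in>CS \<gamma>. \<Sum>(\<alpha>, \<beta>)\<in>splits \<gamma>. \<Sum>gs\<in>?T cs \<beta>. ?K \<alpha> (zip gs cs))"
    by (simp only: coeff_F)
  also have "\<dots> = (\<Sum>(\<alpha>, \<beta>)\<in>splits \<gamma>. \<Sum>cs\<in>CS \<gamma>. \<Sum>gs\<in>?T cs \<beta>. ?K \<alpha> (zip gs cs))"
    unfolding split_def by (rule sum.swap)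
  also have "\<dots> = (\<Sum>(\<alpha>, \<beta>)\<in>splits \<gamma>. \<Sum>ds\<in>blocks \<beta> xs. ?K \<alpha> ds)"
  proof (rule sum.cong[OF refl], clarify)
    fix a b c d assume s: "((a, b), c, d) \<in> splits \<gamma>"
    have "(\<Sum>cs\<in>CS \<gamma>. \<Sum>gs\<in>?T cs (c, d). ?K (a, b) (zip gs cs)) =
        (\<Sum>(cs, gs)\<in>(SIGMA cs:CS \<gamma>. ?T cs (c, d)). ?K (a, b) (zip gs cs))"
      by (rule sum.Sigma) (auto simp: finCS finite_tuples)
    also have "\<dots> = (\<Sum>ds\<in>blocks (c, d) xs. ?K (a, b) ds)"
    proof (rule sum.reindex_bij_witness[of _ "\<lambda>ds. (map snd ds, map fst ds)" "\<lambda>(cs, gs). zip gs cs"], goal_cases)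
      case (1 x) thus ?case by (auto simp: tuples_def)
    next
      case (2 x) thus ?case using zipb CSc by auto
    next
      case (3 ds) thus ?case by (simp add: zip_map_fst_snd)
    next
      case (4 ds)
      have "map snd ds \<in> CS \<gamma>" using 4 s by (force simp: CS_def)
      moreover have "map fst ds \<in> ?T (map snd ds) (c, d)"
        using 4 by (auto simp: tuples_def blocks_def zip_map_fst_snd)
      ultimately show ?case by blast
    next
      case (5 x) thus ?case by auto
    qed
    finally show "(\<Sum>cs\<in>CS \<gamma>. \<Sum>gs\<in>?T cs (c, d). ?K (a, b) (zip gs cs)) =
      (\<Sum>ds\<in>blocks (c, d) xs. ?K (a, b) ds)" .
  qed
  finally show ?thesis .
qed

end

context gapped_ainf_algebra
begin

lemma component_multilinear: "\<alpha> \<in> \<Gamma> \<Longrightarrow> length xs = k \<Longrightarrow> i < k \<Longrightarrow>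
    Vector_Spaces.linear scale scale (\<lambda>x. component m \<alpha> (xs[i := x]))"
  using m_multilinear[of "(fst \<alpha>, 2 * snd \<alpha>)" k] in_exponentsD[of \<alpha>]
  by (simp add: multilinear_def component_def)

lemma zero_in_gr: "0 \<in> gr d"
  using subspace_gr by (rule subspace_0)

lemma const_homogeneous:
  assumes "list_all2 (\<lambda>d x. x \<in> gr d) ds xs"
  shows "list_all2 (nov_homogeneous gr) ds (map nov_const xs)"
  unfolding list.rel_map
  by (rule list_all2_mono[OF assms])
     (auto simp: nov_homogeneous_def nov_monom.rep_eq zero_in_gr zero_prod_def)

lemma component_degree:
  assumes "list_all2 (\<lambda>d x. x \<in> gr d) ds xs" "\<gamma> \<in> \<Gamma>"
  shows "component m \<gamma> xs \<in> gr (shifted_degree ds + 2 - 2 * snd \<gamma>)"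
proof -
  have "nov_coeff (nov_extend G m (map nov_const xs)) (fst \<gamma>, snd \<gamma>) \<in> gr (shifted_degree ds + 1 + 1 - 2 * snd \<gamma>)"
    using m_degree[OF const_homogeneous[OF assms(1)]] unfolding nov_homogeneous_def by blast
  thus ?thesis using nov_coeff_nov_extend_const[of scale scale m, OF m_multilinear] assms(2)
    by (simp add: add.assoc)
qed

end


section \<open>Cyclic homomorphisms in components\<close>

lemma shifted_degree_map_snd: "shifted_degree (map snd w) = total (\<lambda>p. snd p - 1) w"
  by (simp add: shifted_degree_def comp_def)

context gapped_ainf_hom
begin

lemma component_h_degree:
  assumes "list_all2 (\<lambda>d x. x \<in> grB d) ds xs" "\<gamma> \<in> dom.exponents"
  shows "component h \<gamma> xs \<in> grA (shifted_degree ds + 1 - 2 * snd \<gamma>)"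
proof -
  have "nov_coeff (nov_extend G h (map nov_const xs)) (fst \<gamma>, snd \<gamma>) \<in> grA (shifted_degree ds + 1 - 2 * snd \<gamma>)"
    using h_degree[OF dom.const_homogeneous[OF assms(1)]] unfolding nov_homogeneous_def by blast
  thus ?thesis using dom.nov_coeff_nov_extend_const[of sB sA h, OF h_multilinear] assms(2)
    by simp
qed

lemma component_h_0: "component h 0 [] = 0"
proof (rule ccontr)
  assume nz: "component h 0 [] \<noteq> 0"
  obtain l where l: "l > 0" "nov_extend G h [] \<in> nov_filtration l" using h_curvature by blast
  have "nov_coeff (nov_extend G h []) 0 = component h 0 []"
    using dom.nov_coeff_nov_extend_const[of sB sA h "[]" 0, OF h_multilinear] dom.zero_in_exponents
    by simp
  hence "nov_coeff (nov_extend G h []) 0 \<noteq> 0" using nz by simp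
  hence "l \<le> fst (0 :: real \<times> int)" using l(2) unfolding nov_filtration_def by blast
  thus False using l(1) by simp
qed

text \<open>
  On constant arguments the only exponents in \<open>h(\<dots>, m(\<dots>), \<dots>)\<close> are those of \<open>h\<close> and \<open>m\<close>, so the
  coefficients of the right hand side are sums over \<open>splits\<close>.
\<close>
lemma hom_relation_component:
  assumes hom: "list_all2 (\<lambda>d x. x \<in> grB d) ds xs" and \<gamma>: "\<gamma> \<in> dom.exponents"
  shows "(\<Sum>(\<alpha>, \<beta>)\<in>dom.splits \<gamma>. \<Sum>bs\<in>dom.blocks \<beta> xs. component mA \<alpha> (map (case_prod (component h)) bs)) =
    (\<Sum>(i, j) | i + j \<le> length xs. \<Sum>(\<alpha>, \<beta>)\<in>dom.splits \<gamma>. koszul (shifted_degree (take i ds))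
       (component h \<alpha> (take i xs @ component mB \<beta> (take j (drop i xs)) # drop (i + j) xs)))"
proof -
  let ?Xs = "map nov_const xs"
  have "(\<Sum>(\<alpha>, \<beta>)\<in>dom.splits \<gamma>. \<Sum>bs\<in>dom.blocks \<beta> xs. component mA \<alpha> (map (case_prod (component h)) bs)) =
      nov_coeff (nov_sum (\<lambda>bs. nov_extend G mA (map (nov_extend G h) bs)) {bs. concat bs = ?Xs}) \<gamma>"
    by (rule dom.nov_coeff_composition[symmetric, of sA sA mA sB sA h, OF cod.m_multilinear h_multilinear component_h_0])
  also have "\<dots> = nov_coeff (\<Sum>(i, j) | i + j \<le> length ?Xs. koszul (shifted_degree (take i ds))
      (nov_extend G h (take i ?Xs @ [nov_extend G mB (take j (drop i ?Xs))] @ drop (i + j) ?Xs))) \<gamma>"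
    by (subst hom_relation[OF dom.const_homogeneous[OF hom]]) (rule refl)
  also have "\<dots> = (\<Sum>(i, j) | i + j \<le> length xs. \<Sum>(\<alpha>, \<beta>)\<in>dom.splits \<gamma>. koszul (shifted_degree (take i ds))
       (component h \<alpha> (take i xs @ component mB \<beta> (take j (drop i xs)) # drop (i + j) xs)))"
    unfolding nov_coeff_sum length_map
  proof (rule sum.cong[OF refl], clarify)
    fix i j assume "i + j \<le> length xs"
    let ?Z = "nov_extend G mB (map nov_const (take j (drop i xs)))"
    have Z: "dom.gapped ?Z"
      by (rule dom.gapped_nov_extend[of sB sB mB, OF dom.m_multilinear]) (auto simp: dom.gapped_const)
    have "nov_coeff (nov_extend G h (take i ?Xs @ [nov_extend G mB (take j (drop i ?Xs))] @ drop (i + j) ?Xs)) \<gamma> =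
        (\<Sum>(\<alpha>, \<beta>)\<in>dom.splits \<gamma>. component h \<alpha> (take i xs @ nov_coeff ?Z \<beta> # drop (i + j) xs))"
      unfolding take_map drop_map
      by (rule dom.nov_coeff_nov_extend_insert[of sB sA h, OF h_multilinear Z])
    also have "\<dots> = (\<Sum>(\<alpha>, \<beta>)\<in>dom.splits \<gamma>.
        component h \<alpha> (take i xs @ component mB \<beta> (take j (drop i xs)) # drop (i + j) xs))"
    proof (rule sum.cong[OF refl], clarify)
      fix a b c d assume "((a, b), c, d) \<in> dom.splits \<gamma>"
      hence "(c, d) \<in> dom.exponents" by (simp add: dom.splits_def)
      thus "component h (a, b) (take i xs @ nov_coeff ?Z (c, d) # drop (i + j) xs) =
        component h (a, b) (take i xs @ component mB (c, d) (take j (drop i xs)) # drop (i + j) xs)"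
        using dom.nov_coeff_nov_extend_const[of sB sB mB, OF dom.m_multilinear] by simp
    qed
    finally show "nov_coeff (koszul (shifted_degree (take i ds))
        (nov_extend G h (take i ?Xs @ [nov_extend G mB (take j (drop i ?Xs))] @ drop (i + j) ?Xs))) \<gamma> =
      (\<Sum>(\<alpha>, \<beta>)\<in>dom.splits \<gamma>. koszul (shifted_degree (take i ds))
        (component h \<alpha> (take i xs @ component mB \<beta> (take j (drop i xs)) # drop (i + j) xs)))"
      unfolding nov_coeff_koszul by (simp add: koszul_sum split_def)
  qed
  finally show ?thesis .
qed

end

context gapping_monoid
begin

lemma splits_0: "splits 0 = {(0, 0)}"
proof -
  obtain \<epsilon> where \<epsilon>: "\<epsilon> > 0" "\<forall>\<gamma>\<in>\<Gamma>. \<gamma> \<noteq> 0 \<longrightarrow> \<epsilon> \<le> fst \<gamma>" using energy_gap by blast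
  have "\<alpha> = 0 \<and> \<beta> = 0" if "\<alpha> \<in> \<Gamma>" "\<beta> \<in> \<Gamma>" "\<alpha> + \<beta> = 0" for \<alpha> \<beta>
  proof -
    have "fst \<alpha> + fst \<beta> = 0" using that(3) by (metis fst_add fst_zero)
    hence "fst \<alpha> = 0" using exponents_nonneg[OF that(1)] exponents_nonneg[OF that(2)] by linarith
    hence "\<alpha> = 0" using \<epsilon> that(1) by force
    thus ?thesis using that(3) by simp
  qed
  thus ?thesis using zero_in_exponents by (auto simp: splits_def)
qed

lemma sum_splits_double:
  "(\<Sum>(\<beta>1, \<beta>2) | \<beta>1 \<in> G \<and> \<beta>2 \<in> G \<and> \<beta>1 + \<beta>2 = (fst \<gamma>, 2 * snd \<gamma>). F \<beta>1 \<beta>2) =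
   (\<Sum>(\<alpha>, \<beta>)\<in>splits \<gamma>. F (fst \<alpha>, 2 * snd \<alpha>) (fst \<beta>, 2 * snd \<beta>) :: 'c::comm_monoid_add)"
proof -
  let ?half = "\<lambda>\<beta> :: real \<times> int. (fst \<beta>, snd \<beta> div 2)"
  have half: "?half \<beta> \<in> \<Gamma>" "(fst \<beta>, 2 * (snd \<beta> div 2)) = \<beta>" "even (snd \<beta>)" if "\<beta> \<in> G" for \<beta>
    using nonneg_even[OF that] that by (auto simp: exponents_def)
  let ?dbl = "\<lambda>(\<alpha> :: real \<times> int, \<beta> :: real \<times> int). ((fst \<alpha>, 2 * snd \<alpha>), (fst \<beta>, 2 * snd \<beta>))"
  have "{(\<beta>1, \<beta>2). \<beta>1 \<in> G \<and> \<beta>2 \<in> G \<and> \<beta>1 + \<beta>2 = (fst \<gamma>, 2 * snd \<gamma>)} = ?dbl ` splits \<gamma>"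
  proof (intro equalityI subsetI)
    fix p assume "p \<in> {(\<beta>1, \<beta>2). \<beta>1 \<in> G \<and> \<beta>2 \<in> G \<and> \<beta>1 + \<beta>2 = (fst \<gamma>, 2 * snd \<gamma>)}"
    then obtain \<beta>1 \<beta>2 where p: "p = (\<beta>1, \<beta>2)" "\<beta>1 \<in> G" "\<beta>2 \<in> G" "\<beta>1 + \<beta>2 = (fst \<gamma>, 2 * snd \<gamma>)"
      by blast
    have "fst \<beta>1 + fst \<beta>2 = fst \<gamma>" "snd \<beta>1 + snd \<beta>2 = 2 * snd \<gamma>"
      using p(4) by (metis fst_add fst_conv, metis snd_add snd_conv)
    moreover have "snd \<beta>1 div 2 + snd \<beta>2 div 2 = (snd \<beta>1 + snd \<beta>2) div 2"
      by (rule div_add[symmetric]) (fact half(3)[OF p(2)] half(3)[OF p(3)])+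
    ultimately have mem: "(?half \<beta>1, ?half \<beta>2) \<in> splits \<gamma>"
      using half(1)[OF p(2)] half(1)[OF p(3)] by (simp add: splits_def prod_eq_iff)
    have "p = ?dbl (?half \<beta>1, ?half \<beta>2)"
      using half(2)[OF p(2)] half(2)[OF p(3)] p(1) by simp
    thus "p \<in> ?dbl ` splits \<gamma>" using mem by (rule image_eqI)
  qed (auto simp: splits_def exponents_def)
  moreover have "inj_on ?dbl (splits \<gamma>)" by (auto simp: inj_on_def prod_eq_iff)
  ultimately show ?thesis by (simp add: sum.reindex split_def)
qed

end

context cyclic_gapped_ainf_hom
begin

text \<open>
  Since \<open>0\<close> is homogeneous of every degree, a letter records its degree.
\<close>
abbreviation letters :: "('b \<times> int) set"
  where "letters \<equiv> {p. fst p \<in> grB (snd p)}"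

abbreviation letter_degree :: "'b \<times> int \<Rightarrow> int"
  where "letter_degree p \<equiv> snd p - 1"

lemma letters_graded: "w \<in> lists letters \<Longrightarrow> list_all2 (\<lambda>d x. x \<in> grB d) (map snd w) (map fst w)"
  by (induction w) auto

lemma pairA_add_left: "pairA (x + y) z = pairA x z + pairA y z"
  using cod.pair_linear_left[of z] by (simp add: Vector_Spaces.linear_iff)

lemma pairA_zero: "pairA 0 z = 0" "pairA z 0 = 0"
proof -
  show "pairA 0 z = 0" using pairA_add_left[of 0 0 z] by simp
  have "pairA z (0 + 0) = pairA z 0 + pairA z 0"
    using cod.pair_linear_right[of z] unfolding Vector_Spaces.linear_iff by blast
  thus "pairA z 0 = 0" by simp
qed

text \<open>
  For two arguments and exponent \<open>0\<close>, the outer two cuts vanish because \<open>h\<^sub>0\<close> has no component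
  of exponent \<open>0\<close>, and the middle one is evaluated by the isometry condition.
\<close>
lemma h_cuts_component:
  assumes "\<gamma> \<in> dom.exponents"
  shows "(\<Sum>i\<le>length xs. \<Sum>(\<alpha>, \<beta>)\<in>dom.splits \<gamma>.
      pairA (component h \<alpha> (take i xs)) (component h \<beta> (drop i xs))) =
    (if length xs = 2 \<and> \<gamma> = 0 then pairB (xs ! 0) (xs ! 1) else 0)"
proof (cases "length xs = 2 \<and> \<gamma> = 0")
  case True
  then obtain x y where xs: "xs = [x, y]" by (auto simp: numeral_2_eq_2 length_Suc_conv)
  have "component h 0 [x] = h 1 0 [x]" for x by (simp add: component_def zero_prod_def)
  thus ?thesis using True h_isometry[of x y]
    by (simp add: dom.splits_0 xs numeral_2_eq_2 component_h_0 pairA_zero)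
next
  case False
  let ?\<beta> = "(fst \<gamma>, 2 * snd \<gamma>)"
  have "(length xs, ?\<beta>) \<noteq> (2, 0)" using False by (auto simp: prod_eq_iff)
  from h_cyclic[OF refl dom.in_exponentsD[OF assms] this]
  have "(\<Sum>i\<le>length xs. \<Sum>(\<alpha>, \<beta>)\<in>dom.splits \<gamma>.
      pairA (h i (fst \<alpha>, 2 * snd \<alpha>) (take i xs)) (h (length xs - i) (fst \<beta>, 2 * snd \<beta>) (drop i xs))) = 0"
    unfolding dom.sum_splits_double .
  moreover have "(\<Sum>i\<le>length xs. \<Sum>(\<alpha>, \<beta>)\<in>dom.splits \<gamma>.
      pairA (component h \<alpha> (take i xs)) (component h \<beta> (drop i xs))) =
    (\<Sum>i\<le>length xs. \<Sum>(\<alpha>, \<beta>)\<in>dom.splits \<gamma>.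
      pairA (h i (fst \<alpha>, 2 * snd \<alpha>) (take i xs)) (h (length xs - i) (fst \<beta>, 2 * snd \<beta>) (drop i xs)))"
    by (rule sum.cong[OF refl]) (simp add: component_def min_def)
  ultimately show ?thesis by (simp only: if_not_P[OF False])
qed

text \<open>
  A component with exponent \<open>(\<lambda>, n)\<close> differs in degree by \<open>2 n\<close> from the whole operation.  This is
  even, so all signs are the same as for operations of degree \<open>0\<close> and \<open>1\<close>.
\<close>
theorem cyclic_transfer_components:
  "cyclic_transfer G letters letter_degree (\<lambda>\<gamma> w. component h \<gamma> (map fst w)) (component mA)
    (\<lambda>\<gamma> w. (component mB \<gamma> (map fst w), shifted_degree (map snd w) + 2 - 2 * snd \<gamma>))
    pairA (\<lambda>p q. pairB (fst p) (fst q))"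
proof (unfold_locales, goal_cases)
  case (1 \<gamma> w)
  thus ?case using dom.component_degree[OF letters_graded] by simp
next
  case (2 \<gamma> w)
  show ?case by (simp add: shifted_degree_map_snd)
next
  case (3 x y z)
  show ?case by (rule pairA_add_left)
next
  case (4 \<alpha> \<beta> u v)
  let ?p = "shifted_degree (map snd u)" and ?q = "shifted_degree (map snd v)"
  have "pairA (component h \<alpha> (map fst u)) (component h \<beta> (map fst v)) =
      - koszul ((?p + 1 - 2 * snd \<alpha> - 1) * (?q + 1 - 2 * snd \<beta> - 1))
        (pairA (component h \<beta> (map fst v)) (component h \<alpha> (map fst u)))"
    using 4 by (intro cod.pair_skew component_h_degree letters_graded)
  also have "koszul ((?p + 1 - 2 * snd \<alpha> - 1) * (?q + 1 - 2 * snd \<beta> - 1)) = (koszul (?p * ?q) :: 'k \<Rightarrow> 'k)"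
    by (intro ext koszul_cong) (simp add: algebra_simps)
  finally show ?case by (simp only: shifted_degree_map_snd)
next
  case (5 \<gamma> w)
  show ?case using h_cuts_component[OF 5(1), of "map fst w"] by (simp add: take_map drop_map)
next
  case (6 \<gamma> w)
  have "(\<Sum>(\<alpha>, \<beta>)\<in>dom.splits \<gamma>. \<Sum>ds\<in>dom.blocks \<beta> w.
        component mA \<alpha> (map (\<lambda>(\<gamma>, w). component h \<gamma> (map fst w)) ds)) =
      (\<Sum>(\<alpha>, \<beta>)\<in>dom.splits \<gamma>. \<Sum>bs\<in>dom.blocks \<beta> (map fst w).
        component mA \<alpha> (map (case_prod (component h)) bs))"
    unfolding dom.sum_blocks_map by (simp add: split_def comp_def apsnd_def)
  also have "\<dots> = (\<Sum>(i, j) | i + j \<le> length (map fst w). \<Sum>(\<alpha>, \<beta>)\<in>dom.splits \<gamma>.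
      koszul (shifted_degree (take i (map snd w)))
       (component h \<alpha> (take i (map fst w) @ component mB \<beta> (take j (drop i (map fst w))) # drop (i + j) (map fst w))))"
    by (rule hom_relation_component[OF letters_graded[OF 6(2)] 6(1)])
  finally show ?case
    by (simp only: take_map drop_map shifted_degree_map_snd map_append list.map fst_conv length_map)
next
  case (7 \<alpha> d ds)
  let ?h = "\<lambda>(\<gamma>, w). component h \<gamma> (map fst w)"
  let ?deg = "\<lambda>d. shifted_degree (map snd (snd d)) + 1 - 2 * snd (fst d)"
  have mem: "?h d \<in> grA (?deg d)" if "d \<in> dom.exponents \<times> lists letters" for d
    using that component_h_degree[OF letters_graded[of "snd d"], of "fst d"] by (cases d) auto
  have lst: "list_all2 (\<lambda>d x. x \<in> grA d) (map ?deg ds) (map ?h ds)"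
    unfolding list.rel_map by (rule list.rel_refl_strong, rule mem) (use 7(2) in auto)
  have tot: "shifted_degree (map ?deg ds) = total letter_degree (concat (map snd ds)) - 2 * (\<Sum>d\<leftarrow>ds. snd (fst d))"
    by (induction ds) (simp_all add: shifted_degree_def comp_def)
  have "pairA (mA (length ds) (fst \<alpha>, 2 * snd \<alpha>) (butlast (?h d # map ?h ds))) (last (?h d # map ?h ds)) =
      koszul ((?deg d - 1) * shifted_degree (map ?deg ds))
        (pairA (mA (length ds) (fst \<alpha>, 2 * snd \<alpha>) (map ?h ds)) (?h d))"
    by (rule cod.m_cyclic[OF dom.in_exponentsD[OF 7(1)] mem lst]) (use 7(2) in auto)
  also have "koszul ((?deg d - 1) * shifted_degree (map ?deg ds)) =
      (koszul (total letter_degree (snd d) * total letter_degree (concat (map snd ds))) :: 'k \<Rightarrow> 'k)"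
    unfolding tot by (intro ext koszul_cong) (simp add: shifted_degree_map_snd algebra_simps)
  finally have rot: "pairA (mA (length ds) (fst \<alpha>, 2 * snd \<alpha>) (butlast (?h d # map ?h ds)))
        (last (?h d # map ?h ds)) =
      koszul (total letter_degree (snd d) * total letter_degree (concat (map snd ds)))
        (pairA (mA (length ds) (fst \<alpha>, 2 * snd \<alpha>) (map ?h ds)) (?h d))" .
  have bl: "map ?h (butlast (d # ds)) = butlast (?h d # map ?h ds)"
    and la: "?h (last (d # ds)) = last (?h d # map ?h ds)"
    and len: "length (butlast (?h d # map ?h ds)) = length ds"
    by (simp_all add: map_butlast last_map)
  show ?case unfolding bl la component_def[of mA] len length_map by (rule rot)
qed

end


section \<open>Coefficients of substitutions and cyclizations\<close>

text \<open>
  The factor of a product of the series \<open>\<sigma> i\<close>, for \<open>i\<close> in \<open>u\<close>, that comes from choosing in each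
  of them the variables of one block and the exponent attached to it.
\<close>
abbreviation word_coeff ::
  "('i \<Rightarrow> ('j, 'k::comm_ring_1 novikov) nc_series) \<Rightarrow> 'i list \<Rightarrow> ((real \<times> int) \<times> 'j list) list \<Rightarrow> 'k"
  where "word_coeff \<sigma> u ds \<equiv> prod_list (map2 (\<lambda>i (g, b). nov_coeff (\<sigma> i b) g) u ds)"

context gapping_monoid
begin

text \<open>
  Together with \<open>gap\<close>, the assumption \<open>zero\<close> says that the constant terms of the substituted
  series have positive energy; it accounts for the exclusion of empty blocks of exponent \<open>0\<close>.
\<close>
lemma nc_product_coeff:
  fixes \<sigma> :: "'i \<Rightarrow> ('j, 'k::comm_ring_1 novikov) nc_series"
  assumes gap: "\<And>i b. gapped (\<sigma> i b)" and zero: "\<And>i. nov_coeff (\<sigma> i []) 0 = 0"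
  shows "gapped (foldr nc_mult (map \<sigma> u) (nc_const 1) w) \<and>
    nov_coeff (foldr nc_mult (map \<sigma> u) (nc_const 1) w) \<beta> =
      (\<Sum>ds | ds \<in> blocks \<beta> w \<and> length ds = length u. word_coeff \<sigma> u ds)"
proof (induction u arbitrary: w \<beta>)
  case Nil
  have "{ds \<in> blocks \<beta> w. ds = []} = (if w = [] \<and> \<beta> = 0 then {[]} else {})"
    by (auto simp: blocks_def)
  thus ?case
    by (simp add: nc_const_def one_novikov_def gapped_const nov_coeff_const gapped_def zero_novikov.rep_eq
        zero_in_exponents)
next
  case (Cons i u)
  let ?R = "foldr nc_mult (map \<sigma> u) (nc_const 1)"
  let ?B = "\<lambda>b k. {ds \<in> blocks b (drop k w). length ds = length u}"
  have gapR: "gapped (?R v)" for v using Cons.IH by blast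
  have prod: "foldr nc_mult (map \<sigma> (i # u)) (nc_const 1) w = (\<Sum>k\<le>length w. \<sigma> i (take k w) * ?R (drop k w))"
    by (simp add: nc_mult_def)
  define P where "P = (SIGMA k:{..length w}. SIGMA p:splits \<beta>. ?B (snd p) k)"
  let ?f = "\<lambda>(k, p, ds). nov_coeff (\<sigma> i (take k w)) (fst p) * word_coeff \<sigma> u ds"
  have finB: "finite (?B b k)" for b k by (rule finite_subset[OF _ finite_blocks]) auto
  have "nov_coeff (foldr nc_mult (map \<sigma> (i # u)) (nc_const 1) w) \<beta> =
      (\<Sum>k\<le>length w. \<Sum>p\<in>splits \<beta>. \<Sum>ds\<in>?B (snd p) k. ?f (k, p, ds))"
    unfolding prod nov_coeff_sum nov_coeff_times_gapped[OF gap gapR] Cons.IH[THEN conjunct2]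
    by (simp add: sum_distrib_left split_def)
  also have "\<dots> = (\<Sum>(k, p, ds)\<in>P. ?f (k, p, ds))"
    unfolding P_def by (rule sum_Sigma3) (auto simp: finite_splits finB)
  also have "\<dots> = (\<Sum>x\<in>P - {x. fst x = 0 \<and> fst (fst (snd x)) = 0}. ?f x)"
  proof (rule sum.mono_neutral_cong_right)
    show "finite P" unfolding P_def by (intro finite_SigmaI finite_splits finB) auto
  qed (auto simp: zero)
  also have "\<dots> = (\<Sum>ds | ds \<in> blocks \<beta> w \<and> length ds = length (i # u). word_coeff \<sigma> (i # u) ds)"
  proof (rule sum.reindex_bij_witness[of _
        "\<lambda>ds. (length (snd (hd ds)), (fst (hd ds), sum_list (map fst (tl ds))), tl ds)"
        "\<lambda>(k, p, ds). (fst p, take k w) # ds"], goal_cases)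
    case (1 x)
    thus ?case by (auto simp: P_def blocks_def splits_def)
  next
    case (2 x)
    obtain k \<alpha> \<beta>' ds where x: "x = (k, (\<alpha>, \<beta>'), ds)" by (metis prod.exhaust)
    have m: "k \<le> length w" "\<alpha> \<in> \<Gamma>" "\<alpha> + \<beta>' = \<beta>" "ds \<in> blocks \<beta>' (drop k w)" "length ds = length u"
      "\<not> (k = 0 \<and> \<alpha> = 0)"
      using 2 x by (auto simp: P_def splits_def)
    have "\<alpha> = 0 \<Longrightarrow> take k w \<noteq> []" using m by auto
    thus ?case using m by (auto simp: x blocks_def)
  next
    case (3 ds)
    then obtain d es where ds: "ds = d # es" by (cases ds) auto
    have w: "w = snd d @ concat (map snd es)" using 3 ds by (auto simp: blocks_def)
    show ?case unfolding ds w by simp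
  next
    case (4 ds)
    then obtain d es where ds: "ds = d # es" by (cases ds) auto
    obtain g b where d: "d = (g, b)" by (cases d)
    have b: "set es \<subseteq> \<Gamma> \<times> UNIV - {(0, [])}" "g \<in> \<Gamma>" "(g, b) \<noteq> (0, [])"
      "w = b @ concat (map snd es)" "\<beta> = g + sum_list (map fst es)" "length es = length u"
      using 4 ds d by (auto simp: blocks_def)
    have "sum_list (map fst es) \<in> \<Gamma>" using b(1) by (intro sum_list_in_exponents) auto
    thus ?case using b by (auto simp: P_def splits_def blocks_def ds d)
  next
    case (5 x)
    thus ?case by (auto simp: P_def)
  qed
  finally have "nov_coeff (foldr nc_mult (map \<sigma> (i # u)) (nc_const 1) w) \<beta> =
      (\<Sum>ds | ds \<in> blocks \<beta> w \<and> length ds = length (i # u). word_coeff \<sigma> (i # u) ds)" .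
  moreover have "gapped (foldr nc_mult (map \<sigma> (i # u)) (nc_const 1) w)"
    unfolding prod by (intro gapped_sum gapped_times gap gapR)
  ultimately show ?case by blast
qed

text \<open>
  The number of blocks of a decomposition is bounded in terms of the energy and of \<open>w\<close>, so only
  finitely many words \<open>u\<close> contribute below a given energy and the substitution converges.
\<close>
lemma nov_coeff_nc_subst:
  fixes \<sigma> :: "'i \<Rightarrow> ('j, 'k::comm_ring_1 novikov) nc_series"
  assumes I: "finite I" and \<Phi>: "\<And>u. gapped (\<Phi> u)"
    and gap: "\<And>i b. gapped (\<sigma> i b)" and zero: "\<And>i. nov_coeff (\<sigma> i []) 0 = 0"
  shows "nov_coeff (nc_subst I \<sigma> \<Phi> w) \<gamma> =
    (\<Sum>(\<alpha>, \<beta>)\<in>splits \<gamma>. \<Sum>ds\<in>blocks \<beta> w. \<Sum>u | u \<in> lists I \<and> length u = length ds.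
       nov_coeff (\<Phi> u) \<alpha> * word_coeff \<sigma> u ds)"
proof -
  let ?F = "\<lambda>u. \<Phi> u * foldr nc_mult (map \<sigma> u) (nc_const 1) w"
  let ?B = "\<lambda>\<beta> u. {ds \<in> blocks \<beta> w. length ds = length (u :: 'i list)}"
  let ?t = "\<lambda>\<alpha> u ds. nov_coeff (\<Phi> u) \<alpha> * word_coeff \<sigma> u ds"
  note P = nc_product_coeff[of \<sigma>, OF gap zero]
  have coeff_F: "nov_coeff (?F u) \<gamma> = (\<Sum>(\<alpha>, \<beta>)\<in>splits \<gamma>. \<Sum>ds\<in>?B \<beta> u. ?t \<alpha> u ds)" for u \<gamma>
    using nov_coeff_times_gapped[OF \<Phi> P[THEN conjunct1]] P[THEN conjunct2]
    by (simp add: sum_distrib_left)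
  have finU: "finite {u \<in> lists I. length u = n}" for n
    using finite_lists_length_eq[OF I, of n] by (simp add: lists_eq_set)
  define S where "S \<gamma> = (\<Union>p\<in>splits \<gamma>. \<Union>ds\<in>blocks (snd p) w. {u \<in> lists I. length u = length ds})" for \<gamma>
  have finS: "finite (S \<gamma>)" for \<gamma>
    unfolding S_def using finite_splits finite_blocks finU by blast
  have supp: "u \<in> S \<gamma> \<and> \<gamma> \<in> \<Gamma>" if "u \<in> lists I" "nov_coeff (?F u) \<gamma> \<noteq> 0" for u \<gamma>
  proof -
    have "(\<Sum>(\<alpha>, \<beta>)\<in>splits \<gamma>. \<Sum>ds\<in>?B \<beta> u. ?t \<alpha> u ds) \<noteq> 0" using that(2) coeff_F by simp
    from sum.not_neutral_contains_not_neutral[OF this] obtain p where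
      p: "p \<in> splits \<gamma>" "(case p of (\<alpha>, \<beta>) \<Rightarrow> \<Sum>ds\<in>?B \<beta> u. ?t \<alpha> u ds) \<noteq> 0" by blast
    from p(2) have p2: "(\<Sum>ds\<in>?B (snd p) u. ?t (fst p) u ds) \<noteq> 0" unfolding split_def .
    from sum.not_neutral_contains_not_neutral[OF p2] obtain ds where "ds \<in> ?B (snd p) u" by blast
    thus ?thesis using p(1) that(1) splits_outside[of \<gamma>] unfolding S_def by fastforce
  qed
  have summable: "nov_summable ?F (lists I)"
    unfolding nov_summable_def
  proof
    fix E
    have "{u \<in> lists I. ?F u \<notin> nov_filtration E} \<subseteq> (\<Union>\<gamma>\<in>{\<gamma>\<in>\<Gamma>. fst \<gamma> \<le> E}. S \<gamma>)"
    proof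
      fix u assume u: "u \<in> {u \<in> lists I. ?F u \<notin> nov_filtration E}"
      then obtain \<gamma> where \<gamma>: "nov_coeff (?F u) \<gamma> \<noteq> 0" "fst \<gamma> < E"
        by (auto simp: nov_filtration_def not_le)
      have "\<gamma> \<in> {\<gamma>\<in>\<Gamma>. fst \<gamma> \<le> E}" "u \<in> S \<gamma>" using supp[OF _ \<gamma>(1)] \<gamma>(2) u by simp_all
      thus "u \<in> (\<Union>\<gamma>\<in>{\<gamma>\<in>\<Gamma>. fst \<gamma> \<le> E}. S \<gamma>)" by blast
    qed
    thus "finite {u \<in> lists I. ?F u \<notin> nov_filtration E}"
      by (rule finite_subset) (use finS finite_exponents_le in blast)
  qed
  have "nov_coeff (nc_subst I \<sigma> \<Phi> w) \<gamma> = (\<Sum>u\<in>S \<gamma>. nov_coeff (?F u) \<gamma>)"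
    unfolding nc_subst_def
    by (rule nov_coeff_nov_sum[OF summable finS]) (use supp[of _ \<gamma>] in \<open>auto simp: S_def\<close>)
  also have "\<dots> = (\<Sum>(\<alpha>, \<beta>)\<in>splits \<gamma>. \<Sum>u\<in>S \<gamma>. \<Sum>ds\<in>?B \<beta> u. ?t \<alpha> u ds)"
    unfolding coeff_F split_def by (rule sum.swap)
  also have "\<dots> = (\<Sum>(\<alpha>, \<beta>)\<in>splits \<gamma>. \<Sum>ds\<in>blocks \<beta> w. \<Sum>u | u \<in> lists I \<and> length u = length ds. ?t \<alpha> u ds)"
  proof (rule sum.cong[OF refl], clarify)
    fix a b c d assume s: "((a, b), c, d) \<in> splits \<gamma>"
    have "(\<Sum>u\<in>S \<gamma>. \<Sum>ds\<in>?B (c, d) u. ?t (a, b) u ds) =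
        (\<Sum>(u, ds)\<in>(SIGMA u:S \<gamma>. ?B (c, d) u). ?t (a, b) u ds)"
      by (rule sum.Sigma) (auto simp: finS finite_blocks)
    also have "\<dots> = (\<Sum>(ds, u)\<in>(SIGMA ds:blocks (c, d) w. {u \<in> lists I. length u = length ds}). ?t (a, b) u ds)"
      by (rule sum.reindex_bij_witness[of _ "\<lambda>(ds, u). (u, ds)" "\<lambda>(u, ds). (ds, u)"])
         (use s in \<open>force simp: S_def\<close>)+
    also have "\<dots> = (\<Sum>ds\<in>blocks (c, d) w. \<Sum>u | u \<in> lists I \<and> length u = length ds. ?t (a, b) u ds)"
      by (rule sum.Sigma[symmetric]) (auto simp: finU finite_blocks)
    finally show "(\<Sum>u\<in>S \<gamma>. \<Sum>ds\<in>?B (c, d) u. ?t (a, b) u ds) =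
      (\<Sum>ds\<in>blocks (c, d) w. \<Sum>u | u \<in> lists I \<and> length u = length ds. ?t (a, b) u ds)" .
  qed
  finally show ?thesis .
qed

end

lemma linear_functional_basis_expansion:
  assumes "Vector_Spaces.linear s (*) \<phi>" "finite I" "homogeneous_basis s gr I e d"
  shows "\<phi> y = (\<Sum>i\<in>I. module.representation s (e ` I) y (e i) * \<phi> (e i))"
proof -
  interpret vector_space s using assms(1) by (simp add: Vector_Spaces.linear_iff)
  have b: "inj_on e I" "independent (e ` I)" "span (e ` I) = UNIV"
    using assms(3) by (auto simp: homogeneous_basis_def)
  have add: "\<phi> (x + y) = \<phi> x + \<phi> y" and scale: "\<phi> (s c x) = c * \<phi> x" for x y c
    using assms(1) by (auto simp: Vector_Spaces.linear_iff)
  have zero: "\<phi> 0 = 0" using scale[of 0 0] by simp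
  have "y = (\<Sum>b\<in>e ` I. s (representation (e ` I) y b) b)"
    using b(2,3) assms(2) by (intro sum_representation_eq[symmetric]) auto
  also have "\<dots> = (\<Sum>i\<in>I. s (representation (e ` I) y (e i)) (e i))"
    by (rule sum.reindex[OF b(1), unfolded comp_def])
  finally have "\<phi> y = \<phi> (\<Sum>i\<in>I. s (representation (e ` I) y (e i)) (e i))" by simp
  also have "\<phi> (sum f A) = (\<Sum>i\<in>A. \<phi> (f i))" for f and A :: "'c set"
    by (induction A rule: infinite_finite_induct) (simp_all add: zero add)
  finally show ?thesis by (simp add: scale)
qed

lemma multilinear_basis_expansion:
  fixes ys :: "'b::ab_group_add list"
  assumes "multilinear (length ys) s (*) \<Psi>" "finite I" "homogeneous_basis s gr I e d"
  shows "\<Psi> ys = (\<Sum>u | u \<in> lists I \<and> length u = length ys.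
    prod_list (map2 (\<lambda>i y. module.representation s (e ` I) y (e i)) u ys) * \<Psi> (map e u))"
  using assms(1)
proof (induction ys arbitrary: \<Psi>)
  case Nil
  have "{u \<in> lists I. u = []} = {[]}" by auto
  thus ?case by simp
next
  case (Cons y ys)
  let ?r = "\<lambda>y i. module.representation s (e ` I) y (e i)"
  let ?U = "\<lambda>n. {u \<in> lists I. length u = n}"
  let ?p = "\<lambda>u ys. prod_list (map2 (\<lambda>i y. ?r y i) u ys)"
  have finU: "finite (?U n)" for n
    using finite_lists_length_eq[OF assms(2), of n] by (simp add: lists_eq_set)
  have tail: "multilinear (length ys) s (*) (\<lambda>zs. \<Psi> (x # zs))" for x
    unfolding multilinear_def
  proof (intro allI impI)
    fix xs :: "'b list" and i assume "length xs = length ys \<and> i < length ys"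
    hence "Vector_Spaces.linear s (*) (\<lambda>z. \<Psi> ((x # xs)[Suc i := z]))"
      using Cons.prems unfolding multilinear_def by (metis Suc_less_eq length_Cons)
    thus "Vector_Spaces.linear s (*) (\<lambda>z. \<Psi> (x # xs[i := z]))" by simp
  qed
  have "Vector_Spaces.linear s (*) (\<lambda>z. \<Psi> ((y # ys)[0 := z]))"
    using Cons.prems unfolding multilinear_def by blast
  hence lin: "Vector_Spaces.linear s (*) (\<lambda>z. \<Psi> (z # ys))" by simp
  have "\<Psi> (y # ys) = (\<Sum>i\<in>I. ?r y i * \<Psi> (e i # ys))"
    by (rule linear_functional_basis_expansion[OF lin assms(2,3)])
  also have "\<dots> = (\<Sum>i\<in>I. \<Sum>u\<in>?U (length ys). ?p (i # u) (y # ys) * \<Psi> (map e (i # u)))"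
    by (intro sum.cong refl) (simp add: Cons.IH[OF tail] sum_distrib_left mult.assoc)
  also have "\<dots> = (\<Sum>(i, u)\<in>I \<times> ?U (length ys). ?p (i # u) (y # ys) * \<Psi> (map e (i # u)))"
    by (rule sum.cartesian_product)
  also have "\<dots> = (\<Sum>u\<in>?U (length (y # ys)). ?p u (y # ys) * \<Psi> (map e u))"
    by (rule sum.reindex_bij_witness[of _ "\<lambda>u. (hd u, tl u)" "\<lambda>(i, u). i # u"])
       (auto simp: length_Suc_conv)
  finally show ?case .
qed

text \<open>
  The coefficient of a rotation of \<open>w\<close> enters once for each rotation number, whether or not
  \<open>w\<close> is periodic.
\<close>
lemma cyclization_rotations:
  assumes "w \<noteq> []"
  shows "cyclization d S w = nov_const (1 / of_nat (length w)) *
    (\<Sum>s<length w. koszul ((\<Sum>j\<leftarrow>take s w. d j) * (\<Sum>j\<leftarrow>drop s w. d j)) (S (rotate s w)))"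
proof -
  let ?N = "length w" and ?R = "{rotate r w |r. True}"
  let ?k = "\<lambda>r u. (\<Sum>j\<leftarrow>take r u. d j) * (\<Sum>j\<leftarrow>drop r u. d j)"
  let ?c = "nov_const (1 / of_nat ?N) :: 'b novikov"
  have N: "0 < ?N" using assms by simp
  have Req: "?R = (\<lambda>r. rotate r w) ` {..<?N}"
  proof
    show "?R \<subseteq> (\<lambda>r. rotate r w) ` {..<?N}"
    proof
      fix u assume "u \<in> ?R"
      then obtain r where "u = rotate r w" by blast
      hence "u = rotate (r mod ?N) w" by (metis rotate_conv_mod)
      thus "u \<in> (\<lambda>r. rotate r w) ` {..<?N}" using N by simp
    qed
  qed auto
  have finR: "finite ?R" unfolding Req by simp
  have inv: "rotate r u = w \<longleftrightarrow> u = rotate (?N - r) w" if "r < ?N" "length u = ?N" for r u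
  proof
    assume "rotate r u = w"
    hence "rotate (?N - r) w = rotate (?N - r + r) u" by (metis rotate_rotate)
    thus "u = rotate (?N - r) w" using that by simp
  next
    assume "u = rotate (?N - r) w"
    hence "rotate r u = rotate (r + (?N - r)) w" by (simp add: rotate_rotate)
    thus "rotate r u = w" using that by simp
  qed
  have "cyclization d S w = (\<Sum>u\<in>?R. S u * (?c * (\<Sum>r<?N. if rotate r u = w then koszul (?k r u) 1 else 0)))"
    unfolding cyclization_def cyc_monomial_def using assms by (intro sum.cong refl) auto
  also have "\<dots> = ?c * (\<Sum>u\<in>?R. \<Sum>r<?N. if rotate r u = w then koszul (?k r u) (S u) else 0)"
    by (simp add: sum_distrib_left algebra_simps koszul_mult_right[symmetric] if_distrib cong: if_cong)
  also have "(\<Sum>u\<in>?R. \<Sum>r<?N. if rotate r u = w then koszul (?k r u) (S u) else 0) =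
      (\<Sum>r<?N. \<Sum>u\<in>?R. if rotate r u = w then koszul (?k r u) (S u) else 0)"
    by (rule sum.swap)
  also have "\<dots> = (\<Sum>r<?N. koszul (?k r (rotate (?N - r) w)) (S (rotate (?N - r) w)))"
  proof (rule sum.cong[OF refl])
    fix r assume r: "r \<in> {..<?N}"
    have "(\<Sum>u\<in>?R. if rotate r u = w then koszul (?k r u) (S u) else 0) =
        (\<Sum>u\<in>?R. if u = rotate (?N - r) w then koszul (?k r u) (S u) else 0)"
      using r by (intro sum.cong refl) (auto simp: inv)
    also have "\<dots> = koszul (?k r (rotate (?N - r) w)) (S (rotate (?N - r) w))"
      by (subst sum.delta[OF finR]) auto
    finally show "(\<Sum>u\<in>?R. if rotate r u = w then koszul (?k r u) (S u) else 0) =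
      koszul (?k r (rotate (?N - r) w)) (S (rotate (?N - r) w))" .
  qed
  also have "\<dots> = (\<Sum>s<?N. koszul (?k s w) (S (rotate s w)))"
  proof (rule sum.reindex_bij_witness[of _ "\<lambda>s. (?N - s) mod ?N" "\<lambda>r. (?N - r) mod ?N"], goal_cases)
    case (1 r) thus ?case by (cases "r = 0") auto
  next
    case (3 s) thus ?case by (cases "s = 0") auto
  next
    case (5 r)
    show ?case
    proof (cases "r = 0")
      case False
      hence "rotate (?N - r) w = drop (?N - r) w @ take (?N - r) w"
        using 5 by (simp add: rotate_drop_take)
      thus ?thesis using False 5 by (simp add: mult.commute)
    qed simp
  qed (use N in auto)
  finally show ?thesis .
qed


section \<open>Potentials under cyclic homomorphisms\<close>

lemma nov_coeff_struct_const:
  assumes "gapping_monoid G" "vector_space s" "homogeneous_basis s gr I e d"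
    and "\<And>k \<beta>. \<beta> \<in> G \<Longrightarrow> multilinear k t s (f k \<beta>)"
  shows "nov_coeff (struct_const G s f I e u js i) \<gamma> =
    (if \<gamma> \<in> gapping_monoid.exponents G
     then module.representation s (e ` I) (component f \<gamma> (map u js)) (e i) else 0)"
proof -
  interpret gapping_monoid G by (rule assms(1))
  interpret vector_space s by (rule assms(2))
  have "representation (e ` I) 0 (e i) = 0" by (simp add: representation_zero)
  thus ?thesis
    using nov_coeff_nov_extend_const[of t s f "map u js" \<gamma>, OF assms(4)]
    by (simp add: struct_const_def nov_map.rep_eq comp_def)
qed

context cyclic_gapped_ainf_algebra
begin

lemma nov_coeff_potential:
  assumes I: "finite I" and basis: "homogeneous_basis scale gr I e d" and w: "w \<noteq> []"
  shows "nov_coeff (potential G scale m pair I e w) \<gamma> =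
    (if \<gamma> \<in> \<Gamma> then pair (component m \<gamma> (map e (butlast w))) (e (last w)) / of_nat (length w) else 0)"
proof -
  have coeff: "nov_coeff (X * nov_const c) \<gamma> = nov_coeff X \<gamma> * c" for X :: "'k novikov" and c
    using nov_coeff_const_times[of c X \<gamma>] by (simp add: mult.commute)
  note sc = nov_coeff_struct_const[OF gapping_monoid_axioms vector_space_axioms basis m_multilinear]
  have "nov_coeff (potential G scale m pair I e w) \<gamma> = 1 / of_nat (length w) *
      (\<Sum>j\<in>I. nov_coeff (struct_const G scale m I e e (butlast w) j) \<gamma> * pair (e j) (e (last w)))"
    using w by (simp add: potential_def nov_coeff_const_times nov_coeff_sum coeff)
  also have "\<dots> = (if \<gamma> \<in> \<Gamma> then pair (component m \<gamma> (map e (butlast w))) (e (last w)) / of_nat (length w) else 0)"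
    using linear_functional_basis_expansion[OF pair_linear_left[of "e (last w)"] I basis,
        of "component m \<gamma> (map e (butlast w))"]
    by (simp add: sc)
  finally show ?thesis .
qed

lemma gapped_potential:
  assumes "finite I" "homogeneous_basis scale gr I e d"
  shows "gapped (potential G scale m pair I e w)"
proof (cases "w = []")
  case True
  thus ?thesis by (simp add: potential_def gapped_def zero_novikov.rep_eq)
next
  case False
  thus ?thesis unfolding gapped_def nov_coeff_potential[OF assms False] by simp
qed

lemma multilinear_pairing:
  assumes \<alpha>: "\<alpha> \<in> \<Gamma>" and k: "0 < k"
  shows "multilinear k scale (*) (\<lambda>xs. pair (component m \<alpha> (butlast xs)) (last xs))"
  unfolding multilinear_def
proof (intro allI impI)
  fix xs :: "'a list" and i assume xs: "length xs = k \<and> i < k"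
  show "Vector_Spaces.linear scale (*) (\<lambda>x. pair (component m \<alpha> (butlast (xs[i := x]))) (last (xs[i := x])))"
  proof (cases "i = k - 1")
    case True
    have "butlast (xs[i := x]) = butlast xs" "last (xs[i := x]) = x" for x
      using xs k True by (auto simp: butlast_list_update last_list_update)
    thus ?thesis using pair_linear_right by simp
  next
    case False
    have e: "butlast (xs[i := x]) = (butlast xs)[i := x]" "last (xs[i := x]) = last xs" for x
      using xs k False by (cases "xs = []"; auto simp: butlast_list_update last_conv_nth)+
    have "Vector_Spaces.linear scale scale (\<lambda>x. component m \<alpha> ((butlast xs)[i := x]))"
      by (rule component_multilinear[OF \<alpha>]) (use xs False in auto)
    thus ?thesis unfolding e using pair_linear_left[of "last xs"]
      by (auto simp: Vector_Spaces.linear_iff)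
  qed
qed

end

context cyclic_gapped_ainf_hom
begin

text \<open>
  Summing over the words in the basis of the target recombines the coordinates of the values
  of \<open>h\<close> into these values, because the pairing of \<open>m\<close> with its last argument is multilinear.
\<close>
lemma nov_coeff_pullback_potential:
  fixes f :: "'j \<Rightarrow> 'b"
  assumes I: "finite I" and basis: "homogeneous_basis sA grA I e d" and w: "w \<noteq> []"
  defines "hh \<equiv> \<lambda>(g, b). component h g (map f b)"
  shows "nov_coeff (pullback G sA h I e f (potential G sA mA pairA I e) w) \<gamma> =
    (\<Sum>(\<alpha>, \<beta>)\<in>dom.splits \<gamma>. \<Sum>ds\<in>dom.blocks \<beta> w.
      pairA (component mA \<alpha> (map hh (butlast ds))) (hh (last ds)) / of_nat (length ds))"
proof -
  let ?\<sigma> = "\<lambda>i js. struct_const G sA h I e f js i"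
  let ?rep = "\<lambda>y i. module.representation sA (e ` I) y (e i)"
  note sc = nov_coeff_struct_const[OF dom.gapping_monoid_axioms cod.vector_space_axioms basis h_multilinear]
  have gap: "dom.gapped (?\<sigma> i b)" for i b
    unfolding dom.gapped_def by (intro allI impI, rule ccontr, simp add: sc)
  have zero: "nov_coeff (?\<sigma> i []) 0 = 0" for i
    by (simp add: sc component_h_0 cod.representation_zero)
  have "nov_coeff (pullback G sA h I e f (potential G sA mA pairA I e) w) \<gamma> =
    (\<Sum>(\<alpha>, \<beta>)\<in>dom.splits \<gamma>. \<Sum>ds\<in>dom.blocks \<beta> w. \<Sum>u | u \<in> lists I \<and> length u = length ds.
       nov_coeff (potential G sA mA pairA I e u) \<alpha> * word_coeff ?\<sigma> u ds)"
    unfolding pullback_def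
    by (rule dom.nov_coeff_nc_subst) (rule I cod.gapped_potential[OF I basis] gap zero)+
  also have "\<dots> = (\<Sum>(\<alpha>, \<beta>)\<in>dom.splits \<gamma>. \<Sum>ds\<in>dom.blocks \<beta> w.
      pairA (component mA \<alpha> (map hh (butlast ds))) (hh (last ds)) / of_nat (length ds))"
  proof (rule sum.cong[OF refl], clarify, rule sum.cong[OF refl])
    fix a b c d ds assume s: "((a, b), c, d) \<in> dom.splits \<gamma>" and ds: "ds \<in> dom.blocks (c, d) w"
    have ab: "(a, b) \<in> dom.exponents" using s by (simp add: dom.splits_def)
    have ne: "ds \<noteq> []" using ds w by (auto simp: dom.blocks_def)
    let ?\<Psi> = "\<lambda>xs. pairA (component mA (a, b) (butlast xs)) (last xs)"
    have "(\<Sum>u | u \<in> lists I \<and> length u = length ds.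
          nov_coeff (potential G sA mA pairA I e u) (a, b) * word_coeff ?\<sigma> u ds) =
        (\<Sum>u | u \<in> lists I \<and> length u = length ds.
          prod_list (map2 (\<lambda>i y. ?rep y i) u (map hh ds)) * ?\<Psi> (map e u) / of_nat (length ds))"
    proof (rule sum.cong[OF refl])
      fix u assume u: "u \<in> {u \<in> lists I. length u = length ds}"
      hence un: "u \<noteq> []" using ne by auto
      have "word_coeff ?\<sigma> u ds = prod_list (map2 (\<lambda>i y. ?rep y i) u (map hh ds))"
      proof (rule arg_cong[of _ _ prod_list], rule nth_equalityI)
        fix k assume "k < length (map2 (\<lambda>i (g, b). nov_coeff (?\<sigma> i b) g) u ds)"
        hence k: "k < length u" "k < length ds" by auto
        obtain g v where gv: "ds ! k = (g, v)" by (cases "ds ! k")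
        have "(g, v) \<in> set ds" using gv k by (metis nth_mem)
        hence "g \<in> dom.exponents" using ds by (auto simp: dom.blocks_def)
        thus "map2 (\<lambda>i (g, b). nov_coeff (?\<sigma> i b) g) u ds ! k =
            map2 (\<lambda>i y. ?rep y i) u (map hh ds) ! k"
          using k gv by (simp add: sc hh_def)
      qed simp
      moreover have "nov_coeff (potential G sA mA pairA I e u) (a, b) = ?\<Psi> (map e u) / of_nat (length ds)"
        using cod.nov_coeff_potential[OF I basis un, of "(a, b)"] ab u un
        by (simp add: map_butlast last_map)
      ultimately show "nov_coeff (potential G sA mA pairA I e u) (a, b) * word_coeff ?\<sigma> u ds =
          prod_list (map2 (\<lambda>i y. ?rep y i) u (map hh ds)) * ?\<Psi> (map e u) / of_nat (length ds)"
        by simp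
    qed
    also have "\<dots> = ?\<Psi> (map hh ds) / of_nat (length ds)"
      using multilinear_basis_expansion[OF cod.multilinear_pairing[OF ab] I basis, of "map hh ds"] ne
      by (simp add: sum_divide_distrib)
    finally show "(\<Sum>u | u \<in> lists I \<and> length u = length ds.
        nov_coeff (potential G sA mA pairA I e u) (a, b) * word_coeff ?\<sigma> u ds) =
      pairA (component mA (a, b) (map hh (butlast ds))) (hh (last ds)) / of_nat (length ds)"
      using ne by (simp add: map_butlast last_map)
  qed
  finally show ?thesis .
qed

text \<open>
  For each exponent this is \<open>cyclized_polygon_sum\<close>, applied to the basis vectors that the
  variables of \<open>w\<close> stand for.  Both sides carry the same factor, one over the length of \<open>w\<close>: on the
  left it belongs to the definition of the potential, on the right it comes from averaging over
  rotations.  The degrees of the variables and of the basis vectors differ by a sign only, which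
  leaves the parities unchanged.
\<close>
theorem potential_eq_cyclized_pullback:
  assumes I: "finite I" and basisA: "homogeneous_basis sA grA I e dege"
    and J: "finite J" and basisB: "homogeneous_basis sB grB J f degf"
    and w: "w \<in> lists J" "w \<noteq> []"
  shows "potential G sB mB pairB J f w =
    cyclization (\<lambda>j. - (degf j - 1)) (pullback G sA h I e f (potential G sA mA pairA I e)) w"
proof (rule novikov_eqI)
  fix \<gamma>
  interpret T: cyclic_transfer G letters letter_degree "\<lambda>\<gamma> w. component h \<gamma> (map fst w)" "component mA"
      "\<lambda>\<gamma> w. (component mB \<gamma> (map fst w), shifted_degree (map snd w) + 2 - 2 * snd \<gamma>)"
      pairA "\<lambda>p q. pairB (fst p) (fst q)"
    by (rule cyclic_transfer_components)
  let ?l = "\<lambda>j. (f j, degf j)" and ?N = "length w"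
  let ?S = "pullback G sA h I e f (potential G sA mA pairA I e)"
  let ?hh = "\<lambda>(g, b). component h g (map f b)"
  let ?Y = "map ?l (butlast w)" and ?z = "?l (last w)"
  let ?D = "total letter_degree ?Y + letter_degree ?z"
  have N: "?N = Suc (length ?Y)" using w(2) by simp
  have wYz: "w = butlast w @ [last w]" using w(2) by simp
  have "f j \<in> grB (degf j)" if "j \<in> J" for j using basisB that by (simp add: homogeneous_basis_def)
  hence let_mem: "?l j \<in> letters" if "j \<in> set w" for j using that w(1) by auto
  have Y: "?Y \<in> lists letters" and z: "?z \<in> letters"
    using let_mem[OF in_set_butlastD] let_mem[OF last_in_set[OF w(2)]] by auto
  have rot: "rotate s w = drop s (butlast w) @ last w # take s (butlast w)" if "s \<le> length ?Y" for s
  proof -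
    have "rotate s (butlast w @ [last w]) = drop s (butlast w) @ last w # take s (butlast w)"
      using that by (simp add: rotate_drop_take)
    thus ?thesis using wYz by simp
  qed
  have pull: "nov_coeff (?S (rotate s w)) \<gamma> = (\<Sum>(\<alpha>, \<beta>)\<in>dom.splits \<gamma>.
      \<Sum>ds\<in>dom.blocks \<beta> (drop s ?Y @ ?z # take s ?Y). T.polygon \<alpha> ds / of_nat (length ds))"
    if s: "s \<le> length ?Y" for s
  proof -
    have "nov_coeff (?S (rotate s w)) \<gamma> = (\<Sum>(\<alpha>, \<beta>)\<in>dom.splits \<gamma>. \<Sum>ds\<in>dom.blocks \<beta> (rotate s w).
        pairA (component mA \<alpha> (map ?hh (butlast ds))) (?hh (last ds)) / of_nat (length ds))"
      by (rule nov_coeff_pullback_potential[OF I basisA]) (use w(2) in simp)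
    also have "\<dots> = (\<Sum>(\<alpha>, \<beta>)\<in>dom.splits \<gamma>. \<Sum>ds\<in>dom.blocks \<beta> (rotate s w).
        T.polygon \<alpha> (map (apsnd (map ?l)) ds) / of_nat (length (map (apsnd (map ?l)) ds)))"
    proof (rule sum.cong[OF refl], clarify, rule sum.cong[OF refl])
      fix a b c d ds assume "ds \<in> dom.blocks (c, d) (rotate s w)"
      hence "concat (map snd ds) \<noteq> []" using w(2) by (simp add: dom.blocks_def)
      hence ne: "ds \<noteq> []" by auto
      have "(\<lambda>(\<gamma>, w). component h \<gamma> (map fst w)) (apsnd (map ?l) x) = ?hh x" for x
        by (simp add: split_def comp_def)
      thus "pairA (component mA (a, b) (map ?hh (butlast ds))) (?hh (last ds)) / of_nat (length ds) =
          T.polygon (a, b) (map (apsnd (map ?l)) ds) / of_nat (length (map (apsnd (map ?l)) ds))"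
        using ne by (simp add: T.polygon_def map_butlast[symmetric] last_map comp_def)
    qed
    also have "\<dots> = (\<Sum>(\<alpha>, \<beta>)\<in>dom.splits \<gamma>. \<Sum>ds\<in>dom.blocks \<beta> (map ?l (rotate s w)).
        T.polygon \<alpha> ds / of_nat (length ds))"
      by (simp only: dom.sum_blocks_map)
    also have "map ?l (rotate s w) = drop s ?Y @ ?z # take s ?Y"
      by (simp add: rot[OF s] drop_map take_map)
    finally show ?thesis .
  qed
  have "nov_coeff (cyclization (\<lambda>j. - (degf j - 1)) ?S w) \<gamma> = 1 / of_nat ?N *
      (\<Sum>s<?N. koszul ((\<Sum>j\<leftarrow>take s w. - (degf j - 1)) * (\<Sum>j\<leftarrow>drop s w. - (degf j - 1)))
        (nov_coeff (?S (rotate s w)) \<gamma>))"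
    unfolding cyclization_rotations[OF w(2)] nov_coeff_const_times nov_coeff_sum nov_coeff_koszul ..
  also have "\<dots> = 1 / of_nat ?N * (\<Sum>s\<le>length ?Y. koszul ((?D - 1) * total letter_degree (take s ?Y))
      (\<Sum>(\<alpha>, \<beta>)\<in>dom.splits \<gamma>. \<Sum>ds\<in>dom.blocks \<beta> (drop s ?Y @ ?z # take s ?Y).
        T.polygon \<alpha> ds / of_nat (length ds)))"
  proof (rule arg_cong[of _ _ "(*) _"], rule sum.cong)
    show "{..<?N} = {..length ?Y}" unfolding N by (rule lessThan_Suc_atMost)
    fix s assume "s \<in> {..length ?Y}"
    hence s: "s \<le> length ?Y" by simp
    have neg: "(\<Sum>j\<leftarrow>v. - (degf j - 1)) = - total letter_degree (map ?l v)" for v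
      by (induction v) auto
    have tk: "map ?l (take s w) = take s ?Y"
      using s wYz by (metis (no_types, lifting) length_map take_map butlast_conv_take take_take min.absorb1 length_butlast)
    have mw: "map ?l w = ?Y @ [?z]"
      using arg_cong[OF wYz, of "map ?l"] by (simp only: map_append list.map)
    have "total letter_degree (map ?l w) = ?D" unfolding mw by simp
    moreover have "total letter_degree (map ?l w) =
        total letter_degree (map ?l (take s w)) + total letter_degree (map ?l (drop s w))"
    proof -
      have "map ?l w = map ?l (take s w) @ map ?l (drop s w)"
        by (simp only: map_append[symmetric] append_take_drop_id)
      from arg_cong[OF this, of "total letter_degree"] show ?thesis
        by (simp only: map_append sum_list_append)
    qed
    ultimately have dr: "total letter_degree (map ?l (drop s w)) = ?D - total letter_degree (take s ?Y)"
      by (simp only: tk)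
    show "koszul ((\<Sum>j\<leftarrow>take s w. - (degf j - 1)) * (\<Sum>j\<leftarrow>drop s w. - (degf j - 1)))
        (nov_coeff (?S (rotate s w)) \<gamma>) =
      koszul ((?D - 1) * total letter_degree (take s ?Y))
      (\<Sum>(\<alpha>, \<beta>)\<in>dom.splits \<gamma>. \<Sum>ds\<in>dom.blocks \<beta> (drop s ?Y @ ?z # take s ?Y).
        T.polygon \<alpha> ds / of_nat (length ds))"
      unfolding pull[OF s] neg tk dr by (rule koszul_cong) (simp add: algebra_simps)
  qed
  also have "\<dots> = (if \<gamma> \<in> dom.exponents
      then pairB (component mB \<gamma> (map f (butlast w))) (f (last w)) / of_nat ?N else 0)"
  proof (cases "\<gamma> \<in> dom.exponents")
    case True
    show ?thesis using T.cyclized_polygon_sum[OF Y z True refl] True by (simp add: comp_def)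
  next
    case False
    thus ?thesis by (simp add: dom.splits_outside)
  qed
  also have "\<dots> = nov_coeff (potential G sB mB pairB J f w) \<gamma>"
    by (rule dom.nov_coeff_potential[OF J basisB w(2), symmetric])
  finally show "nov_coeff (potential G sB mB pairB J f w) \<gamma> =
    nov_coeff (cyclization (\<lambda>j. - (degf j - 1)) ?S w) \<gamma>" ..
qed

end

lemma homogeneous_basis_finite:
  assumes "finite_dimensional_vector_space s E" "homogeneous_basis s gr I e d"
  shows "finite I"
proof -
  interpret finite_dimensional_vector_space s E by (rule assms(1))
  have "finite (e ` I)" using assms(2) by (intro finiteI_independent) (simp add: homogeneous_basis_def)
  thus ?thesis using assms(2) by (simp add: homogeneous_basis_def finite_image_iff)
qed

theorem theorem8p5:
  fixes G :: "(real \<times> int) set"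
    and sA :: "'k::field_char_0 \<Rightarrow> 'a::ab_group_add \<Rightarrow> 'a"
    and grA :: "int \<Rightarrow> 'a set"
    and mA :: "nat \<Rightarrow> real \<times> int \<Rightarrow> 'a list \<Rightarrow> 'a"
    and pairA :: "'a \<Rightarrow> 'a \<Rightarrow> 'k"
    and sB :: "'k \<Rightarrow> 'b::ab_group_add \<Rightarrow> 'b"
    and grB :: "int \<Rightarrow> 'b set"
    and mB :: "nat \<Rightarrow> real \<times> int \<Rightarrow> 'b list \<Rightarrow> 'b"
    and pairB :: "'b \<Rightarrow> 'b \<Rightarrow> 'k"
    and h :: "nat \<Rightarrow> real \<times> int \<Rightarrow> 'b list \<Rightarrow> 'a"
    and I :: "'i set" and e :: "'i \<Rightarrow> 'a" and dege :: "'i \<Rightarrow> int"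
    and J :: "'j set" and f :: "'j \<Rightarrow> 'b" and degf :: "'j \<Rightarrow> int"
  assumes "cyclic_gapped_ainf_algebra G sA grA mA pairA"
    and "cyclic_gapped_ainf_algebra G sB grB mB pairB"
    and "\<exists>E. finite_dimensional_vector_space sA E"
    and "\<exists>E. finite_dimensional_vector_space sB E"
    and "cyclic_gapped_ainf_hom G sB grB mB pairB sA grA mA pairA h"
    and "homogeneous_basis sA grA I e dege"
    and "homogeneous_basis sB grB J f degf"
  shows "\<exists>c :: 'k novikov. \<forall>w\<in>lists J.
    potential G sB mB pairB J f w =
      cyclization (\<lambda>j. - (degf j - 1)) (pullback G sA h I e f (potential G sA mA pairA I e)) w
      + nc_const c w"
proof -
  interpret cyclic_gapped_ainf_hom G sB grB mB pairB sA grA mA pairA h by (rule assms(5))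
  let ?S = "cyclization (\<lambda>j. - (degf j - 1)) (pullback G sA h I e f (potential G sA mA pairA I e))"
  have I: "finite I" and J: "finite J"
    using assms(3,4,6,7) homogeneous_basis_finite by blast+
  \<comment> \<open>Potentials have no constant term, so the constant has to remove the one of the pullback.\<close>
  have "potential G sB mB pairB J f w = ?S w + nc_const (- ?S []) w" if "w \<in> lists J" for w
  proof (cases "w = []")
    case True
    thus ?thesis by (simp add: potential_def nc_const_def)
  next
    case False
    thus ?thesis using potential_eq_cyclized_pullback[OF I assms(6) J assms(7) that False]
      by (simp add: nc_const_def)
  qed
  thus ?thesis by blast
qed

end
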